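(* Let $\lambda_1,\lambda_2\in\mathbb{R}$ with $\lambda_1\lambda_2>0$, and let $u$ be a solution of the cubic-quintic nonlinear Schrödinger equation $$iu_t+\Delta u=\lambda_1|u|^2u-\lambda_2|u|^4u,\qquad (t,x)\in\mathbb{R}\times\mathbb{R}^n,$$ with $P[u]=0$. Then $u$ cannot be a breather in any of the following regimes: (1) $n=1$ and $\lambda_1E_1[u]\le0$; (2) $n=2$ and $\lambda_2E_1[u]\le0$.
   Context: The momentum and energy are $$P[u]=\mathrm{Im}\int_{\mathbb{R}^n}\bar u\,\nabla_xu\,dx,\qquad E_1[u]=\int_{\mathbb{R}^n}\Big(|\nabla_xu|^2+\tfrac{\lambda_1}{2}|u|^4-\tfrac{\lambda_2}{3}|u|^6\Big)dx .$$ Breather (in the weak sense, which includes standing waves): a solution $u:\mathbb{R}\times\mathbb{R}^n\to\mathbb{C}$, not identically zero, for which there exist $\tau,C,\gamma>0$ and $\alpha^*\ge0$ such that: (i) $u(t+\tau,x)=u(t,x)$ for all $(t,x)\in\mathbb{R}\times\mathbb{R}^n$; (ii) $u(t,\cdot)\in C^\infty(\mathbb{R}^n)\cap H^1(\mathbb{R}^n)$ for all $t\in\mathbb{R}$; (iii) $\sup_{t\in\mathbb{R}}|D_x^\alpha u(t,x)|\le Ce^{-\gamma|x|}$ for all $x\in\mathbb{R}^n$ and all multi-indices $|\alpha|\le\alpha^*$. *)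

theory Defs
  imports "HOL-Analysis.Analysis"
begin

definition pd :: "'n::finite \<Rightarrow> (real ^ 'n \<Rightarrow> complex) \<Rightarrow> real ^ 'n \<Rightarrow> complex" where
  "pd i f x = vector_derivative (\<lambda>s. f (x + s *\<^sub>R axis i 1)) (at 0)"

definition grad :: "(real ^ 'n \<Rightarrow> complex) \<Rightarrow> real ^ 'n \<Rightarrow> complex ^ 'n::finite" where
  "grad f x = (\<chi> i. pd i f x)"

definition laplacian :: "(real ^ 'n::finite \<Rightarrow> complex) \<Rightarrow> real ^ 'n \<Rightarrow> complex" where
  "laplacian f x = (\<Sum>i\<in>UNIV. pd i (pd i f) x)"

primrec Ck :: "nat \<Rightarrow> (real ^ 'n::finite \<Rightarrow> complex) \<Rightarrow> bool" where
  "Ck 0 f \<longleftrightarrow> continuous_on UNIV f"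
| "Ck (Suc k) f \<longleftrightarrow> f differentiable_on UNIV \<and> (\<forall>i. Ck k (pd i f))"

definition smooth :: "(real ^ 'n::finite \<Rightarrow> complex) \<Rightarrow> bool" where
  "smooth f \<longleftrightarrow> (\<forall>k. Ck k f)"

definition test_function :: "(real ^ 'n::finite \<Rightarrow> complex) \<Rightarrow> bool" where
  "test_function \<phi> \<longleftrightarrow> smooth \<phi> \<and> compact (closure {x. \<phi> x \<noteq> 0})"

definition L2 :: "(real ^ 'n::finite \<Rightarrow> complex) \<Rightarrow> bool" where
  "L2 f \<longleftrightarrow> f \<in> borel_measurable lborel \<and> integrable lborel (\<lambda>x. (cmod (f x))\<^sup>2)"

text \<open>The Sobolev space \<open>H\<^sup>1\<close>: square-integrable functions whose weak first-order
  partial derivatives exist and are square-integrable.\<close>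

definition H1 :: "(real ^ 'n::finite \<Rightarrow> complex) \<Rightarrow> bool" where
  "H1 f \<longleftrightarrow> L2 f \<and>
    (\<forall>i. \<exists>g. L2 g \<and>
      (\<forall>\<phi>. test_function \<phi> \<longrightarrow>
        (\<integral>x. f x * pd i \<phi> x \<partial>lborel) = - (\<integral>x. g x * \<phi> x \<partial>lborel)))"

text \<open>A list \<open>[i\<^sub>1, \<dots>, i\<^sub>m]\<close> of coordinate directions encodes the multi-index of order \<open>m\<close> that
  counts the occurrences of each direction. Partial derivatives of smooth functions commute, so
  lists of length at most \<open>m\<close> give exactly the derivatives \<open>D\<^sup>\<alpha>\<close> with \<open>\<bar>\<alpha>\<bar> \<le> m\<close>.\<close>

definition deriv_along :: "'n list \<Rightarrow> (real ^ 'n::finite \<Rightarrow> complex) \<Rightarrow> real ^ 'n \<Rightarrow> complex" where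
  "deriv_along \<alpha> f = foldr pd \<alpha> f"

text \<open>Solutions are classical: \<open>u t\<close> is \<open>C\<^sup>2\<close> in space, the time derivative exists everywhere and
  is jointly continuous, and the equation holds at every point.\<close>

definition cqnls_solution :: "real \<Rightarrow> real \<Rightarrow> (real \<Rightarrow> real ^ 'n::finite \<Rightarrow> complex) \<Rightarrow> bool" where
  "cqnls_solution l1 l2 u \<longleftrightarrow>
    (\<forall>t. Ck 2 (u t)) \<and>
    (\<exists>ut. (\<forall>t x. ((\<lambda>s. u s x) has_vector_derivative ut t x) (at t)) \<and>
          continuous_on UNIV (\<lambda>(t, x). ut t x) \<and>
          (\<forall>t x. \<i> * ut t x + laplacian (u t) x =
             of_real (l1 * cmod (u t x) ^ 2) * u t x - of_real (l2 * cmod (u t x) ^ 4) * u t x))"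

text \<open>Momentum and energy of a time slice. Bochner integrals of non-integrable functions are \<open>0\<close>
  by convention; this does not occur for the time slices of a breather, which are bounded and lie
  in \<open>C\<^sup>\<infinity> \<inter> H\<^sup>1\<close>.\<close>

definition momentum :: "(real ^ 'n::finite \<Rightarrow> complex) \<Rightarrow> real ^ 'n" where
  "momentum f = (\<chi> i. Im (\<integral>x. cnj (f x) * grad f x $ i \<partial>lborel))"

definition energy :: "real \<Rightarrow> real \<Rightarrow> (real ^ 'n::finite \<Rightarrow> complex) \<Rightarrow> real" where
  "energy l1 l2 f =
    (\<integral>x. norm (grad f x) ^ 2 + l1 / 2 * cmod (f x) ^ 4 - l2 / 3 * cmod (f x) ^ 6 \<partial>lborel)"

definition breather :: "real \<Rightarrow> real \<Rightarrow> (real \<Rightarrow> real ^ 'n::finite \<Rightarrow> complex) \<Rightarrow> bool" where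
  "breather l1 l2 u \<longleftrightarrow>
    cqnls_solution l1 l2 u \<and>
    (\<exists>t x. u t x \<noteq> 0) \<and>
    (\<exists>\<tau> C \<gamma> :: real. \<exists>m :: nat. \<tau> > 0 \<and> C > 0 \<and> \<gamma> > 0 \<and>
      (\<forall>t x. u (t + \<tau>) x = u t x) \<and>
      (\<forall>t. smooth (u t) \<and> H1 (u t)) \<and>
      (\<forall>\<alpha> x t. length \<alpha> \<le> m \<longrightarrow> cmod (deriv_along \<alpha> (u t) x) \<le> C * exp (- \<gamma> * norm x)))"

end

theory Submission imports Defs
begin

text \<open>The classical argument sets \<open>n = 1, 2\<close> in the virial identity
  \<open>d/dt Im \<integral> cnj u (x \<bullet> \<nabla>u) = 2 \<integral> \<bar>\<nabla>u\<bar>\<^sup>2 + n \<integral> H(u)\<close>, with \<open>H = l1/2 \<bar>u\<bar>\<^sup>4 - 2 l2/3 \<bar>u\<bar>\<^sup>6\<close>: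
  its mean over a period vanishes, while its right-hand side is twice the conserved energy minus
  \<open>l1/2 \<integral> \<bar>u\<bar>\<^sup>4\<close> or \<open>2 l2/3 \<integral> \<bar>u\<bar>\<^sup>6\<close>, of the sign of \<open>l1\<close> or \<open>l2\<close>.
  Only \<open>u\<close> itself is known to decay uniformly in time, so gradients are replaced by translation
  differences \<open>u(x + s e) - u(x)\<close>. For \<open>Q(s,t) = \<integral> \<bar>u(x + s e) - u(x)\<bar>\<^sup>2 dx\<close> the equation, tested on
  mollifications of \<open>u\<close>, gives \<open>\<bar>dQ/dt\<bar> \<le> L Q\<close> and, with the mean over a period written \<open>q(s)\<close>,
  \<open>q(s) = - s\<^sup>2/2 \<integral>\<integral> H + O(\<integral>\<^sub>0\<^sup>s q)\<close>. Together these yield \<open>Q(s,t) \<le> M s\<^sup>2\<close>, so that \<open>u(t)\<close> is bounded in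
  \<open>H\<^sup>1\<close> uniformly in time, and \<open>Q/s\<^sup>2\<close> converges to \<open>\<integral> \<bar>\<partial>u\<bar>\<^sup>2\<close>; conservation of energy follows from a spatial
  cut-off and dominated convergence in time.\<close>

subsection \<open>Exponentially decaying families\<close>

text \<open>The obstacle is that regularity in space is given for each time separately: a priori the
  gradient norm is neither bounded nor continuous in time, so neither the virial quantity nor the
  kinetic energy may be differentiated directly. The way out is the correlation C(s,t) = \<integral>
  u(x + s e) cnj(u(x)) dx. The Laplacian commutes with translations, so it contributes nothing to
  dC/dt; with the weight s/2 + x_j in the integrand it contributes exactly a multiple of dC/ds.
  Averaging over a period removes the time derivative, and integrating in s leaves Re (C(S) - C(0)),
  which is -Q/2. The result is a virial identity without gradients, valid in each coordinate
  direction separately. Its error term is absorbed at a point where q is maximal, so the gradient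
  bound that is uniform in time comes out of the identity itself, and gradients enter only
  afterwards, as limits of quotients.\<close>

lemma integrable_exp_norm:
  fixes \<gamma> :: real
  assumes "\<gamma> > 0"
  shows "integrable lborel (\<lambda>x::'a::euclidean_space. exp (- \<gamma> * norm x))"
proof (rule integrableI_bounded)
  show "(\<lambda>x::'a. exp (- \<gamma> * norm x)) \<in> borel_measurable lborel" by measurable
  let ?d = "DIM('a)"
  let ?v = "unit_ball_vol (real ?d)"
  have vpos: "?v \<ge> 0" by simp
  \<comment> \<open>Balls instead of shells dominate as well, and their volume is an explicit
    polynomial in \<open>k\<close>.\<close>
  have pw: "ennreal (norm (exp (- \<gamma> * norm x))) \<le> (\<Sum>k. ennreal (exp (- \<gamma> * real k)) * indicator (ball 0 (real k + 1)) x)" for x :: 'a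
  proof -
    let ?k = "nat \<lfloor>norm x\<rfloor>"
    have k1: "real ?k \<le> norm x" by (simp add: of_nat_floor)
    have k2: "norm x < real ?k + 1" by linarith
    have "ennreal (norm (exp (- \<gamma> * norm x))) \<le> ennreal (exp (- \<gamma> * real ?k)) * indicator (ball 0 (real ?k + 1)) x"
      using k1 k2 assms by (auto intro!: ennreal_leI)
    also have "\<dots> = (\<Sum>k\<in>{?k}. ennreal (exp (- \<gamma> * real k)) * indicator (ball 0 (real k + 1)) x)" by simp
    also have "\<dots> \<le> (\<Sum>k. ennreal (exp (- \<gamma> * real k)) * indicator (ball 0 (real k + 1)) x)"
      by (rule sum_le_suminf) auto
    finally show ?thesis .
  qed
  \<comment> \<open>Half of the rate absorbs the polynomial volume, the other half leaves a
    geometric series.\<close>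
  have summ: "summable (\<lambda>k. exp (- \<gamma> * real k) * (?v * (real k + 1) ^ ?d))"
  proof (rule summable_comparison_test_ev)
    have "((\<lambda>x::real. exp (- (\<gamma>/2) * x) * (?v * (x + 1) ^ ?d)) \<longlongrightarrow> 0) at_top"
    proof -
      have "filterlim (\<lambda>x::real. 1 + x) at_top at_top"
        by (rule filterlim_tendsto_add_at_top[OF tendsto_const filterlim_ident])
      then have "filterlim (\<lambda>x::real. (\<gamma>/2) * (x + 1)) at_top at_top"
        using assms by (intro filterlim_tendsto_pos_mult_at_top[OF tendsto_const]) (simp_all add: add.commute)
      then have "((\<lambda>x::real. ((\<gamma>/2) * (x + 1)) ^ ?d / exp ((\<gamma>/2) * (x + 1))) \<longlongrightarrow> 0) at_top"
        by (rule filterlim_compose[OF tendsto_power_div_exp_0])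
      then have "((\<lambda>x::real. (?v * exp (\<gamma>/2) / (\<gamma>/2) ^ ?d) * (((\<gamma>/2) * (x + 1)) ^ ?d / exp ((\<gamma>/2) * (x + 1)))) \<longlongrightarrow> (?v * exp (\<gamma>/2) / (\<gamma>/2) ^ ?d) * 0) at_top"
        by (intro tendsto_mult tendsto_const)
      moreover have "(?v * exp (\<gamma>/2) / (\<gamma>/2) ^ ?d) * (((\<gamma>/2) * (x + 1)) ^ ?d / exp ((\<gamma>/2) * (x + 1))) = exp (- (\<gamma>/2) * x) * (?v * (x + 1) ^ ?d)" for x
      proof -
        have e: "exp (- (\<gamma>/2) * x) = exp (\<gamma>/2) / exp ((\<gamma>/2) * (x + 1))"
          by (simp add: exp_diff[symmetric] algebra_simps)
        have g: "(\<gamma>/2) ^ ?d \<noteq> 0" using assms by simp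
        show ?thesis unfolding e power_mult_distrib[of "\<gamma>/2" "x+1"] using g by simp
      qed
      ultimately show ?thesis by simp
    qed
    then have "((\<lambda>k. exp (- (\<gamma>/2) * real k) * (?v * (real k + 1) ^ ?d)) \<longlonglongrightarrow> 0)"
      by (rule filterlim_compose) (rule filterlim_real_sequentially)
    then have "eventually (\<lambda>k. norm (exp (- (\<gamma>/2) * real k) * (?v * (real k + 1) ^ ?d)) < 1) sequentially"
      by (auto simp: tendsto_iff dist_norm dest: spec[where x=1])
    then show "eventually (\<lambda>k. norm (exp (- \<gamma> * real k) * (?v * (real k + 1) ^ ?d)) \<le> exp (- (\<gamma>/2)) ^ k) sequentially"
    proof eventually_elim
      case (elim k)
      have "exp (- \<gamma> * real k) = exp (- (\<gamma>/2) * real k) * exp (- (\<gamma>/2)) ^ k"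
        by (simp add: exp_of_nat_mult[symmetric] mult_exp_exp field_simps)
      then have "norm (exp (- \<gamma> * real k) * (?v * (real k + 1) ^ ?d)) = norm (exp (- (\<gamma>/2) * real k) * (?v * (real k + 1) ^ ?d)) * exp (- (\<gamma>/2)) ^ k"
        by (simp add: norm_mult abs_mult)
      also have "\<dots> \<le> 1 * exp (- (\<gamma>/2)) ^ k" using elim by (intro mult_right_mono) auto
      finally show ?case by simp
    qed
    show "summable (\<lambda>k. exp (- (\<gamma>/2)) ^ k)" using assms by (intro summable_geometric) auto
  qed
  have "(\<integral>\<^sup>+ x. ennreal (norm (exp (- \<gamma> * norm (x::'a)))) \<partial>lborel) \<le> (\<integral>\<^sup>+ x. (\<Sum>k. ennreal (exp (- \<gamma> * real k)) * indicator (ball 0 (real k + 1)) (x::'a)) \<partial>lborel)"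
    by (rule nn_integral_mono) (rule pw)
  also have "\<dots> = (\<Sum>k. \<integral>\<^sup>+ x. ennreal (exp (- \<gamma> * real k)) * indicator (ball 0 (real k + 1)) (x::'a) \<partial>lborel)"
    by (rule nn_integral_suminf) (intro borel_measurable_times_ennreal borel_measurable_indicator borel_measurable_const, simp)
  also have "\<dots> = (\<Sum>k. ennreal (exp (- \<gamma> * real k) * (?v * (real k + 1) ^ ?d)))"
  proof (rule suminf_cong)
    fix k
    have "(\<integral>\<^sup>+ x. ennreal (exp (- \<gamma> * real k)) * indicator (ball 0 (real k + 1)) (x::'a) \<partial>lborel)
        = ennreal (exp (- \<gamma> * real k)) * emeasure lborel (ball (0::'a) (real k + 1))"
      by (rule nn_integral_cmult_indicator) simp
    also have "emeasure lborel (ball (0::'a) (real k + 1)) = ennreal (?v * (real k + 1) ^ ?d)"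
      by (rule emeasure_ball) simp
    finally show "(\<integral>\<^sup>+ x. ennreal (exp (- \<gamma> * real k)) * indicator (ball 0 (real k + 1)) (x::'a) \<partial>lborel)
        = ennreal (exp (- \<gamma> * real k) * (?v * (real k + 1) ^ ?d))"
      by (simp only: ennreal_mult' exp_ge_zero)
  qed
  also have "\<dots> < \<infinity>"
  proof -
    have "(\<Sum>k. ennreal (exp (- \<gamma> * real k) * (?v * (real k + 1) ^ ?d))) = ennreal (\<Sum>k. exp (- \<gamma> * real k) * (?v * (real k + 1) ^ ?d))"
      by (rule suminf_ennreal2[OF _ summ]) simp
    then show ?thesis by (simp only: infinity_ennreal_def ennreal_less_top)
  qed
  finally show "(\<integral>\<^sup>+ x. ennreal (norm (exp (- \<gamma> * norm (x::'a)))) \<partial>lborel) < \<infinity>" .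
qed

text \<open>Dominated convergence works along sequences, so derivatives of integrals are treated as
  limits of difference quotients.\<close>

lemma has_vector_derivative_iff_quotient:
  "(f has_vector_derivative d) (at t) \<longleftrightarrow> (\<lambda>y. (f y - f t) /\<^sub>R (y - t)) \<midarrow>t\<rightarrow> d"
proof -
  have "(f has_vector_derivative d) (at t) \<longleftrightarrow>
      (\<lambda>y. norm (f y - f t - (y - t) *\<^sub>R d) / norm (y - t)) \<midarrow>t\<rightarrow> 0"
    by (simp add: has_vector_derivative_def has_derivative_iff_norm bounded_linear_scaleR_left)
  also have "\<dots> \<longleftrightarrow> (\<lambda>y. norm ((f y - f t) /\<^sub>R (y - t) - d)) \<midarrow>t\<rightarrow> 0"
  proof (rule filterlim_cong[OF refl refl])
    have "norm (f y - f t - (y - t) *\<^sub>R d) / norm (y - t) = norm ((f y - f t) /\<^sub>R (y - t) - d)"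
      if "y \<noteq> t" for y
    proof -
      have "(f y - f t) /\<^sub>R (y - t) - d = (f y - f t - (y - t) *\<^sub>R d) /\<^sub>R (y - t)"
        using that by (simp add: scaleR_diff_right)
      then show ?thesis by (simp add: divide_inverse_commute)
    qed
    then show "\<forall>\<^sub>F y in at t. norm (f y - f t - (y - t) *\<^sub>R d) / norm (y - t) = norm ((f y - f t) /\<^sub>R (y - t) - d)"
      by (auto simp: eventually_at_filter)
  qed
  finally show ?thesis
    by (simp add: tendsto_norm_zero_iff LIM_zero_iff)
qed

text \<open>The constants may depend on the radius \<open>r\<close> of the parameter ball: this is
  enough for dominated convergence along convergent parameters and is stable under shifts of
  \<open>x\<close> that are unbounded in the parameter. The parameter ranges over any Euclidean
  space, so that time, shift, mollification scale and tuples of them are treated alike; a single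
  function is a family constant in a real parameter.\<close>

definition edec :: "('p::euclidean_space \<Rightarrow> 'a::euclidean_space \<Rightarrow> 'b::{banach,second_countable_topology}) \<Rightarrow> bool" where
  "edec f \<longleftrightarrow> continuous_on UNIV (\<lambda>(p, x). f p x) \<and>
    (\<forall>r. \<exists>C \<gamma>. \<gamma> > 0 \<and> (\<forall>p x. norm p \<le> r \<longrightarrow> norm (f p x) \<le> C * exp (- \<gamma> * norm x)))"

lemma edec_continuous: "edec f \<Longrightarrow> continuous_on S (\<lambda>(p, x). f p x)"
  unfolding edec_def by (meson continuous_on_subset subset_UNIV)

lemma edec_continuous_compose:
  assumes "edec f" "continuous_on S \<phi>" "continuous_on S \<psi>"
  shows "continuous_on S (\<lambda>y. f (\<phi> y) (\<psi> y))"
  using continuous_on_compose2[OF edec_continuous[OF assms(1), of UNIV] continuous_on_Pair[OF assms(2,3)]]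
  by auto

lemma edec_bound:
  assumes "edec f"
  obtains C \<gamma> where "C > 0" "\<gamma> > 0" "\<And>p x. norm p \<le> r \<Longrightarrow> norm (f p x) \<le> C * exp (- \<gamma> * norm x)"
proof -
  obtain C \<gamma> where *: "\<gamma> > 0" "\<And>p x. norm p \<le> r \<Longrightarrow> norm (f p x) \<le> C * exp (- \<gamma> * norm x)"
    using assms unfolding edec_def by blast
  show ?thesis
  proof (rule that[of "max C 1" \<gamma>])
    show "norm (f p x) \<le> max C 1 * exp (- \<gamma> * norm x)" if "norm p \<le> r" for p x
      by (rule order_trans[OF *(2)[OF that]]) (intro mult_right_mono, auto)
  qed (use * in auto)
qed

lemma edecI:
  assumes "continuous_on UNIV (\<lambda>(p, x). f p x)"
    "\<And>r. \<exists>C \<gamma>. \<gamma> > 0 \<and> (\<forall>p x. norm p \<le> r \<longrightarrow> norm (f p x) \<le> C * exp (- \<gamma> * norm x))"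
  shows "edec f"
  using assms unfolding edec_def by blast

lemma edec_measurable: "edec f \<Longrightarrow> f p \<in> borel_measurable lborel"
  using edec_continuous_compose[of f UNIV "\<lambda>_. p" "\<lambda>x. x"]
  by (auto intro!: borel_measurable_continuous_onI)

lemma edec_integrable:
  assumes "edec f" shows "integrable lborel (f p)"
proof -
  obtain C \<gamma> where *: "C > 0" "\<gamma> > 0" "\<And>q x. norm q \<le> norm p \<Longrightarrow> norm (f q x) \<le> C * exp (- \<gamma> * norm x)"
    using edec_bound[OF assms, of "norm p"] by blast
  show ?thesis
    by (rule Bochner_Integration.integrable_bound[OF integrable_mult_right[OF integrable_exp_norm[OF *(2)], of C] edec_measurable[OF assms]])
       (use *(1,3) in auto)
qed

lemma integrable_edec: "edec (\<lambda>_::real. f) \<Longrightarrow> integrable lborel f"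
  by (rule edec_integrable)

lemma edec_continuous_integral:
  assumes "edec f" shows "continuous_on S (\<lambda>p. LBINT x. f p x)"
proof -
  have "isCont (\<lambda>p. LBINT x. f p x) p" for p
  proof (unfold continuous_at_sequentially, intro allI impI)
    fix q :: "nat \<Rightarrow> _" assume q: "q \<longlonglongrightarrow> p"
    obtain r where r: "\<And>k. norm (q k) \<le> r"
      using q by (metis Bseq_def convergent_imp_Bseq convergent_def)
    obtain C \<gamma> where *: "C > 0" "\<gamma> > 0" "\<And>q x. norm q \<le> r \<Longrightarrow> norm (f q x) \<le> C * exp (- \<gamma> * norm x)"
      using edec_bound[OF assms, of r] by blast
    show "((\<lambda>p. LBINT x. f p x) \<circ> q) \<longlonglongrightarrow> (LBINT x. f p x)"
      unfolding o_def
    proof (rule integral_dominated_convergence[where w = "\<lambda>x. C * exp (- \<gamma> * norm x)"])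
      show "integrable lborel (\<lambda>x::'b. C * exp (- \<gamma> * norm x))"
        by (intro integrable_mult_right integrable_exp_norm *)
      show "AE x in lborel. (\<lambda>i. f (q i) x) \<longlonglongrightarrow> f p x"
      proof (rule AE_I2)
        fix x
        have "continuous_on UNIV (\<lambda>p. f p x)"
          by (rule edec_continuous_compose[OF assms]) (auto intro: continuous_intros)
        then have "isCont (\<lambda>p. f p x) p" by (simp add: continuous_on_eq_continuous_at)
        then show "(\<lambda>i. f (q i) x) \<longlonglongrightarrow> f p x" using q by (rule isCont_tendsto_compose)
      qed
    qed (use * r edec_measurable[OF assms] in auto)
  qed
  then show ?thesis by (simp add: continuous_at_imp_continuous_on)
qed

text \<open>The mean value inequality bounds every difference quotient by the decay bound of
  \<open>g\<close>, which serves as the integrable majorant.\<close>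

lemma edec_has_vector_derivative_integral:
  fixes f :: "real \<Rightarrow> 'a::euclidean_space \<Rightarrow> 'b::{banach,second_countable_topology}"
  assumes f: "edec f" and g: "edec g"
    and d: "\<And>t x. ((\<lambda>t. f t x) has_vector_derivative g t x) (at t)"
  shows "((\<lambda>t. LBINT x. f t x) has_vector_derivative (LBINT x. g t x)) (at t)"
proof -
  have "(\<lambda>y. ((LBINT x. f y x) - (LBINT x. f t x)) /\<^sub>R (y - t)) \<midarrow>t\<rightarrow> (LBINT x. g t x)"
  proof (unfold tendsto_at_iff_sequentially, intro allI impI)
    fix q :: "nat \<Rightarrow> real" assume qn: "\<forall>i. q i \<in> UNIV - {t}" and q: "q \<longlonglongrightarrow> t"
    obtain r0 where r0: "\<And>k. norm (q k) \<le> r0"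
      using q by (metis Bseq_def convergent_imp_Bseq convergent_def)
    \<comment> \<open>The interval must contain \<open>t\<close> and the whole sequence, so that one
      bound covers all segments between them.\<close>
    define r where "r = max r0 \<bar>t\<bar>"
    have r: "\<And>k. \<bar>q k\<bar> \<le> r" "\<bar>t\<bar> \<le> r" using r0 by (auto simp: r_def intro: max.coboundedI1)
    obtain C \<gamma> where *: "C > 0" "\<gamma> > 0" "\<And>q x. norm q \<le> r \<Longrightarrow> norm (g q x) \<le> C * exp (- \<gamma> * norm x)"
      using edec_bound[OF g, of r] by blast
    have "(\<lambda>i. LBINT x. (f (q i) x - f t x) /\<^sub>R (q i - t)) \<longlonglongrightarrow> (LBINT x. g t x)"
    proof (rule integral_dominated_convergence[where w = "\<lambda>x. C * exp (- \<gamma> * norm x)"])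
      show "integrable lborel (\<lambda>x::'a. C * exp (- \<gamma> * norm x))"
        by (intro integrable_mult_right integrable_exp_norm *)
      show "AE x in lborel. (\<lambda>i. (f (q i) x - f t x) /\<^sub>R (q i - t)) \<longlonglongrightarrow> g t x"
      proof (rule AE_I2)
        fix x
        have "(\<lambda>y. (f y x - f t x) /\<^sub>R (y - t)) \<midarrow>t\<rightarrow> g t x"
          using d[of x t] by (simp add: has_vector_derivative_iff_quotient)
        then show "(\<lambda>i. (f (q i) x - f t x) /\<^sub>R (q i - t)) \<longlonglongrightarrow> g t x"
          using qn q unfolding tendsto_at_iff_sequentially by (auto simp: o_def)
      qed
      show "AE x in lborel. norm ((f (q i) x - f t x) /\<^sub>R (q i - t)) \<le> C * exp (- \<gamma> * norm x)" for i
      proof (rule AE_I2)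
        fix x
        have "norm (f (q i) x - f t x) \<le> (C * exp (- \<gamma> * norm x)) * norm (q i - t)"
        proof (rule differentiable_bound[where S = "{- r..r}" and f = "\<lambda>t. f t x" and f' = "\<lambda>t s. s *\<^sub>R g t x"])
          show "((\<lambda>t. f t x) has_derivative (\<lambda>s. s *\<^sub>R g y x)) (at y within {- r..r})" for y
            using d[of x y] by (simp add: has_vector_derivative_def has_derivative_at_withinI)
          show "onorm (\<lambda>s. s *\<^sub>R g y x) \<le> C * exp (- \<gamma> * norm x)" if "y \<in> {- r..r}" for y
            using *(3)[of y x] that by (intro order_trans[OF onorm_le[where b = "norm (g y x)"]]) auto
        qed (use r in \<open>auto simp: abs_le_iff minus_le_iff\<close>)
        moreover have "\<bar>q i - t\<bar> > 0" using qn by auto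
        moreover have "norm ((f (q i) x - f t x) /\<^sub>R (q i - t)) = norm (f (q i) x - f t x) / \<bar>q i - t\<bar>"
          by (simp only: norm_scaleR abs_inverse divide_inverse_commute)
        ultimately show "norm ((f (q i) x - f t x) /\<^sub>R (q i - t)) \<le> C * exp (- \<gamma> * norm x)"
          by (simp only: pos_divide_le_eq real_norm_def)
      qed
    qed (use edec_measurable[OF f] edec_measurable[OF g] in auto)
    then show "((\<lambda>y. ((LBINT x. f y x) - (LBINT x. f t x)) /\<^sub>R (y - t)) \<circ> q) \<longlonglongrightarrow> (LBINT x. g t x)"
      by (simp add: o_def edec_integrable[OF f])
  qed
  then show ?thesis by (simp add: has_vector_derivative_iff_quotient)
qed

section \<open>Closure properties of decaying families\<close>

lemma edec_bounded_linear:
  assumes "bounded_linear T" "edec f" shows "edec (\<lambda>p x. T (f p x))"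
proof (rule edecI)
  show "continuous_on UNIV (\<lambda>(p, x). T (f p x))"
    using bounded_linear.continuous_on[OF assms(1) edec_continuous[OF assms(2), of UNIV]]
    by (simp add: case_prod_beta')
  fix r
  obtain K where K: "\<And>x. norm (T x) \<le> norm x * K" "K \<ge> 0"
    using bounded_linear.nonneg_bounded[OF assms(1)] by blast
  obtain C \<gamma> where *: "C > 0" "\<gamma> > 0" "\<And>p x. norm p \<le> r \<Longrightarrow> norm (f p x) \<le> C * exp (- \<gamma> * norm x)"
    using edec_bound[OF assms(2), of r] by blast
  have "norm (T (f p x)) \<le> (C * K) * exp (- \<gamma> * norm x)" if "norm p \<le> r" for p x
    using order_trans[OF K(1) mult_right_mono[OF *(3)[OF that] K(2)]] by (simp add: mult_ac)
  then show "\<exists>C \<gamma>. \<gamma> > 0 \<and> (\<forall>p x. norm p \<le> r \<longrightarrow> norm (T (f p x)) \<le> C * exp (- \<gamma> * norm x))"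
    using *(2) by blast
qed

lemma edec_cnj: "edec f \<Longrightarrow> edec (\<lambda>p x. cnj (f p x))"
  by (rule edec_bounded_linear[OF bounded_linear_cnj])

lemma edec_add:
  assumes "edec f" "edec g" shows "edec (\<lambda>p x. f p x + g p x)"
proof (rule edecI)
  show "continuous_on UNIV (\<lambda>(p, x). f p x + g p x)"
    using continuous_on_add[OF assms[THEN edec_continuous, of UNIV]] by (simp add: case_prod_beta')
  fix r
  obtain C \<gamma> where f: "C > 0" "\<gamma> > 0" "\<And>p x. norm p \<le> r \<Longrightarrow> norm (f p x) \<le> C * exp (- \<gamma> * norm x)"
    using edec_bound[OF assms(1), of r] by blast
  obtain C' \<gamma>' where g: "C' > 0" "\<gamma>' > 0" "\<And>p x. norm p \<le> r \<Longrightarrow> norm (g p x) \<le> C' * exp (- \<gamma>' * norm x)"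
    using edec_bound[OF assms(2), of r] by blast
  define \<delta> where "\<delta> = min \<gamma> \<gamma>'"
  have "norm (f p x + g p x) \<le> (C + C') * exp (- \<delta> * norm x)" if "norm p \<le> r" for p x
  proof -
    have "norm (f p x) \<le> C * exp (- \<delta> * norm x)"
      by (rule order_trans[OF f(3)[OF that]]) (use f in \<open>auto simp: \<delta>_def intro!: mult_right_mono\<close>)
    moreover have "norm (g p x) \<le> C' * exp (- \<delta> * norm x)"
      by (rule order_trans[OF g(3)[OF that]]) (use g in \<open>auto simp: \<delta>_def intro!: mult_right_mono\<close>)
    ultimately show ?thesis using norm_triangle_ineq[of "f p x" "g p x"] by (simp add: distrib_right)
  qed
  moreover have "\<delta> > 0" using f g by (simp add: \<delta>_def)
  ultimately show "\<exists>C \<gamma>. \<gamma> > 0 \<and> (\<forall>p x. norm p \<le> r \<longrightarrow> norm (f p x + g p x) \<le> C * exp (- \<gamma> * norm x))"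
    by blast
qed

lemma edec_minus: "edec f \<Longrightarrow> edec (\<lambda>p x. - f p x)"
  by (rule edec_bounded_linear[OF bounded_linear_minus[OF bounded_linear_ident]])

lemma edec_diff: "edec f \<Longrightarrow> edec g \<Longrightarrow> edec (\<lambda>p x. f p x - g p x)"
  using edec_add[of f "\<lambda>p x. - g p x"] edec_minus[of g] by simp

lemma edec_zero: "edec (\<lambda>(p::'a::euclidean_space) (x::'b::euclidean_space). 0::'c::{banach,second_countable_topology})"
proof (rule edecI)
  show "\<exists>C \<gamma>. \<gamma> > 0 \<and> (\<forall>p x. norm p \<le> r \<longrightarrow> norm (0::'c) \<le> C * exp (- \<gamma> * norm x))" for r
    by (intro exI[of _ 0] exI[of _ 1]) auto
qed (simp add: case_prod_beta')

lemma edec_sum: "(\<And>i. i \<in> I \<Longrightarrow> edec (f i)) \<Longrightarrow> edec (\<lambda>p x. \<Sum>i\<in>I. f i p x)"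
  by (induction I rule: infinite_finite_induct) (auto intro: edec_add edec_zero)

lemma edec_cmult: "edec f \<Longrightarrow> edec (\<lambda>p x. c * (f p x :: 'b::{real_normed_algebra,banach,second_countable_topology}))"
  by (rule edec_bounded_linear[OF bounded_linear_mult_right])

text \<open>Half of the rate pays for the linear factor, by
  \<open>1 + (\<gamma>/2) * y \<le> exp ((\<gamma>/2) * y)\<close>.\<close>

lemma linear_exp_bound:
  fixes \<gamma> y :: real assumes "\<gamma> > 0" "y \<ge> 0"
  shows "(1 + y) * exp (- \<gamma> * y) \<le> (1 + 2 / \<gamma>) * exp (- (\<gamma>/2) * y)"
proof -
  have "1 + (\<gamma>/2) * y \<le> exp ((\<gamma>/2) * y)" by (rule exp_ge_add_one_self)
  then have y: "y \<le> (2/\<gamma>) * exp ((\<gamma>/2) * y)" using assms by (simp add: field_simps)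
  have "1 \<le> exp ((\<gamma>/2) * y)" using assms by simp
  then have "1 + y \<le> (1 + 2/\<gamma>) * exp ((\<gamma>/2) * y)" using y unfolding distrib_right by linarith
  then have "(1 + y) * exp (- \<gamma> * y) \<le> (1 + 2/\<gamma>) * exp ((\<gamma>/2) * y) * exp (- \<gamma> * y)"
    by (rule mult_right_mono) simp
  also have "\<dots> = (1 + 2/\<gamma>) * exp (- (\<gamma>/2) * y)"
  proof -
    have "exp ((\<gamma>/2) * y) * exp (- \<gamma> * y) = exp (- (\<gamma>/2) * y)"
      unfolding exp_add[symmetric] by (rule arg_cong[of _ _ exp]) (simp add: field_simps)
    then show ?thesis by (simp only: mult.assoc)
  qed
  finally show ?thesis .
qed

lemma exp_norm_shift:
  fixes x y :: "'a::real_normed_vector" and \<gamma> r :: real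
  assumes "\<gamma> > 0" "norm y \<le> r"
  shows "exp (- \<gamma> * norm (x + y)) \<le> exp (\<gamma> * r) * exp (- \<gamma> * norm x)"
proof -
  have "norm x \<le> norm (x + y) + r" using norm_triangle_ineq4[of "x + y" y] assms(2) by simp
  then have "\<gamma> * norm x \<le> \<gamma> * norm (x + y) + \<gamma> * r"
    using assms(1) by (metis distrib_left mult_left_mono less_imp_le)
  then show ?thesis by (simp add: exp_add[symmetric])
qed

text \<open>Meant for the virial weights, which grow linearly in \<open>x\<close> and cost half of
  the decay rate. A product of two decaying families is the special case of a bounded first
  factor.\<close>

lemma edec_mult_linear_growth:
  fixes a f :: "'p::euclidean_space \<Rightarrow> 'a::euclidean_space \<Rightarrow> 'b::{real_normed_algebra,banach,second_countable_topology}"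
  assumes a: "continuous_on UNIV (\<lambda>(p, x). a p x)"
    and K: "\<And>r. \<exists>K. \<forall>p x. norm p \<le> r \<longrightarrow> norm (a p x) \<le> K * (1 + norm x)"
    and f: "edec f"
  shows "edec (\<lambda>p x. a p x * f p x)"
proof (rule edecI)
  show "continuous_on UNIV (\<lambda>(p, x). a p x * f p x)"
    using continuous_on_mult[OF a edec_continuous[OF f, of UNIV]] by (simp add: case_prod_beta')
  fix r
  obtain C \<gamma> where f: "C > 0" "\<gamma> > 0" "\<And>p x. norm p \<le> r \<Longrightarrow> norm (f p x) \<le> C * exp (- \<gamma> * norm x)"
    using edec_bound[OF f, of r] by blast
  obtain K0 where K0: "\<And>p x. norm p \<le> r \<Longrightarrow> norm (a p x) \<le> K0 * (1 + norm x)" using K by blast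
  define K1 where "K1 = max K0 0"
  have K1: "norm (a p x) \<le> K1 * (1 + norm x)" "K1 \<ge> 0" if "norm p \<le> r" for p x
    by (rule order_trans[OF K0[OF that]]) (auto simp: K1_def intro!: mult_right_mono)
  have "norm (a p x * f p x) \<le> (K1 * C * (1 + 2/\<gamma>)) * exp (- (\<gamma>/2) * norm x)" if p: "norm p \<le> r" for p x
  proof -
    have "norm (a p x * f p x) \<le> norm (a p x) * norm (f p x)" by (rule norm_mult_ineq)
    also have "\<dots> \<le> (K1 * (1 + norm x)) * (C * exp (- \<gamma> * norm x))"
      using K1[OF p] f(3)[OF p] by (intro mult_mono) auto
    also have "\<dots> = (K1 * C) * ((1 + norm x) * exp (- \<gamma> * norm x))" by (simp add: mult_ac)
    also have "\<dots> \<le> (K1 * C) * ((1 + 2/\<gamma>) * exp (- (\<gamma>/2) * norm x))"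
      using f K1(2)[OF p] by (intro mult_left_mono linear_exp_bound) auto
    finally show ?thesis by (simp add: mult_ac)
  qed
  moreover have "\<gamma> / 2 > 0" using f by simp
  ultimately show "\<exists>C \<gamma>. \<gamma> > 0 \<and> (\<forall>p x. norm p \<le> r \<longrightarrow> norm (a p x * f p x) \<le> C * exp (- \<gamma> * norm x))"
    by blast
qed

lemma continuous_norm_bound:
  fixes \<phi> :: "'q::euclidean_space \<Rightarrow> 'p::real_normed_vector"
  assumes "continuous_on UNIV \<phi>"
  obtains R where "\<And>q. norm q \<le> r \<Longrightarrow> norm (\<phi> q) \<le> R"
proof -
  have "compact (\<phi> ` cball 0 r)"
    by (intro compact_continuous_image continuous_on_subset[OF assms]) auto
  then obtain R where "\<And>y. y \<in> \<phi> ` cball 0 r \<Longrightarrow> norm y \<le> R"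
    by (metis compact_imp_bounded bounded_iff)
  then have "norm (\<phi> q) \<le> R" if "norm q \<le> r" for q
    using that by simp
  then show ?thesis by (rule that)
qed

lemma edec_affine_weight:
  fixes f :: "'p::euclidean_space \<Rightarrow> real ^ 'n::finite \<Rightarrow> 'b::{real_normed_algebra_1,banach,second_countable_topology}"
  assumes f: "edec f" and \<alpha>: "continuous_on UNIV \<alpha>"
  shows "edec (\<lambda>p x. of_real (\<alpha> p + \<beta> * x $ j) * f p x)"
proof (rule edec_mult_linear_growth[OF _ _ f])
  have "continuous_on UNIV (\<lambda>y::'p \<times> (real ^ 'n). \<alpha> (fst y))"
    by (rule continuous_on_compose2[OF \<alpha>], intro continuous_intros) simp
  then show "continuous_on UNIV (\<lambda>(p, x :: real ^ 'n). of_real (\<alpha> p + \<beta> * x $ j) :: 'b)"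
    unfolding case_prod_beta' by (intro continuous_intros)
  fix r
  obtain K where K: "\<And>p. norm p \<le> r \<Longrightarrow> norm (\<alpha> p) \<le> K"
    using continuous_norm_bound[OF \<alpha>] by blast
  have "norm (of_real (\<alpha> p + \<beta> * x $ j) :: 'b) \<le> (\<bar>K\<bar> + \<bar>\<beta>\<bar>) * (1 + norm x)" if "norm p \<le> r" for p x
  proof -
    have "norm (of_real (\<alpha> p + \<beta> * x $ j) :: 'b) \<le> \<bar>K\<bar> + \<bar>\<beta>\<bar> * \<bar>x $ j\<bar>"
      unfolding norm_of_real using abs_triangle_ineq[of "\<alpha> p" "\<beta> * x $ j"] K[OF that] by (simp add: abs_mult)
    also have "\<dots> \<le> \<bar>K\<bar> * (1 + norm x) + \<bar>\<beta>\<bar> * (1 + norm x)"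
      using component_le_norm_cart[of x j]
      by (intro add_mono mult_left_mono mult_right_le_one_le) (auto simp: mult_le_cancel_left1)
    finally show ?thesis by (simp add: distrib_right)
  qed
  then show "\<exists>K. \<forall>p x. norm p \<le> r \<longrightarrow> norm (of_real (\<alpha> p + \<beta> * x $ j) :: 'b) \<le> K * (1 + norm x)" by blast
qed

lemma edec_mult:
  fixes a f :: "'p::euclidean_space \<Rightarrow> 'a::euclidean_space \<Rightarrow> 'b::{real_normed_algebra,banach,second_countable_topology}"
  assumes "edec a" "edec f" shows "edec (\<lambda>p x. a p x * f p x)"
proof (rule edec_mult_linear_growth[OF edec_continuous[OF assms(1)] _ assms(2)])
  fix r
  obtain C \<gamma> where f: "C > 0" "\<gamma> > 0" "\<And>p x. norm p \<le> r \<Longrightarrow> norm (a p x) \<le> C * exp (- \<gamma> * norm x)"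
    using edec_bound[OF assms(1), of r] by blast
  have "C * exp (- \<gamma> * norm x) \<le> C * (1 + norm x)" for x :: 'a
    using f by (intro mult_left_mono) (auto intro: order_trans[of _ 1])
  then show "\<exists>K. \<forall>p x. norm p \<le> r \<longrightarrow> norm (a p x) \<le> K * (1 + norm x)"
    using f(3) by (meson order_trans)
qed

lemma edec_power:
  fixes f :: "'p::euclidean_space \<Rightarrow> 'a::euclidean_space \<Rightarrow> 'b::{real_normed_algebra_1,banach,second_countable_topology}"
  assumes "edec f" "n > 0" shows "edec (\<lambda>p x. f p x ^ n)"
  using assms(2)
proof (induction n)
  case (Suc n)
  then show ?case using assms(1) edec_mult[OF assms(1)] by (cases n) auto
qed simp

text \<open>A shift by at most \<open>S\<close> costs a factor \<open>exp (\<gamma> * S)\<close>,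
  and the continuous maps \<open>\<phi>\<close>, \<open>\<psi>\<close> are bounded on bounded
  parameter sets. This is where the locally uniform form of \<open>edec\<close> pays off.\<close>

lemma edec_reparam:
  fixes \<phi> :: "'q::euclidean_space \<Rightarrow> 'p::euclidean_space" and \<psi> :: "'q \<Rightarrow> 'a::euclidean_space"
  assumes f: "edec f" and \<phi>: "continuous_on UNIV \<phi>" and \<psi>: "continuous_on UNIV \<psi>"
  shows "edec (\<lambda>q x. f (\<phi> q) (x + \<psi> q))"
proof (rule edecI)
  have "continuous_on UNIV (\<lambda>y::'q \<times> 'a. f (\<phi> (fst y)) (snd y + \<psi> (fst y)))"
    by (intro edec_continuous_compose[OF f] continuous_on_add continuous_on_compose2[OF \<phi>] continuous_on_compose2[OF \<psi>] continuous_on_fst continuous_on_snd continuous_on_id) auto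
  then show "continuous_on UNIV (\<lambda>(q, x). f (\<phi> q) (x + \<psi> q))" by (simp add: case_prod_beta')
  fix r
  obtain R where R: "\<And>q. norm q \<le> r \<Longrightarrow> norm (\<phi> q) \<le> R" using continuous_norm_bound[OF \<phi>] by blast
  obtain S where S: "\<And>q. norm q \<le> r \<Longrightarrow> norm (\<psi> q) \<le> S" using continuous_norm_bound[OF \<psi>] by blast
  obtain C \<gamma> where f: "C > 0" "\<gamma> > 0" "\<And>p x. norm p \<le> R \<Longrightarrow> norm (f p x) \<le> C * exp (- \<gamma> * norm x)"
    using edec_bound[OF f, of R] by blast
  have "norm (f (\<phi> q) (x + \<psi> q)) \<le> (C * exp (\<gamma> * S)) * exp (- \<gamma> * norm x)" if q: "norm q \<le> r" for q x
  proof -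
    have "C * exp (- \<gamma> * norm (x + \<psi> q)) \<le> C * exp (\<gamma> * S) * exp (- \<gamma> * norm x)"
      using mult_left_mono[OF exp_norm_shift[OF f(2) S[OF q], of x] less_imp_le[OF f(1)]] by (simp only: mult.assoc)
    then show ?thesis using f(3)[OF R[OF q]] order_trans by blast
  qed
  then show "\<exists>C \<gamma>. \<gamma> > 0 \<and> (\<forall>q x. norm q \<le> r \<longrightarrow> norm (f (\<phi> q) (x + \<psi> q)) \<le> C * exp (- \<gamma> * norm x))"
    using f(2) by blast
qed

text \<open>Where the function can be nonzero, a compactness bound \<open>B\<close> is at most
  \<open>B * exp (\<bar>R\<bar> - norm x)\<close>. Thus merely continuous functions become
  admissible once multiplied by a bump.\<close>

lemma edec_compact_support:
  assumes c: "continuous_on UNIV (\<lambda>(p, x). f p x)"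
    and z: "\<And>p x. norm x \<ge> R \<Longrightarrow> f p x = 0"
  shows "edec f"
proof (rule edecI[OF c])
  fix r
  obtain B where B: "\<And>y. norm y \<le> \<bar>r\<bar> + \<bar>R\<bar> \<Longrightarrow> norm (case y of (p, x) \<Rightarrow> f p x) \<le> B"
    using continuous_norm_bound[OF c] by blast
  have B0: "B \<ge> 0" using order_trans[OF norm_ge_zero B[of 0]] by simp
  have "norm (f p x) \<le> (B * exp \<bar>R\<bar>) * exp (- 1 * norm x)" if p: "norm p \<le> r" for p x
  proof (cases "norm x \<ge> R")
    case False
    then have "norm (p, x) \<le> \<bar>r\<bar> + \<bar>R\<bar>" using p norm_Pair_le[of p x] by linarith
    then have "norm (f p x) \<le> B * 1" using B[of "(p, x)"] by simp
    also have "\<dots> \<le> B * exp (\<bar>R\<bar> + - 1 * norm x)"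
      using False B0 by (intro mult_left_mono) auto
    finally show ?thesis by (simp only: exp_add mult.assoc)
  qed (use z B0 in auto)
  then show "\<exists>C \<gamma>. \<gamma> > 0 \<and> (\<forall>p x. norm p \<le> r \<longrightarrow> norm (f p x) \<le> C * exp (- \<gamma> * norm x))"
    by (intro exI[of _ "B * exp \<bar>R\<bar>"] exI[of _ 1]) auto
qed

section \<open>Derivatives along lines and translation invariance\<close>

lemma has_vector_derivative_line:
  fixes x e :: "'a::real_vector"
  assumes "\<And>x. ((\<lambda>s. f (x + s *\<^sub>R e)) has_vector_derivative g x) (at 0)"
  shows "((\<lambda>s. f (x + s *\<^sub>R e)) has_vector_derivative g (x + s *\<^sub>R e)) (at s)"
proof -
  have "(((\<lambda>r. f ((x + s *\<^sub>R e) + r *\<^sub>R e)) \<circ> (\<lambda>r. r - s)) has_vector_derivative 1 *\<^sub>R g (x + s *\<^sub>R e)) (at s)"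
    by (rule vector_diff_chain_at) (auto intro!: derivative_eq_intros assms)
  moreover have "x + s *\<^sub>R e + (r - s) *\<^sub>R e = x + r *\<^sub>R e" for r
    by (simp only: add.assoc scaleR_left_distrib[symmetric]) simp
  ultimately show ?thesis by (simp add: o_def)
qed

lemma edec_const_reparam: "edec (\<lambda>_::real. f) \<Longrightarrow> continuous_on UNIV \<psi> \<Longrightarrow> edec (\<lambda>q::'q::euclidean_space. \<lambda>x. f (x + \<psi> q))"
  using edec_reparam[of "\<lambda>_::real. f" "\<lambda>_. 0" \<psi>] by (simp add: continuous_on_const)

lemma integral_translation_lborel:
  fixes f :: "'a::euclidean_space \<Rightarrow> 'b::{banach,second_countable_topology}"
  assumes "f \<in> borel_measurable lborel"
  shows "(LBINT x. f (x + c)) = (LBINT x. f x)"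
proof -
  have "(LBINT x. f x) = (\<integral>x. f x \<partial>(distr lborel borel ((+) c)))"
    by (simp add: lborel_distr_plus)
  also have "\<dots> = (LBINT x. f (c + x))"
    using assms by (subst integral_distr) auto
  finally show ?thesis by (simp add: add.commute)
qed

text \<open>Translation invariance: \<open>\<integral> f (x + s e) dx\<close> does not depend on \<open>s\<close>.\<close>

lemma integral_line_derivative_zero:
  fixes f g :: "'a::euclidean_space \<Rightarrow> 'b::{banach,second_countable_topology}"
  assumes "edec (\<lambda>_::real. f)" "edec (\<lambda>_::real. g)"
    and "\<And>x. ((\<lambda>s. f (x + s *\<^sub>R e)) has_vector_derivative g x) (at 0)"
  shows "(LBINT x. g x) = 0"
proof -
  have "((\<lambda>s. LBINT x. f (x + s *\<^sub>R e)) has_vector_derivative (LBINT x. g (x + 0 *\<^sub>R e))) (at 0)"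
    by (rule edec_has_vector_derivative_integral[OF edec_const_reparam[OF assms(1)] edec_const_reparam[OF assms(2)] has_vector_derivative_line[OF assms(3)]])
       (intro continuous_intros)+
  moreover have "(LBINT x. f (x + s *\<^sub>R e)) = (LBINT x. f x)" for s
    by (rule integral_translation_lborel) (rule edec_measurable[OF assms(1)])
  ultimately have "((\<lambda>s::real. LBINT x. f x) has_vector_derivative (LBINT x. g x)) (at 0)"
    by simp
  then show ?thesis by (rule vector_derivative_unique_at) (rule has_vector_derivative_const)
qed

subsection \<open>Mollification\<close>

text \<open>At the kink the difference quotient is at most \<open>\<bar>h\<bar> ^ Suc n\<close>, so
  the two smooth pieces fit together.\<close>

lemma has_real_derivative_max0_power:
  "((\<lambda>r::real. max 0 r ^ Suc (Suc n)) has_real_derivative real (n + 2) * max 0 r ^ Suc n) (at r)"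
proof (cases r "0::real" rule: linorder_cases)
  case less
  have "((\<lambda>r::real. 0) has_real_derivative real (n + 2) * max 0 r ^ Suc n) (at r)"
    using less by (simp add: max_def)
  then show ?thesis
    by (rule has_field_derivative_transform_within_open[where S = "{..<0}"]) (use less in \<open>auto simp: max_def\<close>)
next
  case greater
  have "((\<lambda>r::real. r ^ Suc (Suc n)) has_real_derivative real (n + 2) * max 0 r ^ Suc n) (at r)"
    using DERIV_pow[of "Suc (Suc n)" r] greater by (simp add: max_def algebra_simps)
  then show ?thesis
    by (rule has_field_derivative_transform_within_open[where S = "{0<..}"]) (use greater in \<open>auto simp: max_def\<close>)
next
  case equal
  have "(\<lambda>h::real. (max 0 (0 + h) ^ Suc (Suc n) - max 0 0 ^ Suc (Suc n)) / h) \<midarrow>0\<rightarrow> 0"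
  proof (rule Lim_null_comparison[where g = "\<lambda>h. \<bar>h\<bar> ^ Suc n"])
    have "norm ((max 0 (0 + h) ^ Suc (Suc n) - max 0 0 ^ Suc (Suc n)) / h) \<le> \<bar>h\<bar> ^ Suc n" for h :: real
    proof (cases "h > 0")
      case True
      then show ?thesis by (simp add: max_def abs_mult)
    next
      case False
      then have "(max 0 (0 + h) ^ Suc (Suc n) - max 0 0 ^ Suc (Suc n)) / h = 0" by (simp add: max_def)
      then show ?thesis by (simp only: norm_zero zero_le_power abs_ge_zero)
    qed
    then show "\<forall>\<^sub>F h::real in at 0. norm ((max 0 (0 + h) ^ Suc (Suc n) - max 0 0 ^ Suc (Suc n)) / h) \<le> \<bar>h\<bar> ^ Suc n"
      by simp
    have "((\<lambda>h::real. \<bar>h\<bar> ^ Suc n) \<longlongrightarrow> \<bar>0\<bar> ^ Suc n) (at 0)" by (intro tendsto_intros)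
    then show "((\<lambda>h::real. \<bar>h\<bar> ^ Suc n) \<longlongrightarrow> 0) (at 0)" by simp
  qed
  then show ?thesis using equal by (simp add: DERIV_def)
qed

text \<open>The third power is the smallest integer power with continuous second derivatives, and
  the Laplacian asks for two derivatives of the kernel. \<open>bump1\<close> and
  \<open>bump2\<close> are the first and the pure second derivative in direction
  \<open>j\<close>.\<close>

definition bump :: "real ^ 'n::finite \<Rightarrow> real" where
  "bump z = max 0 (1 - z \<bullet> z) ^ 3"

definition bump1 :: "'n \<Rightarrow> real ^ 'n::finite \<Rightarrow> real" where
  "bump1 j z = - 6 * z $ j * max 0 (1 - z \<bullet> z) ^ 2"

definition bump2 :: "'n \<Rightarrow> real ^ 'n::finite \<Rightarrow> real" where
  "bump2 j z = - 6 * max 0 (1 - z \<bullet> z) ^ 2 + 24 * (z $ j)\<^sup>2 * max 0 (1 - z \<bullet> z)"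

lemma continuous_bump [continuous_intros]:
  "continuous_on S bump" "continuous_on S (bump1 j)" "continuous_on S (bump2 j)"
  unfolding bump_def bump1_def bump2_def by (intro continuous_intros)+

lemma bump_support:
  assumes "norm z \<ge> 1" shows "bump z = 0" "bump1 j z = 0" "bump2 j z = 0"
proof -
  have "z \<bullet> z \<ge> 1" using assms by (simp add: power2_norm_eq_inner[symmetric])
  then show "bump z = 0" "bump1 j z = 0" "bump2 j z = 0"
    by (simp_all add: bump_def bump1_def bump2_def max_def)
qed

lemma bump_derivative:
  fixes x :: "real ^ 'n::finite"
  shows "((\<lambda>s. bump (x + s *\<^sub>R axis j 1)) has_vector_derivative bump1 j x) (at 0)"
    and "((\<lambda>s. bump1 j (x + s *\<^sub>R axis j 1)) has_vector_derivative bump2 j x) (at 0)"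
proof -
  let ?e = "axis j 1 :: real ^ 'n"
  have sq: "(x + s *\<^sub>R ?e) \<bullet> (x + s *\<^sub>R ?e) = x \<bullet> x + 2 * s * x $ j + s\<^sup>2" for s
    by (simp add: inner_add_left inner_add_right inner_axis inner_axis' power2_eq_square algebra_simps)
  have in': "((\<lambda>s. 1 - (x + s *\<^sub>R ?e) \<bullet> (x + s *\<^sub>R ?e)) has_real_derivative - 2 * x $ j) (at 0)"
    unfolding sq by (auto intro!: derivative_eq_intros)
  have c3: "((\<lambda>s. max 0 (1 - (x + s *\<^sub>R ?e) \<bullet> (x + s *\<^sub>R ?e)) ^ 3) has_real_derivative
      (3 * max 0 (1 - x \<bullet> x) ^ 2) * (- 2 * x $ j)) (at 0)"
    by (rule DERIV_chain2[OF _ in'])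
       (use has_real_derivative_max0_power[of 1 "1 - x \<bullet> x"] in \<open>simp add: numeral_eq_Suc\<close>)
  then show "((\<lambda>s. bump (x + s *\<^sub>R ?e)) has_vector_derivative bump1 j x) (at 0)"
    by (simp add: bump_def bump1_def has_real_derivative_iff_has_vector_derivative mult_ac)
  have c2: "((\<lambda>s. max 0 (1 - (x + s *\<^sub>R ?e) \<bullet> (x + s *\<^sub>R ?e)) ^ 2) has_real_derivative
      (2 * max 0 (1 - x \<bullet> x)) * (- 2 * x $ j)) (at 0)"
    by (rule DERIV_chain2[OF _ in'])
       (use has_real_derivative_max0_power[of 0 "1 - x \<bullet> x"] in \<open>simp add: numeral_eq_Suc\<close>)
  have xj: "((\<lambda>s. (x + s *\<^sub>R ?e) $ j) has_real_derivative 1) (at 0)"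
    by (auto intro!: derivative_eq_intros simp: axis_def)
  have "((\<lambda>s. - 6 * ((x + s *\<^sub>R ?e) $ j) * max 0 (1 - (x + s *\<^sub>R ?e) \<bullet> (x + s *\<^sub>R ?e)) ^ 2) has_real_derivative
     bump2 j x) (at 0)"
    using DERIV_mult[OF DERIV_cmult[OF xj, of "- 6"] c2]
    by (simp add: bump2_def power2_eq_square algebra_simps)
  then show "((\<lambda>s. bump1 j (x + s *\<^sub>R ?e)) has_vector_derivative bump2 j x) (at 0)"
    by (simp add: bump1_def has_real_derivative_iff_has_vector_derivative)
qed

text \<open>An open set of measure zero is empty, so the integral cannot vanish.\<close>

lemma integral_continuous_pos:
  fixes f :: "'a::euclidean_space \<Rightarrow> real"
  assumes c: "continuous_on UNIV f" and i: "integrable lborel f" and nn: "\<And>x. f x \<ge> 0" and p: "f x0 > 0"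
  shows "(LBINT x. f x) > 0"
proof -
  have "(LBINT x. f x) \<noteq> 0"
  proof
    assume "(LBINT x. f x) = 0"
    then have ae: "AE x in lborel. f x = 0"
      using integral_nonneg_eq_0_iff_AE[OF i] nn by simp
    have o: "open {x. f x > 0}" using open_Collect_less[OF continuous_on_const c] by simp
    have "{x. f x > 0} \<in> null_sets lborel"
      using ae by (subst AE_iff_null_sets) (use o in \<open>auto elim: eventually_mono\<close>)
    then have "negligible {x. f x > 0}"
      by (simp add: negligible_iff_null_sets null_sets_completionI)
    moreover have "\<not> negligible {x. f x > 0}" using p by (intro open_not_negligible o) auto
    ultimately show False by simp
  qed
  moreover have "(LBINT x. f x) \<ge> 0" using nn by (intro Bochner_Integration.integral_nonneg) auto
  ultimately show ?thesis by simp
qed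

text \<open>With the scale inside the argument, as \<open>x + \<epsilon> z\<close>, there is no
  factor singular in the scale, and the convolution stays jointly continuous at scale 0. The
  parameter \<open>q\<close> is the pair of scale and original parameter.\<close>

lemma edec_mollify:
  fixes f :: "'p::euclidean_space \<Rightarrow> 'a::euclidean_space \<Rightarrow> 'b::{banach,second_countable_topology}" and \<zeta> :: "'a \<Rightarrow> real"
  assumes f: "edec f" and \<zeta>: "continuous_on UNIV \<zeta>" and z: "\<And>z. norm z \<ge> 1 \<Longrightarrow> \<zeta> z = 0"
  shows "edec (\<lambda>q x. LBINT z. \<zeta> z *\<^sub>R f (snd q) (x + fst q *\<^sub>R z))"
proof (rule edecI)
  have e: "edec (\<lambda>y z. \<zeta> z *\<^sub>R f (snd (fst y)) (snd y + fst (fst y) *\<^sub>R z))"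
  proof (rule edec_compact_support[where R = 1])
    have "continuous_on UNIV (\<lambda>y::((real \<times> 'p) \<times> 'a) \<times> 'a. \<zeta> (snd y) *\<^sub>R f (snd (fst (fst y))) (snd (fst y) + fst (fst (fst y)) *\<^sub>R snd y))"
      by (intro continuous_on_scaleR continuous_on_compose2[OF \<zeta>] edec_continuous_compose[OF f] continuous_intros) auto
    then show "continuous_on UNIV (\<lambda>(y, z). \<zeta> z *\<^sub>R f (snd (fst y)) (snd y + fst (fst y) *\<^sub>R z))"
      by (simp add: case_prod_beta')
  qed (simp add: z)
  show "continuous_on UNIV (\<lambda>(q, x). LBINT z. \<zeta> z *\<^sub>R f (snd q) (x + fst q *\<^sub>R z))"
    using edec_continuous_integral[OF e, of UNIV] by (simp add: case_prod_beta')
  have i\<zeta>: "integrable lborel \<zeta>"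
    by (rule integrable_edec, rule edec_compact_support[where R = 1])
       (use \<zeta> z in \<open>auto simp: case_prod_beta' intro!: continuous_on_compose2[OF \<zeta>] continuous_intros\<close>)
  fix r
  obtain C \<gamma> where *: "C > 0" "\<gamma> > 0" "\<And>p x. norm p \<le> r \<Longrightarrow> norm (f p x) \<le> C * exp (- \<gamma> * norm x)"
    using edec_bound[OF f, of r] by blast
  have "norm (LBINT z. \<zeta> z *\<^sub>R f (snd q) (x + fst q *\<^sub>R z)) \<le> ((LBINT z. \<bar>\<zeta> z\<bar>) * (C * exp (\<gamma> * r))) * exp (- \<gamma> * norm x)"
    if q: "norm q \<le> r" for q x
  proof -
    have q1: "\<bar>fst q\<bar> \<le> r" "norm (snd q) \<le> r" using q norm_fst_le[of "fst q" "snd q"] norm_snd_le[of "snd q" "fst q"] by auto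
    have pw: "norm (\<zeta> z *\<^sub>R f (snd q) (x + fst q *\<^sub>R z)) \<le> \<bar>\<zeta> z\<bar> * (C * exp (\<gamma> * r) * exp (- \<gamma> * norm x))" for z
    proof (cases "norm z \<ge> 1")
      case False
      have "norm (fst q *\<^sub>R z) \<le> r * 1" using q1 False by (simp only: norm_scaleR) (intro mult_mono, auto)
      then have "C * exp (- \<gamma> * norm (x + fst q *\<^sub>R z)) \<le> C * (exp (\<gamma> * r) * exp (- \<gamma> * norm x))"
        using *(1,2) by (intro mult_left_mono exp_norm_shift) auto
      then have "norm (f (snd q) (x + fst q *\<^sub>R z)) \<le> C * exp (\<gamma> * r) * exp (- \<gamma> * norm x)"
        using order_trans[OF *(3)[OF q1(2)]] by (simp only: mult.assoc)
      then show ?thesis unfolding norm_scaleR by (intro mult_left_mono) auto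
    qed (simp add: z)
    have "norm (LBINT z. \<zeta> z *\<^sub>R f (snd q) (x + fst q *\<^sub>R z)) \<le> (LBINT z. \<bar>\<zeta> z\<bar> * (C * exp (\<gamma> * r) * exp (- \<gamma> * norm x)))"
      using i\<zeta>
      by (intro Bochner_Integration.integral_norm_bound_integral pw) (use edec_integrable[OF e, of "(q, x)"] in auto)
    then show ?thesis by (simp add: mult_ac)
  qed
  then show "\<exists>C \<gamma>. \<gamma> > 0 \<and> (\<forall>q x. norm q \<le> r \<longrightarrow> norm (LBINT z. \<zeta> z *\<^sub>R f (snd q) (x + fst q *\<^sub>R z)) \<le> C * exp (- \<gamma> * norm x))"
    using *(2) by blast
qed

text \<open>The second equation moves the derivative to the kernel at the price of a factor
  1/\<epsilon>. It is the source of decay for mollified derivatives: \<open>f1\<close> is only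
  continuous, whereas \<open>f\<close> may decay.\<close>

lemma mollify_space_derivative:
  fixes f f1 :: "'a::euclidean_space \<Rightarrow> 'b::{banach,second_countable_topology}" and \<zeta> \<zeta>1 :: "'a \<Rightarrow> real"
  assumes \<zeta>: "continuous_on UNIV \<zeta>" "\<And>z. norm z \<ge> 1 \<Longrightarrow> \<zeta> z = 0"
    and \<zeta>1: "continuous_on UNIV \<zeta>1" "\<And>z. norm z \<ge> 1 \<Longrightarrow> \<zeta>1 z = 0"
    and d\<zeta>: "\<And>z. ((\<lambda>s. \<zeta> (z + s *\<^sub>R e)) has_vector_derivative \<zeta>1 z) (at 0)"
    and f: "continuous_on UNIV f" "continuous_on UNIV f1"
    and df: "\<And>x. ((\<lambda>s. f (x + s *\<^sub>R e)) has_vector_derivative f1 x) (at 0)"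
  shows "((\<lambda>s. LBINT z. \<zeta> z *\<^sub>R f (x + s *\<^sub>R e + \<epsilon> *\<^sub>R z)) has_vector_derivative (LBINT z. \<zeta> z *\<^sub>R f1 (x + \<epsilon> *\<^sub>R z))) (at 0)"
    and "\<epsilon> *\<^sub>R (LBINT z. \<zeta> z *\<^sub>R f1 (x + \<epsilon> *\<^sub>R z)) = - (LBINT z. \<zeta>1 z *\<^sub>R f (x + \<epsilon> *\<^sub>R z))"
proof -
  have ed: "edec (\<lambda>s z. \<xi> z *\<^sub>R g (x + s *\<^sub>R e + \<epsilon> *\<^sub>R z))" if "continuous_on UNIV \<xi>" "continuous_on UNIV g" "\<And>z. norm z \<ge> 1 \<Longrightarrow> \<xi> z = 0"
    for \<xi> :: "'a \<Rightarrow> real" and g :: "'a \<Rightarrow> 'b"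
  proof (rule edec_compact_support[where R = 1])
    show "continuous_on UNIV (\<lambda>(s, z). \<xi> z *\<^sub>R g (x + s *\<^sub>R e + \<epsilon> *\<^sub>R z))"
      unfolding case_prod_beta'
      by (intro continuous_on_scaleR continuous_on_compose2[OF that(1)] continuous_on_compose2[OF that(2)] continuous_intros) auto
  qed (simp add: that)
  have dl: "((\<lambda>s. f (y + s *\<^sub>R e)) has_vector_derivative f1 (y + s *\<^sub>R e)) (at s)" for y s
    by (rule has_vector_derivative_line[OF df])
  have "((\<lambda>s. LBINT z. \<zeta> z *\<^sub>R f (x + s *\<^sub>R e + \<epsilon> *\<^sub>R z)) has_vector_derivative (LBINT z. \<zeta> z *\<^sub>R f1 (x + 0 *\<^sub>R e + \<epsilon> *\<^sub>R z))) (at 0)"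
  proof (rule edec_has_vector_derivative_integral[OF ed[OF \<zeta>(1) f(1) \<zeta>(2)] ed[OF \<zeta>(1) f(2) \<zeta>(2)]])
    fix t z
    have "((\<lambda>t. \<zeta> z *\<^sub>R f ((x + \<epsilon> *\<^sub>R z) + t *\<^sub>R e)) has_vector_derivative \<zeta> z *\<^sub>R f1 ((x + \<epsilon> *\<^sub>R z) + t *\<^sub>R e)) (at t)"
      by (rule bounded_linear.has_vector_derivative[OF bounded_linear_scaleR_right dl])
    then show "((\<lambda>t. \<zeta> z *\<^sub>R f (x + t *\<^sub>R e + \<epsilon> *\<^sub>R z)) has_vector_derivative \<zeta> z *\<^sub>R f1 (x + t *\<^sub>R e + \<epsilon> *\<^sub>R z)) (at t)"
      by (simp add: add_ac)
  qed
  then show "((\<lambda>s. LBINT z. \<zeta> z *\<^sub>R f (x + s *\<^sub>R e + \<epsilon> *\<^sub>R z)) has_vector_derivative (LBINT z. \<zeta> z *\<^sub>R f1 (x + \<epsilon> *\<^sub>R z))) (at 0)"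
    by simp
  have c: "edec (\<lambda>(s::real) z. \<xi> z *\<^sub>R g (x + \<epsilon> *\<^sub>R z))" if "continuous_on UNIV \<xi>" "continuous_on UNIV g" "\<And>z. norm z \<ge> 1 \<Longrightarrow> \<xi> z = 0"
    for \<xi> :: "'a \<Rightarrow> real" and g :: "'a \<Rightarrow> 'b"
  proof (rule edec_compact_support[where R = 1])
    show "continuous_on UNIV (\<lambda>(s::real, z). \<xi> z *\<^sub>R g (x + \<epsilon> *\<^sub>R z))"
      unfolding case_prod_beta'
      by (intro continuous_on_scaleR continuous_on_compose2[OF that(1)] continuous_on_compose2[OF that(2)] continuous_intros) auto
  qed (simp add: that)
  note c1 = c[OF \<zeta>1(1) f(1) \<zeta>1(2)] and c2 = edec_bounded_linear[where T = "\<lambda>x. \<epsilon> *\<^sub>R x", OF bounded_linear_scaleR_right c[OF \<zeta>(1) f(2) \<zeta>(2)]]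
  \<comment> \<open>The integrand is the derivative in \<open>z\<close> along \<open>e\<close> of
    \<zeta>(z) f(x + \<epsilon> z); the chain rule produces the factor \<epsilon>.\<close>
  have "(LBINT z. \<zeta>1 z *\<^sub>R f (x + \<epsilon> *\<^sub>R z) + \<epsilon> *\<^sub>R (\<zeta> z *\<^sub>R f1 (x + \<epsilon> *\<^sub>R z))) = 0"
  proof (rule integral_line_derivative_zero[OF c[OF \<zeta>(1) f(1) \<zeta>(2)] edec_add[OF c1 c2]])
    fix z
    have "((\<lambda>s. f ((x + \<epsilon> *\<^sub>R z) + s *\<^sub>R e)) \<circ> (\<lambda>s. \<epsilon> * s) has_vector_derivative \<epsilon> *\<^sub>R f1 ((x + \<epsilon> *\<^sub>R z) + (\<epsilon> * 0) *\<^sub>R e)) (at 0)"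
      by (rule vector_diff_chain_at[OF _ dl]) (auto intro!: derivative_eq_intros)
    then have "((\<lambda>s. f (x + \<epsilon> *\<^sub>R (z + s *\<^sub>R e))) has_vector_derivative \<epsilon> *\<^sub>R f1 (x + \<epsilon> *\<^sub>R z)) (at 0)"
      by (simp add: o_def scaleR_add_right add.assoc)
    from has_vector_derivative_scaleR[OF _ this, where f = "\<lambda>s. \<zeta> (z + s *\<^sub>R e)" and f' = "\<zeta>1 z"] d\<zeta>[of z]
    show "((\<lambda>s. \<zeta> (z + s *\<^sub>R e) *\<^sub>R f (x + \<epsilon> *\<^sub>R (z + s *\<^sub>R e))) has_vector_derivative
      \<zeta>1 z *\<^sub>R f (x + \<epsilon> *\<^sub>R z) + \<epsilon> *\<^sub>R (\<zeta> z *\<^sub>R f1 (x + \<epsilon> *\<^sub>R z))) (at 0)"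
      by (simp add: has_real_derivative_iff_has_vector_derivative add.commute scaleR_left_commute mult.commute)
  qed
  then have "(LBINT z. \<zeta>1 z *\<^sub>R f (x + \<epsilon> *\<^sub>R z)) + \<epsilon> *\<^sub>R (LBINT z. \<zeta> z *\<^sub>R f1 (x + \<epsilon> *\<^sub>R z)) = 0"
    using edec_integrable[OF c1] edec_integrable[OF c2] by (simp del: scaleR_scaleR)
  then show "\<epsilon> *\<^sub>R (LBINT z. \<zeta> z *\<^sub>R f1 (x + \<epsilon> *\<^sub>R z)) = - (LBINT z. \<zeta>1 z *\<^sub>R f (x + \<epsilon> *\<^sub>R z))"
    by (simp add: eq_neg_iff_add_eq_0 add.commute)
qed

text \<open>The kernel has compact support, so continuity of \<open>ut\<close> suffices for
  differentiation under the integral.\<close>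

lemma mollify_time_derivative:
  fixes u ut :: "real \<Rightarrow> 'a::euclidean_space \<Rightarrow> 'b::{banach,second_countable_topology}" and \<zeta> :: "'a \<Rightarrow> real"
  assumes \<zeta>: "continuous_on UNIV \<zeta>" "\<And>z. norm z \<ge> 1 \<Longrightarrow> \<zeta> z = 0"
    and u: "continuous_on UNIV (\<lambda>(t, x). u t x)" "continuous_on UNIV (\<lambda>(t, x). ut t x)"
    and du: "\<And>t x. ((\<lambda>t. u t x) has_vector_derivative ut t x) (at t)"
  shows "((\<lambda>t. LBINT z. \<zeta> z *\<^sub>R u t (x + \<epsilon> *\<^sub>R z)) has_vector_derivative (LBINT z. \<zeta> z *\<^sub>R ut t (x + \<epsilon> *\<^sub>R z))) (at t)"
proof -
  have ed: "edec (\<lambda>t z. \<zeta> z *\<^sub>R g t (x + \<epsilon> *\<^sub>R z))" if "continuous_on UNIV (\<lambda>(t, x). g t x)" for g :: "real \<Rightarrow> 'a \<Rightarrow> 'b"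
  proof (rule edec_compact_support[where R = 1])
    have "continuous_on UNIV (\<lambda>y. g (fst y) (x + \<epsilon> *\<^sub>R snd y))"
    proof -
      have "continuous_on UNIV (\<lambda>y::real \<times> 'a. (fst y, x + \<epsilon> *\<^sub>R snd y))"
        by (intro continuous_intros)
      from continuous_on_compose2[OF that this] show ?thesis by simp
    qed
    then show "continuous_on UNIV (\<lambda>(t, z). \<zeta> z *\<^sub>R g t (x + \<epsilon> *\<^sub>R z))"
      unfolding case_prod_beta'
      by (intro continuous_on_scaleR continuous_on_compose2[OF \<zeta>(1)] continuous_intros) auto
  qed (simp add: \<zeta>)
  show ?thesis
    by (rule edec_has_vector_derivative_integral[OF ed[OF u(1)] ed[OF u(2)]])
       (rule bounded_linear.has_vector_derivative[OF bounded_linear_scaleR_right du])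
qed

subsection \<open>Correlations of a decaying Schroedinger flow\<close>

text \<open>The equation i w_t + \<Delta>w = f, with decay of \<open>w\<close>, \<open>f\<close> and
  the space derivatives involved, so that integration by parts is unrestricted. It is instantiated
  by mollifications of the solution at nonzero scale.\<close>

locale decaying_flow =
  fixes w f :: "real \<Rightarrow> real ^ 'n::finite \<Rightarrow> complex"
    and w1 w2 :: "'n \<Rightarrow> real \<Rightarrow> real ^ 'n \<Rightarrow> complex"
  assumes w: "edec w" and f: "edec f" and w1: "\<And>j. edec (w1 j)" and w2: "\<And>j. edec (w2 j)"
    and d1: "\<And>j t x. ((\<lambda>s. w t (x + s *\<^sub>R axis j 1)) has_vector_derivative w1 j t x) (at 0)"
    and d2: "\<And>j t x. ((\<lambda>s. w1 j t (x + s *\<^sub>R axis j 1)) has_vector_derivative w2 j t x) (at 0)"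
    and eqn: "\<And>t x. ((\<lambda>t. w t x) has_vector_derivative (- \<i> * f t x + \<i> * (\<Sum>j\<in>UNIV. w2 j t x))) (at t)"
begin

abbreviation pr :: "(real \<Rightarrow> real ^ 'n \<Rightarrow> complex) \<Rightarrow> (real \<Rightarrow> real ^ 'n \<Rightarrow> complex) \<Rightarrow> real ^ 'n \<Rightarrow> real \<Rightarrow> real ^ 'n \<Rightarrow> complex" where
  "pr X Y h t x \<equiv> X t (x + h) * cnj (Y t x)"

lemma edec_pair1:
  fixes X Y :: "real \<Rightarrow> real ^ 'n \<Rightarrow> complex"
  assumes X: "edec X" and Y: "edec Y"
  shows "edec (pr X Y h)"
  using edec_reparam[OF X continuous_on_id continuous_on_const] Y
  by (intro edec_mult edec_cnj) auto

lemma edec_pair: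
  fixes X Y :: "real \<Rightarrow> real ^ 'n \<Rightarrow> complex"
  assumes "edec X" "edec Y"
  shows "edec (\<lambda>t x. of_real (\<alpha> + \<beta> * x $ j) * (pr X Y h t x))"
  by (rule edec_affine_weight[OF edec_pair1[OF assms] continuous_on_const])

lemma integrable_pair:
  fixes X Y :: "real \<Rightarrow> real ^ 'n \<Rightarrow> complex"
  assumes "edec X" "edec Y"
  shows "integrable lborel (\<lambda>x. of_real (\<alpha> + \<beta> * x $ j) * (pr X Y h t x))"
    "integrable lborel (pr X Y h t)"
  using edec_integrable[OF edec_pair[OF assms]] edec_integrable[OF edec_pair1[OF assms]] by blast+

lemma edec_freeze: "edec X \<Longrightarrow> edec (\<lambda>_::real. X t)"
  using edec_reparam[of X "\<lambda>_::real. t" "\<lambda>_. 0"] by (simp add: continuous_on_const)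

lemma line_derivative_shift:
  fixes X Y :: "real ^ 'n \<Rightarrow> complex"
  assumes "\<And>x. ((\<lambda>s. X (x + s *\<^sub>R e)) has_vector_derivative Y x) (at 0)"
  shows "((\<lambda>s. X (x + s *\<^sub>R e + h)) has_vector_derivative Y (x + h)) (at 0)"
  using assms[of "x + h"] by (simp add: add_ac)

text \<open>Green's identity for the antisymmetric current of the two factors: the mixed products of
  first derivatives cancel, and only the derivative of the weight remains, which is \<beta> in
  direction \<open>j\<close> and zero in the others.\<close>

lemma integral_current:
  "(LBINT x. of_real (\<alpha> + \<beta> * x $ j) * (pr (w2 k) w h t x - pr w (w2 k) h t x))
   = (if k = j then - 2 * of_real \<beta> * (LBINT x. pr (w1 j) w h t x) else 0)"
proof -
  let ?a = "\<lambda>x. complex_of_real (\<alpha> + \<beta> * x $ j)"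
  let ?b = "complex_of_real (if k = j then \<beta> else 0)"
  have [simp]: "integrable lborel (\<lambda>x. ?a x * (pr X Y h t x))" if "edec X" "edec Y" for X Y
    using integrable_pair(1)[OF that] .
  have da: "((\<lambda>s. ?a (x + s *\<^sub>R axis k 1)) has_vector_derivative ?b) (at 0)" for x
  proof -
    have "((\<lambda>s. \<alpha> + \<beta> * (x + s *\<^sub>R axis k 1) $ j) has_vector_derivative (if k = j then \<beta> else 0)) (at 0)"
      unfolding has_real_derivative_iff_has_vector_derivative[symmetric]
      by (auto intro!: derivative_eq_intros simp: axis_def)
    then show ?thesis by (rule bounded_linear.has_vector_derivative[OF bounded_linear_of_real])
  qed
  have dw: "((\<lambda>s. w t (x + s *\<^sub>R axis k 1 + h)) has_vector_derivative w1 k t (x + h)) (at 0)"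
    "((\<lambda>s. w1 k t (x + s *\<^sub>R axis k 1 + h)) has_vector_derivative w2 k t (x + h)) (at 0)" for x h
    by (rule line_derivative_shift, rule d1) (rule line_derivative_shift, rule d2)
  note dwc = dw(1)[of _ 0, simplified, THEN has_vector_derivative_cnj] dw(2)[of _ 0, simplified, THEN has_vector_derivative_cnj]
  \<comment> \<open>Integrating the total derivative of the product shows that both halves of the
    current have the same integral up to sign, hence the factor 2 in the result.\<close>
  have parts: "(LBINT x. pr (w1 k) w h t x) = - (LBINT x. pr w (w1 k) h t x)"
  proof -
    have "(LBINT x. pr (w1 k) w h t x + pr w (w1 k) h t x) = 0"
    proof (rule integral_line_derivative_zero[where e = "axis k 1"])
      show "edec (\<lambda>_::real. \<lambda>x. pr w w h t x)"
        by (rule edec_freeze[OF edec_pair1]) (rule w)+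
      show "edec (\<lambda>_::real. \<lambda>x. pr (w1 k) w h t x + pr w (w1 k) h t x)"
        by (intro edec_add edec_freeze[OF edec_pair1] w w1)
      show "((\<lambda>s. w t (x + s *\<^sub>R axis k 1 + h) * cnj (w t (x + s *\<^sub>R axis k 1))) has_vector_derivative
            pr (w1 k) w h t x + pr w (w1 k) h t x) (at 0)" for x
        using has_vector_derivative_mult[OF dw(1) dwc(1), of h x x] by (simp add: add_ac)
    qed
    then show ?thesis using integrable_pair(2)[OF w1 w] integrable_pair(2)[OF w w1]
      by (simp add: eq_neg_iff_add_eq_0)
  qed
  have "(LBINT x. (?b * (pr (w1 k) w h t x - pr w (w1 k) h t x)
        + (?a x * (pr (w2 k) w h t x) - ?a x * (pr w (w2 k) h t x)))) = 0"
  proof (rule integral_line_derivative_zero[where e = "axis k 1"])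
    show "edec (\<lambda>_::real. \<lambda>x. ?a x * (pr (w1 k) w h t x) - ?a x * (pr w (w1 k) h t x))"
      by (intro edec_diff edec_freeze[OF edec_pair] w w1)
    show "edec (\<lambda>_::real. \<lambda>x. (?b * (pr (w1 k) w h t x - pr w (w1 k) h t x)
        + (?a x * (pr (w2 k) w h t x) - ?a x * (pr w (w2 k) h t x))))"
      by (intro edec_diff edec_add edec_cmult edec_freeze[OF edec_pair] edec_freeze[OF edec_pair1] w w1 w2)
    fix x
    have *: "((\<lambda>s. w1 k t (x + s *\<^sub>R axis k 1 + h) * cnj (w t (x + s *\<^sub>R axis k 1)) - w t (x + s *\<^sub>R axis k 1 + h) * cnj (w1 k t (x + s *\<^sub>R axis k 1)))
       has_vector_derivative (pr (w2 k) w h t x - pr w (w2 k) h t x)) (at 0)"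
      using has_vector_derivative_diff[OF has_vector_derivative_mult[OF dw(2) dwc(1), of h x x] has_vector_derivative_mult[OF dw(1) dwc(2), of h x x]]
      by (simp add: add_ac)
    show "((\<lambda>s. ?a (x + s *\<^sub>R axis k 1) * (w1 k t (x + s *\<^sub>R axis k 1 + h) * cnj (w t (x + s *\<^sub>R axis k 1)))
            - ?a (x + s *\<^sub>R axis k 1) * (w t (x + s *\<^sub>R axis k 1 + h) * cnj (w1 k t (x + s *\<^sub>R axis k 1)))) has_vector_derivative
         (?b * (pr (w1 k) w h t x - pr w (w1 k) h t x)
        + (?a x * (pr (w2 k) w h t x) - ?a x * (pr w (w2 k) h t x)))) (at 0)"
      using has_vector_derivative_mult[OF da[of x] *] by (simp only: right_diff_distrib[symmetric] scaleR_zero_left add_0_left add_0_right add.commute)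
  qed
  then have E: "?b * ((LBINT x. pr (w1 k) w h t x) - (LBINT x. pr w (w1 k) h t x))
    + (LBINT x. (?a x * (pr (w2 k) w h t x) - ?a x * (pr w (w2 k) h t x))) = 0"
    by (subst (asm) Bochner_Integration.integral_add
        [OF integrable_mult_right[OF Bochner_Integration.integrable_diff[OF integrable_pair(2)[OF w1 w] integrable_pair(2)[OF w w1]]]
            Bochner_Integration.integrable_diff[OF integrable_pair(1)[OF w2 w] integrable_pair(1)[OF w w2]]])
       (simp only: integral_mult_right_zero Bochner_Integration.integral_diff[OF integrable_pair(2)[OF w1 w] integrable_pair(2)[OF w w1]])
  have alg: "I = (if k = j then - 2 * of_real \<beta> * P else 0)" if "?b * (P - Q) + I = 0" "P = - Q" for P Q I
    using that by (cases "k = j") (auto simp: add_eq_0_iff algebra_simps)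
  show ?thesis
  proof (cases "k = j")
    case True
    then show ?thesis using alg[OF E parts] by (simp only: right_diff_distrib[of "?a x" for x] if_True refl)
  next
    case False
    then show ?thesis using alg[OF E parts] by (simp only: right_diff_distrib[of "?a x" for x] if_False)
  qed
qed

text \<open>The Laplacians of the two factors combine into the currents of
  \<open>integral_current\<close>, and only direction \<open>j\<close> survives the sum.\<close>

lemma weighted_correlation_derivative:
  "((\<lambda>t. LBINT x. of_real (\<alpha> + \<beta> * x $ j) * (pr w w h t x)) has_vector_derivative
     (- \<i> * (LBINT x. of_real (\<alpha> + \<beta> * x $ j) * (pr f w h t x - pr w f h t x))
      - 2 * \<i> * of_real \<beta> * (LBINT x. pr (w1 j) w h t x))) (at t)"
proof -
  let ?a = "\<lambda>x. complex_of_real (\<alpha> + \<beta> * x $ j)"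
  let ?N = "\<lambda>t x. ?a x * (pr f w h t x) - ?a x * (pr w f h t x)"
  let ?L = "\<lambda>k t x. ?a x * (pr (w2 k) w h t x) - ?a x * (pr w (w2 k) h t x)"
  have eN: "edec ?N" and eL: "\<And>k. edec (?L k)"
    by (intro edec_diff edec_pair w f w2)+
  have "((\<lambda>t. LBINT x. ?a x * (pr w w h t x)) has_vector_derivative
     (LBINT x. (- \<i> * ?N t x + (\<Sum>k\<in>UNIV. \<i> * ?L k t x)))) (at t)"
  proof (rule edec_has_vector_derivative_integral)
    show "edec (\<lambda>t x. ?a x * (pr w w h t x))" by (intro edec_pair w)
    show "edec (\<lambda>t x. - \<i> * ?N t x + (\<Sum>k\<in>UNIV. \<i> * ?L k t x))"
      by (intro edec_add edec_cmult edec_sum eN eL)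
    fix t x
    have "((\<lambda>t. pr w w h t x) has_vector_derivative
       (w t (x + h) * cnj (- \<i> * f t x + \<i> * (\<Sum>j\<in>UNIV. w2 j t x)) + (- \<i> * f t (x + h) + \<i> * (\<Sum>j\<in>UNIV. w2 j t (x + h))) * cnj (w t x))) (at t)"
      by (rule has_vector_derivative_mult[OF eqn has_vector_derivative_cnj[OF eqn]])
    then have "((\<lambda>t. ?a x * (pr w w h t x)) has_vector_derivative
       ?a x * (w t (x + h) * cnj (- \<i> * f t x + \<i> * (\<Sum>j\<in>UNIV. w2 j t x)) + (- \<i> * f t (x + h) + \<i> * (\<Sum>j\<in>UNIV. w2 j t (x + h))) * cnj (w t x))) (at t)"
      by (rule bounded_linear.has_vector_derivative[OF bounded_linear_mult_right])
    moreover have "?a x * (w t (x + h) * cnj (- \<i> * f t x + \<i> * (\<Sum>j\<in>UNIV. w2 j t x)) + (- \<i> * f t (x + h) + \<i> * (\<Sum>j\<in>UNIV. w2 j t (x + h))) * cnj (w t x))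
       = - \<i> * ?N t x + (\<Sum>k\<in>UNIV. \<i> * ?L k t x)"
    proof -
      have "(\<Sum>k\<in>UNIV. \<i> * ?L k t x) = \<i> * (?a x * (((\<Sum>k\<in>UNIV. w2 k t (x + h))) * cnj (w t x)) - ?a x * (w t (x + h) * cnj (\<Sum>k\<in>UNIV. w2 k t x)))"
        by (simp only: sum_subtractf sum_distrib_left sum_distrib_right cnj_sum right_diff_distrib)
      then show ?thesis by (simp add: algebra_simps)
    qed
    ultimately show "((\<lambda>t. ?a x * (pr w w h t x)) has_vector_derivative - \<i> * ?N t x + (\<Sum>k\<in>UNIV. \<i> * ?L k t x)) (at t)"
      by simp
  qed
  moreover have "(LBINT x. (- \<i> * ?N t x + (\<Sum>k\<in>UNIV. \<i> * ?L k t x))) = - \<i> * (LBINT x. ?N t x) + (\<Sum>k\<in>UNIV. \<i> * (LBINT x. ?L k t x))"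
    using edec_integrable[OF eN] edec_integrable[OF eL]
    by (subst Bochner_Integration.integral_add) auto
  moreover have "(\<Sum>k\<in>UNIV. \<i> * (LBINT x. ?L k t x)) = - 2 * \<i> * of_real \<beta> * (LBINT x. pr (w1 j) w h t x)"
  proof -
    have "(\<Sum>k\<in>UNIV. \<i> * (LBINT x. ?L k t x)) = (\<Sum>k\<in>UNIV. if k = j then - 2 * \<i> * of_real \<beta> * (LBINT x. pr (w1 j) w h t x) else 0)"
      unfolding right_diff_distrib[symmetric] integral_current by (intro sum.cong) auto
    then show ?thesis by simp
  qed
  moreover have "- \<i> * (LBINT x. ?N t x) + - 2 * \<i> * of_real \<beta> * (LBINT x. pr (w1 j) w h t x)
     = - \<i> * (LBINT x. ?a x * (pr f w h t x - pr w f h t x))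
      - 2 * \<i> * of_real \<beta> * (LBINT x. pr (w1 j) w h t x)"
    by (simp only: right_diff_distrib) simp
  ultimately show ?thesis by (simp only:)
qed

text \<open>Identifies the gradient term of the weighted balance as the derivative, in the shift, of
  the unweighted correlation. This is what lets the gradient be eliminated by integration in
  \<open>s\<close>.\<close>

lemma correlation_shift_derivative:
  "((\<lambda>s. LBINT x. w t (x + s *\<^sub>R axis j 1) * cnj (w t x)) has_vector_derivative
     (LBINT x. w1 j t (x + s *\<^sub>R axis j 1) * cnj (w t x))) (at s)"
proof (rule edec_has_vector_derivative_integral)
  have "edec (\<lambda>s x. X t (x + s *\<^sub>R axis j 1) * cnj (w t x))" if "edec X" for X
    by (rule edec_mult[OF edec_const_reparam[OF edec_freeze[OF that]] edec_cnj[OF edec_freeze[OF w]]])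
       (intro continuous_intros)
  then show "edec (\<lambda>s x. w t (x + s *\<^sub>R axis j 1) * cnj (w t x))" "edec (\<lambda>s x. w1 j t (x + s *\<^sub>R axis j 1) * cnj (w t x))"
    using w w1 by blast+
  show "((\<lambda>s. w t (x + s *\<^sub>R axis j 1) * cnj (w t x)) has_vector_derivative w1 j t (x + s *\<^sub>R axis j 1) * cnj (w t x)) (at s)" for s x
    by (rule bounded_linear.has_vector_derivative[OF bounded_linear_mult_left has_vector_derivative_line[OF d1]])
qed

end

subsection \<open>The solution and its mollifications\<close>

text \<open>Passage to the limit for mollified identities: they hold at every nonzero scale and
  depend continuously on it.\<close>

lemma continuous_eq_at_0:
  fixes h :: "real \<Rightarrow> 'b::t2_space"
  assumes "continuous_on UNIV h" and "\<And>\<epsilon>. \<epsilon> \<noteq> 0 \<Longrightarrow> h \<epsilon> = c"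
  shows "h 0 = c"
proof -
  have "(h \<longlongrightarrow> h 0) (at 0)" using assms(1) by (simp add: continuous_on_def)
  moreover have "(h \<longlongrightarrow> c) (at 0)"
    by (rule tendsto_eventually) (auto simp: eventually_at_filter assms(2))
  ultimately show ?thesis using tendsto_unique at_neq_bot by blast
qed

lemma continuous_integral_param:
  fixes f :: "'p::topological_space \<Rightarrow> real \<Rightarrow> 'b::banach"
  assumes "continuous_on UNIV (\<lambda>y. f (fst y) (snd y))"
  shows "continuous_on UNIV (\<lambda>p. integral {a..b} (f p))"
  using integral_continuous_on_param[of UNIV a b f] continuous_on_subset[OF assms, of "UNIV \<times> {a..b}"]
  by (simp add: case_prod_beta')

locale cqnls_decay =
  fixes l1 l2 \<tau> :: real and u ut :: "real \<Rightarrow> real ^ 'n::finite \<Rightarrow> complex"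
  assumes tau: "\<tau> > 0" and periodic: "u (t + \<tau>) x = u t x"
    and C2: "Ck 2 (u t)"
    and ut: "((\<lambda>s. u s x) has_vector_derivative ut t x) (at t)"
    and ut_cont: "continuous_on UNIV (\<lambda>(t, x). ut t x)"
    and eqn: "\<i> * ut t x + laplacian (u t) x =
             of_real (l1 * cmod (u t x) ^ 2) * u t x - of_real (l2 * cmod (u t x) ^ 4) * u t x"
    and decay: "\<exists>C \<gamma>. \<gamma> > 0 \<and> (\<forall>t x. cmod (u t x) \<le> C * exp (- \<gamma> * norm x))"
begin

abbreviation sh :: "'n \<Rightarrow> real \<Rightarrow> real ^ 'n \<Rightarrow> real ^ 'n" where
  "sh j s x \<equiv> x + s *\<^sub>R axis j 1"

abbreviation du :: "'n \<Rightarrow> real \<Rightarrow> real ^ 'n \<Rightarrow> complex" where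
  "du j t \<equiv> pd j (u t)"

abbreviation ddu :: "'n \<Rightarrow> real \<Rightarrow> real ^ 'n \<Rightarrow> complex" where
  "ddu j t \<equiv> pd j (pd j (u t))"

definition gz :: "complex \<Rightarrow> real" where
  "gz z = l1 * (cmod z)\<^sup>2 - l2 * (cmod z) ^ 4"

definition F :: "real \<Rightarrow> real ^ 'n \<Rightarrow> complex" where
  "F t x = of_real (gz (u t x)) * u t x"

lemma pd_derivative:
  assumes "f differentiable_on UNIV"
  shows "((\<lambda>s. f (sh j s x)) has_vector_derivative pd j f x) (at 0)"
proof -
  have "f differentiable (at (x + 0 *\<^sub>R axis j 1))" using assms by (simp add: differentiable_on_def)
  moreover have "(\<lambda>s::real. x + s *\<^sub>R axis j 1) differentiable (at 0)"
    by (intro differentiable_add differentiable_const differentiable_scaleR differentiable_ident)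
  ultimately have "(f \<circ> (\<lambda>s. x + s *\<^sub>R axis j 1)) differentiable (at 0)"
    by (intro differentiable_chain_at) auto
  then show ?thesis by (simp add: pd_def o_def vector_derivative_works)
qed

lemma Ck2D: "u t differentiable_on UNIV" "du j t differentiable_on UNIV" "continuous_on UNIV (ddu j t)"
  using C2[of t] by (simp_all add: numeral_2_eq_2)

lemma u_space_cont: "continuous_on S (u t)" "continuous_on S (du j t)" "continuous_on S (ddu j t)"
  using Ck2D differentiable_imp_continuous_on continuous_on_subset subset_UNIV by metis+

lemma du: "((\<lambda>s. u t (sh j s x)) has_vector_derivative du j t x) (at 0)"
  by (rule pd_derivative[OF Ck2D(1)])

lemma ddu: "((\<lambda>s. du j t (sh j s x)) has_vector_derivative ddu j t x) (at 0)"
  by (rule pd_derivative[OF Ck2D(2)])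

lemma u_lipschitz_local:
  obtains B where "\<And>s t x. \<bar>s\<bar> \<le> r \<Longrightarrow> \<bar>t\<bar> \<le> r \<Longrightarrow> norm x \<le> R \<Longrightarrow> cmod (u s x - u t x) \<le> B * \<bar>s - t\<bar>"
proof -
  obtain B where B: "\<And>y. norm y \<le> \<bar>r\<bar> + \<bar>R\<bar> \<Longrightarrow> norm (case y of (t, x) \<Rightarrow> ut t x) \<le> B"
    using continuous_norm_bound[OF ut_cont] by blast
  show ?thesis
  proof (rule that[of B])
    fix s t and x :: "real ^ 'n" assume *: "\<bar>s\<bar> \<le> r" "\<bar>t\<bar> \<le> r" "norm x \<le> R"
    have "norm (u s x - u t x) \<le> B * norm (s - t)"
    proof (rule differentiable_bound[where S = "{- r..r}" and f = "\<lambda>t. u t x" and f' = "\<lambda>t h. h *\<^sub>R ut t x"])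
      show "((\<lambda>t. u t x) has_derivative (\<lambda>h. h *\<^sub>R ut y x)) (at y within {- r..r})" for y
        using ut[of x y] by (simp add: has_vector_derivative_def has_derivative_at_withinI)
      show "onorm (\<lambda>h. h *\<^sub>R ut y x) \<le> B" if "y \<in> {- r..r}" for y
      proof -
        have "norm (y, x) \<le> \<bar>r\<bar> + \<bar>R\<bar>" using that *(3) norm_Pair_le[of y x] by auto
        then have "norm (ut y x) \<le> B" using B by fastforce
        then show ?thesis by (intro order_trans[OF onorm_le[where b = "norm (ut y x)"]]) auto
      qed
    qed (use * in auto)
    then show "cmod (u s x - u t x) \<le> B * \<bar>s - t\<bar>" by simp
  qed
qed

text \<open>Continuity in \<open>x\<close> at a fixed time is combined with a Lipschitz bound in
  time, uniform on compact sets, which stems from the joint continuity of \<open>ut\<close>.\<close>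

lemma u_cont: "continuous_on UNIV (\<lambda>(t, x). u t x)"
proof -
  have "isCont (\<lambda>(t, x). u t x) (t, x)" for t x
  proof -
    obtain B where B: "\<And>s t' y. \<bar>s\<bar> \<le> \<bar>t\<bar> + 1 \<Longrightarrow> \<bar>t'\<bar> \<le> \<bar>t\<bar> + 1 \<Longrightarrow> norm y \<le> norm x + 1 \<Longrightarrow> cmod (u s y - u t' y) \<le> B * \<bar>s - t'\<bar>"
      using u_lipschitz_local by blast
    have "((\<lambda>y. u (fst y) (snd y) - u t x) \<longlongrightarrow> 0) (at (t, x))"
    proof (rule Lim_null_comparison[where g = "\<lambda>y. B * \<bar>fst y - t\<bar> + cmod (u t (snd y) - u t x)"])
      have "eventually (\<lambda>y. y \<in> ball (t, x) 1) (at (t, x))"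
        by (intro eventually_at_in_open') auto
      then show "\<forall>\<^sub>F y in at (t, x). norm (u (fst y) (snd y) - u t x) \<le> B * \<bar>fst y - t\<bar> + cmod (u t (snd y) - u t x)"
      proof eventually_elim
        case (elim y)
        have "dist t (fst y) < 1" "dist x (snd y) < 1"
          using elim dist_fst_le[of "(t, x)" y] dist_snd_le[of "(t, x)" y] by auto
        then have "\<bar>fst y\<bar> \<le> \<bar>t\<bar> + 1" "norm (snd y) \<le> norm x + 1"
          using norm_triangle_ineq2[of "snd y" x] by (auto simp: dist_norm norm_minus_commute)
        then have "cmod (u (fst y) (snd y) - u t (snd y)) \<le> B * \<bar>fst y - t\<bar>" by (intro B) auto
        then show ?case
          using norm_triangle_ineq[of "u (fst y) (snd y) - u t (snd y)" "u t (snd y) - u t x"] by simp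
      qed
      have "((\<lambda>y. u t (snd y)) \<longlongrightarrow> u t (snd (t, x))) (at (t, x))"
        by (rule isCont_tendsto_compose[of "snd (t, x)" "u t"])
           (use u_space_cont(1)[of UNIV t] in \<open>auto simp: continuous_on_eq_continuous_at intro!: tendsto_eq_intros\<close>)
      then show "((\<lambda>y. B * \<bar>fst y - t\<bar> + cmod (u t (snd y) - u t x)) \<longlongrightarrow> 0) (at (t, x))"
        by (auto intro!: tendsto_eq_intros)
    qed
    then show ?thesis by (simp add: isCont_def LIM_zero_iff case_prod_beta')
  qed
  then show ?thesis by (auto simp: continuous_on_eq_continuous_at)
qed

lemma edec_u: "edec u"
  using u_cont decay unfolding edec_def by blast

lemma edec_F: "edec F"
proof -
  \<comment> \<open>As a polynomial in \<open>u\<close> and its conjugate, \<open>F\<close> falls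
    under the closure rules.\<close>
  have "F = (\<lambda>t x. of_real l1 * (u t x * cnj (u t x) * u t x) - of_real l2 * ((u t x * cnj (u t x)) ^ 2 * u t x))"
  proof (intro ext)
    fix t x
    have "complex_of_real ((cmod (u t x)) ^ 4) = (complex_of_real ((cmod (u t x)) ^ 2)) ^ 2"
      by (simp flip: power_mult of_real_power)
    then show "F t x = of_real l1 * (u t x * cnj (u t x) * u t x) - of_real l2 * ((u t x * cnj (u t x)) ^ 2 * u t x)"
      unfolding F_def gz_def of_real_diff of_real_mult complex_norm_square
      by (simp only: complex_norm_square[symmetric]) (simp add: algebra_simps)
  qed
  moreover have "edec \<dots>"
    by (intro edec_diff edec_cmult edec_mult edec_power edec_cnj edec_u) auto
  ultimately show ?thesis by simp
qed

definition bmass :: real where "bmass = (LBINT z. bump (z :: real ^ 'n))"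

lemma bump_integrable: "integrable lborel (bump :: real ^ 'n \<Rightarrow> real)"
proof (rule integrable_edec, rule edec_compact_support[where R = 1])
  show "continuous_on UNIV (\<lambda>(p::real, x::real ^ 'n). bump x)"
    unfolding case_prod_beta' by (rule continuous_on_compose2[OF continuous_bump(1)]) (auto intro: continuous_intros)
qed (rule bump_support)

lemma bmass_pos: "bmass > 0"
  unfolding bmass_def
  by (rule integral_continuous_pos[where ?x0.0 = 0]) (use bump_integrable in \<open>auto simp: continuous_bump, auto simp: bump_def\<close>)

text \<open>Mollification at scale \<open>\<epsilon>\<close>; the value at \<open>\<epsilon> = 0\<close> is \<open>X\<close> itself, so limits \<open>\<epsilon> \<rightarrow> 0\<close> are
  instances of joint continuity.\<close>

definition moll :: "(real ^ 'n \<Rightarrow> real) \<Rightarrow> (real \<Rightarrow> real ^ 'n \<Rightarrow> complex) \<Rightarrow> real \<Rightarrow> real \<Rightarrow> real ^ 'n \<Rightarrow> complex" where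
  "moll \<zeta> X \<epsilon> t x = (LBINT z. (\<zeta> z / bmass) *\<^sub>R X t (x + \<epsilon> *\<^sub>R z))"

lemma edec_moll:
  assumes "edec X" "continuous_on UNIV \<zeta>" "\<And>z. norm z \<ge> 1 \<Longrightarrow> \<zeta> z = 0"
  shows "edec (\<lambda>q. moll \<zeta> X (fst q) (snd q))" "edec (moll \<zeta> X \<epsilon>)"
proof -
  show 1: "edec (\<lambda>q. moll \<zeta> X (fst q) (snd q))"
    unfolding moll_def using assms bmass_pos
    by (intro edec_mollify continuous_on_divide) (auto intro!: continuous_intros)
  have "edec (\<lambda>t x. moll \<zeta> X (fst (\<epsilon>, t)) (snd (\<epsilon>, t)) (x + 0))"
    by (rule edec_reparam[OF 1]) (intro continuous_intros)+
  then show "edec (moll \<zeta> X \<epsilon>)" by simp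
qed

lemma moll_0: "moll bump X 0 t x = X t x"
proof -
  have "moll bump X 0 t x = (LBINT z. (bump (z::real^'n) / bmass)) *\<^sub>R X t x"
    unfolding moll_def using bump_integrable by simp
  also have "(LBINT z. (bump (z::real^'n) / bmass)) = 1"
    using bmass_pos by (simp add: bmass_def)
  finally show ?thesis by simp
qed

text \<open>At nonzero scale every derivative can be moved to the kernel, so decay of
  \<open>u\<close> alone yields decay of the mollified first and second derivatives. The nonlinear
  term is the mollification of \<open>F\<close> itself, hence no commutator has to be
  estimated.\<close>

lemma mollified_flow:
  assumes e: "\<epsilon> \<noteq> 0"
  shows "decaying_flow (moll bump u \<epsilon>) (moll bump F \<epsilon>) (\<lambda>j. moll bump (du j) \<epsilon>) (\<lambda>j. moll bump (ddu j) \<epsilon>)"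
proof -
  have cd: "continuous_on UNIV (\<lambda>z. \<zeta> z / bmass)" if "continuous_on UNIV \<zeta>" for \<zeta> :: "real ^ 'n \<Rightarrow> real"
    using that bmass_pos by (intro continuous_intros) auto
  have sd: "\<zeta> z / bmass = 0" if "\<zeta> z = 0" for \<zeta> :: "real ^ 'n \<Rightarrow> real" and z using that by simp
  have dd: "((\<lambda>s. \<zeta> (z + s *\<^sub>R axis j 1) / bmass) has_vector_derivative \<zeta>1 z / bmass) (at 0)"
    if "((\<lambda>s. \<zeta> (z + s *\<^sub>R axis j 1)) has_vector_derivative \<zeta>1 z) (at 0)" for \<zeta> \<zeta>1 :: "real ^ 'n \<Rightarrow> real" and z j
    by (rule bounded_linear.has_vector_derivative[OF bounded_linear_divide that])
  note bs = bump_support[THEN sd] and bc = continuous_bump[THEN cd] and bd = bump_derivative[THEN dd]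
  have X: "((\<lambda>s. moll \<zeta> Y \<epsilon> t (sh j s x)) has_vector_derivative moll \<zeta> Y1 \<epsilon> t x) (at 0)"
    "\<epsilon> *\<^sub>R moll \<zeta> Y1 \<epsilon> t x = - moll \<zeta>1 Y \<epsilon> t x"
    if "continuous_on UNIV (\<lambda>z. \<zeta> z / bmass)" "\<And>z. 1 \<le> norm z \<Longrightarrow> \<zeta> z / bmass = 0"
      "continuous_on UNIV (\<lambda>z. \<zeta>1 z / bmass)" "\<And>z. 1 \<le> norm z \<Longrightarrow> \<zeta>1 z / bmass = 0"
      "\<And>z. ((\<lambda>s. \<zeta> (sh j s z) / bmass) has_vector_derivative \<zeta>1 z / bmass) (at 0)"
      "continuous_on UNIV (Y t)" "continuous_on UNIV (Y1 t)"
      "\<And>x. ((\<lambda>s. Y t (sh j s x)) has_vector_derivative Y1 t x) (at 0)" for \<zeta> \<zeta>1 Y Y1 j t x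
  proof -
    note m = mollify_space_derivative[where \<zeta> = "\<lambda>z. \<zeta> z / bmass" and ?\<zeta>1.0 = "\<lambda>z. \<zeta>1 z / bmass"
        and e = "axis j 1" and f = "Y t" and ?f1.0 = "Y1 t", OF that]
    show "((\<lambda>s. moll \<zeta> Y \<epsilon> t (sh j s x)) has_vector_derivative moll \<zeta> Y1 \<epsilon> t x) (at 0)"
      unfolding moll_def by (rule m(1))
    show "\<epsilon> *\<^sub>R moll \<zeta> Y1 \<epsilon> t x = - moll \<zeta>1 Y \<epsilon> t x"
      unfolding moll_def by (rule m(2))
  qed
  \<comment> \<open>\<open>D2\<close> repeats the move with the kernel \<open>bump1\<close>, so that
    both derivatives in \<open>ddu\<close> end on the kernel.\<close>
  have A1: "((\<lambda>s. moll bump u \<epsilon> t (sh j s x)) has_vector_derivative moll bump (du j) \<epsilon> t x) (at 0)"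
    and B1: "((\<lambda>s. moll bump (du j) \<epsilon> t (sh j s x)) has_vector_derivative moll bump (ddu j) \<epsilon> t x) (at 0)"
    and A2: "\<epsilon> *\<^sub>R moll bump (du j) \<epsilon> t x = - moll (bump1 j) u \<epsilon> t x"
    and B2: "\<epsilon> *\<^sub>R moll bump (ddu j) \<epsilon> t x = - moll (bump1 j) (du j) \<epsilon> t x"
    and D2: "\<epsilon> *\<^sub>R moll (bump1 j) (du j) \<epsilon> t x = - moll (bump2 j) u \<epsilon> t x" for j t x
    by - (rule X, rule bc, erule bs, rule bc, erule bs, rule bd, rule u_space_cont, rule u_space_cont, rule du ddu)+
  have inv: "a = of_real (- inverse \<epsilon>) * b" if "\<epsilon> *\<^sub>R a = - b" for a b :: complex
  proof -
    have "b = - (of_real \<epsilon> * a)" using that by (simp add: scaleR_conv_of_real)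
    then show ?thesis using e by (simp add: field_simps)
  qed
  \<comment> \<open>Each derivative moved to the kernel costs one factor -1/\<epsilon>.\<close>
  have eq1: "moll bump (du j) \<epsilon> t x = of_real (- inverse \<epsilon>) * moll (bump1 j) u \<epsilon> t x" for j t x
    by (rule inv[OF A2])
  have eq2: "moll bump (ddu j) \<epsilon> t x = of_real (inverse \<epsilon> * inverse \<epsilon>) * moll (bump2 j) u \<epsilon> t x" for j t x
  proof -
    have 1: "moll bump (ddu j) \<epsilon> t x = of_real (- inverse \<epsilon>) * moll (bump1 j) (du j) \<epsilon> t x"
      by (rule inv[OF B2])
    have 2: "moll (bump1 j) (du j) \<epsilon> t x = of_real (- inverse \<epsilon>) * moll (bump2 j) u \<epsilon> t x"
      by (rule inv[OF D2])
    show ?thesis unfolding 1 2 by simp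
  qed
  show ?thesis
  proof
    show "edec (moll bump u \<epsilon>)" "edec (moll bump F \<epsilon>)"
      by (rule edec_moll(2)[OF edec_u continuous_bump(1) bump_support(1)] edec_moll(2)[OF edec_F continuous_bump(1) bump_support(1)]; assumption)+
    show "edec (moll bump (du j) \<epsilon>)" for j
      unfolding eq1 by (intro edec_cmult edec_moll(2)[OF edec_u continuous_bump(2) bump_support(2)])
    show "edec (moll bump (ddu j) \<epsilon>)" for j
      unfolding eq2 by (intro edec_cmult edec_moll(2)[OF edec_u continuous_bump(3) bump_support(3)])
    show "((\<lambda>s. moll bump u \<epsilon> t (sh j s x)) has_vector_derivative moll bump (du j) \<epsilon> t x) (at 0)" for j t x
      by (rule A1)
    show "((\<lambda>s. moll bump (du j) \<epsilon> t (sh j s x)) has_vector_derivative moll bump (ddu j) \<epsilon> t x) (at 0)" for j t x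
      by (rule B1)
    fix t x
    have int: "integrable lborel (\<lambda>z. (bump z / bmass) *\<^sub>R X (x + \<epsilon> *\<^sub>R z))" if "continuous_on UNIV X" for X :: "real ^ 'n \<Rightarrow> complex"
    proof (rule integrable_edec, rule edec_compact_support[where R = 1])
      show "continuous_on UNIV (\<lambda>(p::real, z). (bump z / bmass) *\<^sub>R X (x + \<epsilon> *\<^sub>R z))"
        unfolding case_prod_beta'
        by (intro continuous_on_scaleR continuous_on_compose2[OF bc(1)] continuous_on_compose2[OF that] continuous_intros) auto
    qed (simp add: bump_support)
    have "ut t y = - \<i> * F t y + \<i> * (\<Sum>j\<in>UNIV. ddu j t y)" for y
    proof -
      have "\<i> * ut t y = F t y - (\<Sum>j\<in>UNIV. ddu j t y)"
        using eqn[of t y] by (simp add: F_def gz_def laplacian_def algebra_simps)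
      then have "\<i> * (\<i> * ut t y) = \<i> * (F t y - (\<Sum>j\<in>UNIV. ddu j t y))" by simp
      then show ?thesis by (simp add: algebra_simps minus_equation_iff[of "ut t y"])
    qed
    then have "(LBINT z. (bump z / bmass) *\<^sub>R ut t (x + \<epsilon> *\<^sub>R z))
       = (LBINT z. - \<i> * ((bump z / bmass) *\<^sub>R F t (x + \<epsilon> *\<^sub>R z)) + \<i> * (\<Sum>j\<in>UNIV. (bump z / bmass) *\<^sub>R ddu j t (x + \<epsilon> *\<^sub>R z)))"
      by (simp add: scaleR_add_right scaleR_sum_right sum_distrib_left scaleR_diff_right)
    also have "\<dots> = - \<i> * moll bump F \<epsilon> t x + \<i> * (\<Sum>j\<in>UNIV. moll bump (ddu j) \<epsilon> t x)"
    proof -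
      have 1: "integrable lborel (\<lambda>z. (bump z / bmass) *\<^sub>R F t (x + \<epsilon> *\<^sub>R z))"
        using edec_continuous_compose[OF edec_F continuous_on_const continuous_on_id] by (intro int) auto
      have 2: "integrable lborel (\<lambda>z. (bump z / bmass) *\<^sub>R ddu j t (x + \<epsilon> *\<^sub>R z))" for j
        by (intro int u_space_cont)
      have "(LBINT z. - \<i> * ((bump z / bmass) *\<^sub>R F t (x + \<epsilon> *\<^sub>R z)) + \<i> * (\<Sum>j\<in>UNIV. (bump z / bmass) *\<^sub>R ddu j t (x + \<epsilon> *\<^sub>R z)))
         = (LBINT z. - \<i> * ((bump z / bmass) *\<^sub>R F t (x + \<epsilon> *\<^sub>R z))) + (LBINT z. \<i> * (\<Sum>j\<in>UNIV. (bump z / bmass) *\<^sub>R ddu j t (x + \<epsilon> *\<^sub>R z)))"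
        by (rule Bochner_Integration.integral_add) (intro integrable_mult_right Bochner_Integration.integrable_sum 1 2)+
      also have "\<dots> = - \<i> * (LBINT z. ((bump z / bmass) *\<^sub>R F t (x + \<epsilon> *\<^sub>R z))) + \<i> * (\<Sum>j\<in>UNIV. (LBINT z. (bump z / bmass) *\<^sub>R ddu j t (x + \<epsilon> *\<^sub>R z)))"
        by (simp only: integral_mult_right_zero Bochner_Integration.integral_sum[OF 2])
      finally show ?thesis unfolding moll_def .
    qed
    finally have *: "(LBINT z. (bump z / bmass) *\<^sub>R ut t (x + \<epsilon> *\<^sub>R z)) = - \<i> * moll bump F \<epsilon> t x + \<i> * (\<Sum>j\<in>UNIV. moll bump (ddu j) \<epsilon> t x)" .
    have "((\<lambda>t. moll bump u \<epsilon> t x) has_vector_derivative (LBINT z. (bump z / bmass) *\<^sub>R ut t (x + \<epsilon> *\<^sub>R z))) (at t)"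
      unfolding moll_def
      by (rule mollify_time_derivative[where \<zeta> = "\<lambda>z. bump z / bmass"])
         (rule bc, erule bs, rule u_cont, rule ut_cont, rule ut)
    then show "((\<lambda>t. moll bump u \<epsilon> t x) has_vector_derivative - \<i> * moll bump F \<epsilon> t x + \<i> * (\<Sum>j\<in>UNIV. moll bump (ddu j) \<epsilon> t x)) (at t)"
      unfolding * .
  qed
qed

end

subsection \<open>Correlation identities for the solution\<close>

context cqnls_decay
begin

definition corr :: "'n \<Rightarrow> (real \<Rightarrow> real) \<Rightarrow> real \<Rightarrow> (real \<Rightarrow> real \<Rightarrow> real ^ 'n \<Rightarrow> complex) \<Rightarrow>
    (real \<Rightarrow> real \<Rightarrow> real ^ 'n \<Rightarrow> complex) \<Rightarrow> real \<Rightarrow> real \<Rightarrow> real \<Rightarrow> complex" where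
  "corr j \<alpha> \<beta> X Y \<epsilon> s t = (LBINT x. of_real (\<alpha> s + \<beta> * x $ j) * (X \<epsilon> t (sh j s x) * cnj (Y \<epsilon> t x)))"

abbreviation corr1 :: "'n \<Rightarrow> (real \<Rightarrow> real \<Rightarrow> real ^ 'n \<Rightarrow> complex) \<Rightarrow> (real \<Rightarrow> real \<Rightarrow> real ^ 'n \<Rightarrow> complex) \<Rightarrow> real \<Rightarrow> real \<Rightarrow> real \<Rightarrow> complex" where
  "corr1 j \<equiv> corr j (\<lambda>_. 1) 0"

text \<open>The weight is the \<open>j\<close>-th coordinate of the midpoint of \<open>x\<close> and
  its translate, so that the two points enter symmetrically.\<close>

abbreviation corrh :: "'n \<Rightarrow> (real \<Rightarrow> real \<Rightarrow> real ^ 'n \<Rightarrow> complex) \<Rightarrow> (real \<Rightarrow> real \<Rightarrow> real ^ 'n \<Rightarrow> complex) \<Rightarrow> real \<Rightarrow> real \<Rightarrow> real \<Rightarrow> complex" where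
  "corrh j \<equiv> corr j (\<lambda>s. s / 2) 1"

lemma edec_corr:
  fixes X Y :: "real \<Rightarrow> real \<Rightarrow> real ^ 'n \<Rightarrow> complex"
  assumes X: "edec (\<lambda>q. X (fst q) (snd q))" and Y: "edec (\<lambda>q. Y (fst q) (snd q))" and \<alpha>: "continuous_on UNIV \<alpha>"
  shows "edec (\<lambda>q x. of_real (\<alpha> (fst (snd q)) + \<beta> * x $ j) *
     (X (fst q) (snd (snd q)) (x + fst (snd q) *\<^sub>R axis j 1) * cnj (Y (fst q) (snd (snd q)) x)))"
proof (rule edec_affine_weight)
  have "edec (\<lambda>q::real \<times> real \<times> real. \<lambda>x. X (fst (fst q, snd (snd q))) (snd (fst q, snd (snd q))) (x + fst (snd q) *\<^sub>R axis j 1))"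
    by (rule edec_reparam[OF X]) (intro continuous_intros)+
  moreover have "edec (\<lambda>q::real \<times> real \<times> real. \<lambda>x. Y (fst (fst q, snd (snd q))) (snd (fst q, snd (snd q))) (x + 0))"
    by (rule edec_reparam[OF Y]) (intro continuous_intros)+
  ultimately show "edec (\<lambda>q x. X (fst q) (snd (snd q)) (x + fst (snd q) *\<^sub>R axis j 1) * cnj (Y (fst q) (snd (snd q)) x))"
    by (intro edec_mult edec_cnj) auto
  show "continuous_on UNIV (\<lambda>q::real \<times> real \<times> real. \<alpha> (fst (snd q)))"
    by (rule continuous_on_compose2[OF \<alpha>], intro continuous_intros) simp
qed

lemma corr_cont:
  fixes X Y :: "real \<Rightarrow> real \<Rightarrow> real ^ 'n \<Rightarrow> complex"
  assumes "edec (\<lambda>q. X (fst q) (snd q))" "edec (\<lambda>q. Y (fst q) (snd q))" "continuous_on UNIV \<alpha>"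
    and "continuous_on A a" "continuous_on A b" "continuous_on A c"
  shows "continuous_on A (\<lambda>y. corr j \<alpha> \<beta> X Y (a y) (b y) (c y))"
proof -
  have "continuous_on UNIV (\<lambda>q. corr j \<alpha> \<beta> X Y (fst q) (fst (snd q)) (snd (snd q)))"
    unfolding corr_def by (rule edec_continuous_integral[OF edec_corr[OF assms(1-3)]])
  from continuous_on_compose2[OF this continuous_on_Pair[OF assms(4) continuous_on_Pair[OF assms(5,6)]]]
  show ?thesis by simp
qed

lemma corr_integrable:
  fixes X Y :: "real \<Rightarrow> real \<Rightarrow> real ^ 'n \<Rightarrow> complex"
  assumes "edec (\<lambda>q. X (fst q) (snd q))" "edec (\<lambda>q. Y (fst q) (snd q))" "continuous_on UNIV \<alpha>"
  shows "integrable lborel (\<lambda>x. of_real (\<alpha> s + \<beta> * x $ j) * (X \<epsilon> t (sh j s x) * cnj (Y \<epsilon> t x)))"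
  using edec_integrable[where p = "(\<epsilon>, s, t)", OF edec_corr[OF assms]] by simp

abbreviation U :: "real \<Rightarrow> real \<Rightarrow> real ^ 'n \<Rightarrow> complex" where "U \<equiv> moll bump u"

abbreviation G :: "real \<Rightarrow> real \<Rightarrow> real ^ 'n \<Rightarrow> complex" where "G \<equiv> moll bump F"

lemma edec_UG: "edec (\<lambda>q. U (fst q) (snd q))" "edec (\<lambda>q. G (fst q) (snd q))"
  by (rule edec_moll(1)[OF edec_u continuous_bump(1) bump_support(1)], assumption)
     (rule edec_moll(1)[OF edec_F continuous_bump(1) bump_support(1)], assumption)

text \<open>For \<beta> = 0 no gradient remains, which yields the balance for \<open>Q\<close>; for
  \<beta> = 1 the remaining one is a derivative in \<open>s\<close>, which yields the virial
  identity.\<close>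

lemma corr_derivative:
  assumes e: "\<epsilon> \<noteq> 0" and \<alpha>: "continuous_on UNIV \<alpha>"
  shows "((\<lambda>t. corr j \<alpha> \<beta> U U \<epsilon> s t) has_vector_derivative
    (- \<i> * (corr j \<alpha> \<beta> G U \<epsilon> s t - corr j \<alpha> \<beta> U G \<epsilon> s t)
     - 2 * \<i> * of_real \<beta> * (LBINT x. moll bump (du j) \<epsilon> t (sh j s x) * cnj (U \<epsilon> t x)))) (at t)"
proof -
  interpret decaying_flow "U \<epsilon>" "G \<epsilon>" "\<lambda>j. moll bump (du j) \<epsilon>" "\<lambda>j. moll bump (ddu j) \<epsilon>"
    by (rule mollified_flow[OF e])
  have "corr j \<alpha> \<beta> G U \<epsilon> s t - corr j \<alpha> \<beta> U G \<epsilon> s t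
    = (LBINT x. of_real (\<alpha> s + \<beta> * x $ j) * (G \<epsilon> t (sh j s x) * cnj (U \<epsilon> t x) - U \<epsilon> t (sh j s x) * cnj (G \<epsilon> t x)))"
    unfolding corr_def right_diff_distrib
    by (rule Bochner_Integration.integral_diff[symmetric]; rule corr_integrable[OF _ _ \<alpha>]; rule edec_UG)
  then show ?thesis
    using weighted_correlation_derivative[of "\<alpha> s" \<beta> j "s *\<^sub>R axis j 1" t] by (simp only: corr_def)
qed

lemma U_periodic: "U \<epsilon> (t + \<tau>) x = U \<epsilon> t x"
  unfolding moll_def by (simp add: periodic)

text \<open>Stated in integrated form because both sides are then continuous in the scale, so the
  identity survives at scale 0, where differentiability in time is not known beforehand.\<close>

lemma corr_balance_moll:
  assumes "t0 \<le> t1"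
  shows "corr1 j U U 0 s t1 - corr1 j U U 0 s t0
    = integral {t0..t1} (\<lambda>t. - \<i> * (corr1 j G U 0 s t - corr1 j U G 0 s t))"
proof -
  let ?D = "\<lambda>\<epsilon> t. - \<i> * (corr1 j G U \<epsilon> s t - corr1 j U G \<epsilon> s t)"
  let ?h = "\<lambda>\<epsilon>. corr1 j U U \<epsilon> s t1 - corr1 j U U \<epsilon> s t0 - integral {t0..t1} (?D \<epsilon>)"
  have "?h 0 = 0"
  proof (rule continuous_eq_at_0[of ?h])
    show "continuous_on UNIV ?h"
      by (intro continuous_on_diff continuous_integral_param continuous_on_mult continuous_on_const corr_cont edec_UG
          continuous_on_fst continuous_on_snd continuous_on_id)
    fix \<epsilon> :: real assume e: "\<epsilon> \<noteq> 0"
    have I: "(?D \<epsilon> has_integral corr1 j U U \<epsilon> s t1 - corr1 j U U \<epsilon> s t0) {t0..t1}"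
    proof (rule fundamental_theorem_of_calculus[OF assms has_vector_derivative_at_within])
      fix t
      show "((\<lambda>t. corr1 j U U \<epsilon> s t) has_vector_derivative ?D \<epsilon> t) (at t)"
        using corr_derivative[OF e continuous_on_const, of j 1 0 s t] by simp
    qed
    show "?h \<epsilon> = 0" unfolding integral_unique[OF I] by simp
  qed
  then show ?thesis by (simp only: right_minus_eq)
qed

abbreviation per :: "real \<Rightarrow> real set" where "per T \<equiv> {T..T+\<tau>}"

text \<open>Over a period the weighted correlation returns to its value, so the nonlinear term
  balances the gradient term. The latter is a derivative in the shift, and integrating over
  \<open>{0..S}\<close> turns it into a difference of plain correlations: a virial identity in which
  no gradient occurs.\<close>

lemma virial_moll:
  assumes S: "S \<ge> 0"
  shows "2 * integral (per T) (\<lambda>t. corr1 j U U 0 S t - corr1 j U U 0 0 t)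
    = - integral {0..S} (\<lambda>s. integral (per T) (\<lambda>t. corrh j G U 0 s t - corrh j U G 0 s t))"
proof -
  let ?C = "\<lambda>\<epsilon> s t. corr1 j U U \<epsilon> s t"
  let ?N = "\<lambda>\<epsilon> s t. corrh j G U \<epsilon> s t - corrh j U G \<epsilon> s t"
  let ?h = "\<lambda>\<epsilon>. 2 * integral (per T) (\<lambda>t. ?C \<epsilon> S t - ?C \<epsilon> 0 t) + integral {0..S} (\<lambda>s. integral (per T) (\<lambda>t. ?N \<epsilon> s t))"
  have half: "continuous_on UNIV (\<lambda>s::real. s / 2)" by (intro continuous_intros) auto
  have "?h 0 = 0"
  proof (rule continuous_eq_at_0[of ?h])
    show "continuous_on UNIV ?h"
      by (intro continuous_on_add continuous_on_diff continuous_integral_param continuous_on_mult continuous_on_const corr_cont edec_UG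
          continuous_on_fst continuous_on_snd continuous_on_id half)
    fix \<epsilon> :: real assume e: "\<epsilon> \<noteq> 0"
    interpret decaying_flow "U \<epsilon>" "G \<epsilon>" "\<lambda>j. moll bump (du j) \<epsilon>" "\<lambda>j. moll bump (ddu j) \<epsilon>"
      by (rule mollified_flow[OF e])
    let ?c1 = "\<lambda>s t. (LBINT x. moll bump (du j) \<epsilon> t (sh j s x) * cnj (U \<epsilon> t x))"
    have c1_cont: "continuous_on A (\<lambda>y. ?c1 (a y) (b y))" if "continuous_on A a" "continuous_on A b" for A :: "'z::topological_space set" and a b
    proof -
      have "edec (\<lambda>q::real \<times> real. \<lambda>x. moll bump (du j) \<epsilon> (snd q) (x + fst q *\<^sub>R axis j 1))"
        by (rule edec_reparam[OF w1]) (intro continuous_intros)+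
      moreover have "edec (\<lambda>q::real \<times> real. \<lambda>x. U \<epsilon> (snd q) (x + 0))"
        by (rule edec_reparam[OF w]) (intro continuous_intros)+
      ultimately have "edec (\<lambda>q::real \<times> real. \<lambda>x. moll bump (du j) \<epsilon> (snd q) (x + fst q *\<^sub>R axis j 1) * cnj (U \<epsilon> (snd q) x))"
        by (intro edec_mult edec_cnj) auto
      from continuous_on_compose2[OF edec_continuous_integral[OF this, of UNIV] continuous_on_Pair[OF that]]
      show ?thesis by simp
    qed
    \<comment> \<open>The integral of the time derivative over a period vanishes; multiplication by
      \<i> then clears the factors -\<i>.\<close>
    have v: "integral (per T) (\<lambda>t. ?N \<epsilon> s t) = - 2 * integral (per T) (\<lambda>t. ?c1 s t)" for s
    proof -
      have "((\<lambda>t. - \<i> * ?N \<epsilon> s t - 2 * \<i> * of_real 1 * ?c1 s t) has_integral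
          corrh j U U \<epsilon> s (T + \<tau>) - corrh j U U \<epsilon> s T) (per T)"
        by (rule fundamental_theorem_of_calculus[OF _ has_vector_derivative_at_within[OF corr_derivative[OF e half]]])
           (use tau in simp)
      moreover have "corrh j U U \<epsilon> s (T + \<tau>) - corrh j U U \<epsilon> s T = 0"
        unfolding corr_def U_periodic by simp
      ultimately have "((\<lambda>t. - \<i> * ?N \<epsilon> s t - 2 * \<i> * of_real 1 * ?c1 s t) has_integral 0) (per T)" by simp
      then have "((\<lambda>t. \<i> * (- \<i> * ?N \<epsilon> s t - 2 * \<i> * of_real 1 * ?c1 s t)) has_integral \<i> * 0) (per T)"
        by (rule has_integral_mult_right)
      then have 0: "((\<lambda>t. ?N \<epsilon> s t + 2 * ?c1 s t) has_integral 0) (per T)"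
        by (simp add: algebra_simps)
      have "(\<lambda>t. ?N \<epsilon> s t) integrable_on (per T)" "(\<lambda>t. ?c1 s t) integrable_on (per T)"
        by (intro integrable_continuous_real c1_cont continuous_on_diff corr_cont edec_UG half continuous_on_const continuous_on_id)+
      then have "((\<lambda>t. ?N \<epsilon> s t + 2 * ?c1 s t) has_integral (integral (per T) (\<lambda>t. ?N \<epsilon> s t) + 2 * integral (per T) (\<lambda>t. ?c1 s t))) (per T)"
        by (intro has_integral_add has_integral_mult_right integrable_integral)
      then have "integral (per T) (\<lambda>t. ?N \<epsilon> s t) + 2 * integral (per T) (\<lambda>t. ?c1 s t) = 0"
        using 0 has_integral_unique by blast
      then show ?thesis by (simp add: eq_neg_iff_add_eq_0)
    qed
    have d: "?C \<epsilon> S t - ?C \<epsilon> 0 t = integral {0..S} (\<lambda>s. ?c1 s t)" for t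
    proof -
      have "((\<lambda>s. ?c1 s t) has_integral (LBINT x. U \<epsilon> t (x + S *\<^sub>R axis j 1) * cnj (U \<epsilon> t x)) - (LBINT x. U \<epsilon> t (x + 0 *\<^sub>R axis j 1) * cnj (U \<epsilon> t x))) {0..S}"
        by (rule fundamental_theorem_of_calculus[OF S has_vector_derivative_at_within[OF correlation_shift_derivative]])
      then show ?thesis by (simp add: corr_def integral_unique)
    qed
    have "integral (per T) (\<lambda>t. ?C \<epsilon> S t - ?C \<epsilon> 0 t) = integral {0..S} (\<lambda>s. integral (per T) (\<lambda>t. ?c1 s t))"
      unfolding d
      using integral_swap_continuous[of T 0 "T + \<tau>" S "\<lambda>t s. ?c1 s t"]
      by (simp add: case_prod_beta' c1_cont continuous_on_fst continuous_on_snd continuous_on_id)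
    moreover have "integral {0..S} (\<lambda>s. integral (per T) (\<lambda>t. ?N \<epsilon> s t)) = - 2 * integral {0..S} (\<lambda>s. integral (per T) (\<lambda>t. ?c1 s t))"
      unfolding v by simp
    ultimately show "?h \<epsilon> = 0" by simp
  qed
  then show ?thesis by (simp add: eq_neg_iff_add_eq_0)
qed

end

subsection \<open>Translation differences of the solution\<close>

lemma edec_norm: "edec f \<Longrightarrow> edec (\<lambda>p x. norm (f p x))"
  unfolding edec_def by (auto simp: case_prod_beta' intro: continuous_on_norm)

section \<open>Pointwise estimates for the nonlinearity\<close>

context cqnls_decay
begin

text \<open>Potential energy density: as a function of \<rho> = |z|^2, the antiderivative of
  \<open>gz\<close> that vanishes at 0.\<close>

definition Gz :: "complex \<Rightarrow> real" where
  "Gz z = l1 / 2 * cmod z ^ 4 - l2 / 3 * cmod z ^ 6"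

text \<open>The pressure \<rho> g - G that belongs to the potential energy density G.\<close>

definition Hz :: "complex \<Rightarrow> real" where
  "Hz z = l1 / 2 * cmod z ^ 4 - 2 * l2 / 3 * cmod z ^ 6"

lemma edec_gz:
  assumes "edec f" shows "edec (\<lambda>p x. gz (f p x))" "edec (\<lambda>p x. Gz (f p x))" "edec (\<lambda>p x. Hz (f p x))"
  unfolding gz_def Gz_def Hz_def
  by (intro edec_diff edec_cmult edec_power edec_norm assms; simp)+

lemma gz_diff: "gz b - gz a = (l1 - l2 * ((cmod a)\<^sup>2 + (cmod b)\<^sup>2)) * ((cmod b)\<^sup>2 - (cmod a)\<^sup>2)"
  by (simp add: gz_def power4_eq_xxxx power2_eq_square algebra_simps)

lemma cmod2_diff_le: "\<bar>(cmod b)\<^sup>2 - (cmod a)\<^sup>2\<bar> \<le> (cmod a + cmod b) * cmod (b - a)"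
proof -
  have "(cmod b)\<^sup>2 - (cmod a)\<^sup>2 = (cmod a + cmod b) * (cmod b - cmod a)" by (simp add: power2_eq_square algebra_simps)
  then have "\<bar>(cmod b)\<^sup>2 - (cmod a)\<^sup>2\<bar> = (cmod a + cmod b) * \<bar>cmod b - cmod a\<bar>" by (simp add: abs_mult)
  also have "\<dots> \<le> (cmod a + cmod b) * cmod (b - a)"
    by (intro mult_left_mono) (auto simp: norm_triangle_ineq3)
  finally show ?thesis .
qed

lemma gz_lipschitz:
  assumes M: "cmod a \<le> M" "cmod b \<le> M"
  shows "\<bar>gz b - gz a\<bar> \<le> (\<bar>l1\<bar> + 2 * \<bar>l2\<bar> * M\<^sup>2) * ((cmod a + cmod b) * cmod (b - a))"
proof -
  have "(cmod a)\<^sup>2 \<le> M\<^sup>2" "(cmod b)\<^sup>2 \<le> M\<^sup>2" using M by (auto intro: power_mono)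
  then have "\<bar>l2\<bar> * ((cmod a)\<^sup>2 + (cmod b)\<^sup>2) \<le> \<bar>l2\<bar> * (2 * M\<^sup>2)" by (intro mult_left_mono) auto
  moreover have "\<bar>l1 - l2 * ((cmod a)\<^sup>2 + (cmod b)\<^sup>2)\<bar> \<le> \<bar>l1\<bar> + \<bar>l2\<bar> * ((cmod a)\<^sup>2 + (cmod b)\<^sup>2)"
    using abs_triangle_ineq4[of l1 "l2 * ((cmod a)\<^sup>2 + (cmod b)\<^sup>2)"] by (simp add: abs_mult)
  ultimately have "\<bar>l1 - l2 * ((cmod a)\<^sup>2 + (cmod b)\<^sup>2)\<bar> \<le> \<bar>l1\<bar> + 2 * \<bar>l2\<bar> * M\<^sup>2" by simp
  then show ?thesis unfolding gz_diff abs_mult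
    by (intro mult_mono cmod2_diff_le) auto
qed

text \<open>Since a cnj(a) is real, Im(b cnj(a)) = Im((b - a) cnj(a)). Both factors are therefore of
  first order in b - a, and the product is controlled by the integrand of \<open>Q\<close>.\<close>

lemma gz_Im_bound:
  assumes M: "cmod a \<le> M" "cmod b \<le> M"
  shows "\<bar>(gz b - gz a) * Im (b * cnj a)\<bar> \<le> ((\<bar>l1\<bar> + 2 * \<bar>l2\<bar> * M\<^sup>2) * (2 * M\<^sup>2)) * (cmod (b - a))\<^sup>2"
proof -
  have M0: "M \<ge> 0" using M(1) norm_ge_zero order_trans by blast
  have "Im (b * cnj a) = Im ((b - a) * cnj a)" by (simp add: algebra_simps)
  also have "\<bar>\<dots>\<bar> \<le> cmod (b - a) * cmod a" using abs_Im_le_cmod[of "(b - a) * cnj a"] by (simp add: norm_mult)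
  also have "\<dots> \<le> cmod (b - a) * M" using M by (intro mult_left_mono) auto
  finally have 1: "\<bar>Im (b * cnj a)\<bar> \<le> cmod (b - a) * M" .
  have "(cmod a + cmod b) * cmod (b - a) \<le> (2 * M) * cmod (b - a)" using M by (intro mult_right_mono) auto
  then have "\<bar>gz b - gz a\<bar> \<le> (\<bar>l1\<bar> + 2 * \<bar>l2\<bar> * M\<^sup>2) * ((2 * M) * cmod (b - a))"
    by (intro order_trans[OF gz_lipschitz[OF M]] mult_left_mono) auto
  then have "\<bar>(gz b - gz a) * Im (b * cnj a)\<bar> \<le> ((\<bar>l1\<bar> + 2 * \<bar>l2\<bar> * M\<^sup>2) * ((2 * M) * cmod (b - a))) * (cmod (b - a) * M)"
    unfolding abs_mult using 1 M0 by (intro mult_mono) auto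
  also have "\<dots> = ((\<bar>l1\<bar> + 2 * \<bar>l2\<bar> * M\<^sup>2) * (2 * M\<^sup>2)) * (cmod (b - a))\<^sup>2"
    by (simp add: power2_eq_square)
  finally show ?thesis .
qed

text \<open>With \<open>\<rho> = \<bar>z\<bar>\<^sup>2\<close>, \<open>H' = \<rho> g'\<close>, and the defect below is the error of the trapezoidal rule for \<open>\<integral> \<rho> dg\<close>.\<close>

lemma gz_Re_trapezoid:
  "(gz b - gz a) * Re (b * cnj a) - (Hz b - Hz a)
    = l2 / 6 * ((cmod b)\<^sup>2 - (cmod a)\<^sup>2) ^ 3 - (gz b - gz a) * (cmod (b - a))\<^sup>2 / 2"
proof -
  define A B where "A = (cmod a)\<^sup>2" and "B = (cmod b)\<^sup>2"
  have "(cmod (b - a))\<^sup>2 = A + B - 2 * Re (b * cnj a)"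
    unfolding A_def B_def cmod_power2 by (simp add: power2_eq_square algebra_simps)
  \<comment> \<open>Polarization: the mean of \<open>A\<close> and \<open>B\<close> produces the
    trapezoidal rule, the rest the term with the squared difference.\<close>
  then have r: "Re (b * cnj a) = (A + B - (cmod (b - a))\<^sup>2) / 2" by simp
  have p: "cmod z ^ 4 = ((cmod z)\<^sup>2) ^ 2" "cmod z ^ 6 = ((cmod z)\<^sup>2) ^ 3" for z by (simp_all flip: power_mult)
  show ?thesis unfolding r gz_diff Hz_def p A_def[symmetric] B_def[symmetric]
    by (simp add: field_simps power2_eq_square power3_eq_cube)
qed

text \<open>One factor \<open>cmod a + cmod b\<close> is kept outside the constant: it decays in
  space and later absorbs the growing weight in \<open>N\<close>.\<close>

lemma gz_Re_bound:
  assumes M: "cmod a \<le> M" "cmod b \<le> M"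
  shows "\<bar>(gz b - gz a) * Re (b * cnj a) - (Hz b - Hz a)\<bar>
    \<le> (8 * \<bar>l2\<bar> * M ^ 3 + (\<bar>l1\<bar> + 2 * \<bar>l2\<bar> * M\<^sup>2) * (2 * M)) * ((cmod a + cmod b) * (cmod (b - a))\<^sup>2)"
proof -
  let ?s = "cmod a + cmod b" and ?d = "cmod (b - a)"
  have M0: "M \<ge> 0" using M(1) norm_ge_zero order_trans by blast
  have d: "?d \<le> 2 * M" using norm_triangle_ineq4[of b a] M by simp
  have s: "?s \<le> 2 * M" using M by simp
  \<comment> \<open>Of the six factors in \<open>(?s * ?d) ^ 3\<close>, one \<open>?s\<close> and
    two \<open>?d\<close> are kept; the other three are at most \<open>2 * M\<close> each.\<close>
  have "\<bar>l2 / 6 * ((cmod b)\<^sup>2 - (cmod a)\<^sup>2) ^ 3\<bar> \<le> \<bar>l2\<bar> * (?s * ?d) ^ 3"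
    unfolding abs_mult power_abs by (intro mult_mono power_mono cmod2_diff_le) auto
  also have "\<dots> = \<bar>l2\<bar> * ((?s * ?s) * ?d) * (?s * ?d\<^sup>2)" by (simp add: power2_eq_square power3_eq_cube)
  also have "\<dots> \<le> \<bar>l2\<bar> * (((2 * M) * (2 * M)) * (2 * M)) * (?s * ?d\<^sup>2)"
    using d s M0 by (intro mult_right_mono mult_left_mono mult_mono) auto
  finally have 1: "\<bar>l2 / 6 * ((cmod b)\<^sup>2 - (cmod a)\<^sup>2) ^ 3\<bar> \<le> (8 * \<bar>l2\<bar> * M ^ 3) * (?s * ?d\<^sup>2)"
    by (simp add: power3_eq_cube mult_ac)
  have "\<bar>(gz b - gz a) * ?d\<^sup>2 / 2\<bar> \<le> \<bar>gz b - gz a\<bar> * ?d\<^sup>2" by (simp add: abs_mult)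
  also have "\<dots> \<le> ((\<bar>l1\<bar> + 2 * \<bar>l2\<bar> * M\<^sup>2) * (?s * ?d)) * ?d\<^sup>2"
    by (intro mult_right_mono gz_lipschitz M) auto
  also have "\<dots> \<le> ((\<bar>l1\<bar> + 2 * \<bar>l2\<bar> * M\<^sup>2) * (?s * (2 * M))) * ?d\<^sup>2"
    using d by (intro mult_right_mono mult_left_mono) auto
  also have "\<dots> = ((\<bar>l1\<bar> + 2 * \<bar>l2\<bar> * M\<^sup>2) * (2 * M)) * (?s * ?d\<^sup>2)"
    by (simp only: mult_ac)
  finally have 2: "\<bar>(gz b - gz a) * ?d\<^sup>2 / 2\<bar> \<le> ((\<bar>l1\<bar> + 2 * \<bar>l2\<bar> * M\<^sup>2) * (2 * M)) * (?s * ?d\<^sup>2)" .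
  show ?thesis unfolding gz_Re_trapezoid distrib_right[of "8 * \<bar>l2\<bar> * M ^ 3"] using 1 2 by linarith
qed

section \<open>Integral functionals of translation differences\<close>

definition Q :: "'n \<Rightarrow> real \<Rightarrow> real \<Rightarrow> real" where
  "Q j s t = (LBINT x. (cmod (u t (sh j s x) - u t x))\<^sup>2)"

definition K :: "'n \<Rightarrow> real \<Rightarrow> real \<Rightarrow> real" where
  "K j s t = (LBINT x. (gz (u t (sh j s x)) - gz (u t x)) * Im (u t (sh j s x) * cnj (u t x)))"

text \<open>\<open>K\<close> and \<open>N\<close> are the nonlinear sources in the balances with
  weight 1 and with the midpoint weight; the former sees the imaginary, the latter the real part of
  the same product.\<close>

definition N :: "'n \<Rightarrow> real \<Rightarrow> real \<Rightarrow> real" where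
  "N j s t = (LBINT x. (s / 2 + x $ j) * ((gz (u t (sh j s x)) - gz (u t x)) * Re (u t (sh j s x) * cnj (u t x))))"

lemma UG_0: "U 0 = u" "G 0 = F"
  by (intro ext moll_0)+

lemma u_bound: obtains M where "M > 0" "\<And>t x. cmod (u t x) \<le> M"
proof -
  obtain C \<gamma> where *: "\<gamma> > 0" "\<And>t x. cmod (u t x) \<le> C * exp (- \<gamma> * norm x)" using decay by blast
  have "cmod (u t x) \<le> \<bar>C\<bar> + 1" for t x
  proof -
    have "C * exp (- \<gamma> * norm x) \<le> \<bar>C\<bar> * 1" using *(1) by (intro mult_mono) auto
    then show ?thesis using *(2)[of t x] by linarith
  qed
  then show ?thesis by (intro that[of "\<bar>C\<bar> + 1"]) auto
qed

lemma u_weighted_bound: obtains M where "M > 0" "\<And>t x. (1 + norm x) * cmod (u t x) \<le> M"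
proof -
  obtain C \<gamma> where *: "\<gamma> > 0" "\<And>t x. cmod (u t x) \<le> C * exp (- \<gamma> * norm x)" using decay by blast
  have "(1 + norm x) * cmod (u t x) \<le> \<bar>C\<bar> * (1 + 2 / \<gamma>) + 1" for t x
  proof -
    have "(1 + norm x) * cmod (u t x) \<le> (1 + norm x) * (\<bar>C\<bar> * exp (- \<gamma> * norm x))"
      using *(2)[of t x] by (intro mult_left_mono order_trans[OF *(2)] mult_right_mono) auto
    also have "\<dots> = \<bar>C\<bar> * ((1 + norm x) * exp (- \<gamma> * norm x))" by simp
    also have "\<dots> \<le> \<bar>C\<bar> * ((1 + 2 / \<gamma>) * exp (- (\<gamma>/2) * norm x))"
      using *(1) by (intro mult_left_mono linear_exp_bound) auto
    also have "\<dots> \<le> \<bar>C\<bar> * ((1 + 2 / \<gamma>) * 1)" using *(1) by (intro mult_left_mono) auto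
    finally show ?thesis by simp
  qed
  then show ?thesis using *(1) by (intro that[of "\<bar>C\<bar> * (1 + 2 / \<gamma>) + 1"]) (auto intro: add_nonneg_pos)
qed

lemma edec_ux: "edec (\<lambda>_::real. u t)" "edec (\<lambda>_::real. \<lambda>x. u t (x + h))"
proof -
  show 1: "edec (\<lambda>_::real. u t)" using edec_reparam[OF edec_u, of "\<lambda>_::real. t" "\<lambda>_. 0"] by (simp add: continuous_on_const)
  show "edec (\<lambda>_::real. \<lambda>x. u t (x + h))" by (rule edec_const_reparam[OF 1 continuous_on_const])
qed

lemma edec_linear_weight:
  fixes f :: "real \<Rightarrow> real ^ 'n \<Rightarrow> real"
  assumes "edec f" shows "edec (\<lambda>p x. (\<alpha> + x $ j) * f p x)"
  using edec_affine_weight[OF assms continuous_on_const, of \<alpha> 1 j] by simp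

lemma integrable_Q: "integrable lborel (\<lambda>x. (cmod (u t (x + h) - u t x))\<^sup>2)"
  by (rule integrable_edec)
     (intro edec_power edec_norm edec_diff edec_ux, simp)

lemma integrable_K: "integrable lborel (\<lambda>x. (gz (u t (x + h)) - gz (u t x)) * Im (u t (x + h) * cnj (u t x)))"
  by (rule integrable_edec)
     (intro edec_mult edec_diff edec_gz edec_bounded_linear[OF bounded_linear_Im] edec_cnj edec_ux)

lemma corr_UG:
  fixes \<alpha> :: "real \<Rightarrow> real"
  assumes "continuous_on UNIV \<alpha>"
  shows "corr j \<alpha> \<beta> G U 0 s t - corr j \<alpha> \<beta> U G 0 s t
   = (LBINT x. of_real ((\<alpha> s + \<beta> * x $ j) * (gz (u t (sh j s x)) - gz (u t x))) * (u t (sh j s x) * cnj (u t x)))"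
   and "integrable lborel (\<lambda>x. of_real ((\<alpha> s + \<beta> * x $ j) * (gz (u t (sh j s x)) - gz (u t x))) * (u t (sh j s x) * cnj (u t x)))"
proof -
  let ?A = "\<lambda>x. of_real (\<alpha> s + \<beta> * x $ j) * (G 0 t (sh j s x) * cnj (U 0 t x))"
  let ?B = "\<lambda>x. of_real (\<alpha> s + \<beta> * x $ j) * (U 0 t (sh j s x) * cnj (G 0 t x))"
  have i: "integrable lborel ?A" "integrable lborel ?B"
    by (rule corr_integrable[OF edec_UG(2,1) assms], rule corr_integrable[OF edec_UG(1,2) assms])
  have eq: "?A x - ?B x = of_real ((\<alpha> s + \<beta> * x $ j) * (gz (u t (sh j s x)) - gz (u t x))) * (u t (sh j s x) * cnj (u t x))" for x
    unfolding UG_0 F_def by (simp add: algebra_simps)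
  show "corr j \<alpha> \<beta> G U 0 s t - corr j \<alpha> \<beta> U G 0 s t
   = (LBINT x. of_real ((\<alpha> s + \<beta> * x $ j) * (gz (u t (sh j s x)) - gz (u t x))) * (u t (sh j s x) * cnj (u t x)))"
    unfolding corr_def eq[symmetric] using i by simp
  show "integrable lborel (\<lambda>x. of_real ((\<alpha> s + \<beta> * x $ j) * (gz (u t (sh j s x)) - gz (u t x))) * (u t (sh j s x) * cnj (u t x)))"
    unfolding eq[symmetric] using i by (rule Bochner_Integration.integrable_diff)
qed

lemma half_cont: "continuous_on UNIV (\<lambda>s::real. s / 2)" by (intro continuous_intros) auto

lemma K_corr: "K j s t = Im (corr1 j G U 0 s t - corr1 j U G 0 s t)"
  unfolding corr_UG(1)[OF continuous_on_const] using corr_UG(2)[where \<alpha> = "\<lambda>_. 1" and \<beta> = 0 and s = s and j = j and t = t, OF continuous_on_const]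
  by (subst integral_Im[symmetric]) (auto simp: K_def simp del: of_real_diff)

lemma N_corr: "N j s t = Re (corrh j G U 0 s t - corrh j U G 0 s t)"
  unfolding corr_UG(1)[OF half_cont] using corr_UG(2)[where \<beta> = 1 and s = s and j = j and t = t, OF half_cont]
  by (subst integral_Re[symmetric]) (auto simp: N_def mult.assoc simp del: of_real_diff of_real_add of_real_mult)

text \<open>The square is expanded: translation invariance makes both norms equal to the correlation
  at shift 0, and the mixed term is the real part of the correlation at shift
  \<open>s\<close>.\<close>

lemma Q_corr: "Q j s t = 2 * Re (corr1 j U U 0 0 t) - 2 * Re (corr1 j U U 0 s t)"
proof -
  let ?b = "\<lambda>x. u t (sh j s x)"
  have i2: "integrable lborel (\<lambda>x. (cmod (u t (x + h)))\<^sup>2)" for h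
    by (rule integrable_edec)
       (intro edec_power edec_norm edec_ux, simp)
  have ic: "integrable lborel (\<lambda>x. u t (x + h) * cnj (u t x))" for h
    by (rule integrable_edec)
       (intro edec_mult edec_cnj edec_ux)
  have c: "Re (corr1 j U U 0 s t) = (LBINT x. Re (u t (sh j s x) * cnj (u t x)))" for s
    unfolding corr_def UG_0 using integral_Re[OF ic[of "s *\<^sub>R axis j 1"]] by simp
  have c0: "Re (corr1 j U U 0 0 t) = (LBINT x. (cmod (u t x))\<^sup>2)"
    unfolding c by (intro Bochner_Integration.integral_cong refl) (simp only: cmod_power2, simp add: power2_eq_square)
  define p where "p x = Re (?b x * cnj (u t x))" for x
  have ip: "integrable lborel p" unfolding p_def by (rule integrable_Re[OF ic[of "s *\<^sub>R axis j 1"]])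
  have "(cmod (?b x - u t x))\<^sup>2 = (cmod (?b x))\<^sup>2 + (cmod (u t x))\<^sup>2 - 2 * p x" for x
    unfolding cmod_power2 p_def by (simp add: power2_eq_square algebra_simps)
  then have "Q j s t = (LBINT x. (cmod (?b x))\<^sup>2) + (LBINT x. (cmod (u t x))\<^sup>2) - 2 * (LBINT x. p x)"
    unfolding Q_def using i2[of "s *\<^sub>R axis j 1"] i2[of 0] ip by simp
  moreover have "(LBINT x. (cmod (?b x))\<^sup>2) = (LBINT x. (cmod (u t x))\<^sup>2)"
    by (rule integral_translation_lborel[where f = "\<lambda>x. (cmod (u t x))\<^sup>2"]) (use i2[of 0] in \<open>simp add: borel_measurable_integrable\<close>)
  ultimately show ?thesis unfolding c0 unfolding c p_def by simp
qed

lemma Q_cont: "continuous_on A a \<Longrightarrow> continuous_on A b \<Longrightarrow> continuous_on A (\<lambda>y. Q j (a y) (b y))"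
  unfolding Q_corr by (intro continuous_intros corr_cont edec_UG)

lemma K_cont: "continuous_on A a \<Longrightarrow> continuous_on A b \<Longrightarrow> continuous_on A (\<lambda>y. K j (a y) (b y))"
  unfolding K_corr by (intro continuous_intros corr_cont edec_UG)

lemma N_cont: "continuous_on A a \<Longrightarrow> continuous_on A b \<Longrightarrow> continuous_on A (\<lambda>y. N j (a y) (b y))"
  unfolding N_corr by (intro continuous_intros corr_cont edec_UG) auto

lemma Q_nonneg: "Q j s t \<ge> 0"
  unfolding Q_def by (intro Bochner_Integration.integral_nonneg) auto

text \<open>The integrated balance has a continuous integrand, so differentiability in time is
  recovered from the fundamental theorem of calculus.\<close>

lemma Q_derivative: "((\<lambda>t. Q j s t) has_real_derivative - 2 * K j s t) (at t)"
proof -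
  define a b where "a = t - 1" and "b = t + 1"
  have int: "(\<lambda>t. - \<i> * (corr1 j G U 0 s t - corr1 j U G 0 s t)) integrable_on {a..r}" for r s
    by (intro integrable_continuous_real continuous_intros corr_cont edec_UG)
  have Re_bal: "Re (corr1 j U U 0 s r) = Re (corr1 j U U 0 s a) + integral {a..r} (K j s)" if "r \<in> {a..b}" for r s
  proof -
    have "Re (corr1 j U U 0 s r - corr1 j U U 0 s a)
       = integral {a..r} (Re \<circ> (\<lambda>t. - \<i> * (corr1 j G U 0 s t - corr1 j U G 0 s t)))"
      unfolding integral_linear[OF int bounded_linear_Re] using that by (subst corr_balance_moll) auto
    also have "Re \<circ> (\<lambda>t. - \<i> * (corr1 j G U 0 s t - corr1 j U G 0 s t)) = K j s"
      by (auto simp: K_corr)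
    finally show ?thesis by simp
  qed
  \<comment> \<open>At shift 0 the source vanishes, which is conservation of mass; only the
    correlation at shift \<open>s\<close> contributes.\<close>
  have K0: "K j 0 = (\<lambda>t. 0)" by (simp add: K_def fun_eq_iff)
  have Qr: "Q j s a - 2 * integral {a..r} (K j s) = Q j s r" if "r \<in> {a..b}" for r
    unfolding Q_corr Re_bal[OF that] K0 by simp
  have Kc: "continuous_on {a..b} (K j s)" using K_cont[OF continuous_on_const continuous_on_id] by simp
  have "((\<lambda>r. Q j s a - 2 * integral {a..r} (K j s)) has_real_derivative - 2 * K j s t) (at t within {a..b})"
    using integral_has_real_derivative[OF Kc, of t]
    by (auto intro!: derivative_eq_intros simp: a_def b_def)
  then have "((\<lambda>r. Q j s r) has_real_derivative - 2 * K j s t) (at t within {a..b})"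
    by (rule has_field_derivative_transform_within[where d = 1]) (use Qr in \<open>auto simp: a_def b_def\<close>)
  moreover have "at t within {a..b} = at t" by (rule at_within_interior) (simp add: a_def b_def)
  ultimately show ?thesis by simp
qed

lemma K_bound: obtains L where "L > 0" "\<And>j s t. \<bar>K j s t\<bar> \<le> L * Q j s t"
proof -
  obtain M where M: "M > 0" "\<And>t x. cmod (u t x) \<le> M" using u_bound by blast
  define L where "L = (\<bar>l1\<bar> + 2 * \<bar>l2\<bar> * M\<^sup>2) * (2 * M\<^sup>2)"
  have "\<bar>K j s t\<bar> \<le> L * Q j s t" for j s t
  proof -
    have "norm (K j s t) \<le> (LBINT x. L * (cmod (u t (sh j s x) - u t x))\<^sup>2)"
      unfolding K_def using gz_Im_bound[OF M(2) M(2)]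
      by (intro Bochner_Integration.integral_norm_bound_integral integrable_K integrable_mult_right integrable_Q) (auto simp: L_def)
    then show ?thesis by (simp add: Q_def)
  qed
  moreover have "L \<ge> 0" using M by (simp add: L_def)
  ultimately have "\<bar>K j s t\<bar> \<le> (L + 1) * Q j s t" for j s t
    using Q_nonneg[of j s t] by (smt (verit) mult_right_mono)
  then show ?thesis using \<open>L \<ge> 0\<close> by (intro that[of "L + 1"]) auto
qed

text \<open>The integrating factor has rate \<open>2 * L\<close>: the constant of
  \<open>K_bound\<close>, doubled by the factor 2 in \<open>Q_derivative\<close>.\<close>

lemma Q_gronwall: obtains L where "L > 0" "\<And>j s t t'. t' \<le> t \<Longrightarrow> Q j s t \<le> exp (L * (t - t')) * Q j s t'"
proof -
  obtain L where L: "L > 0" "\<And>j s t. \<bar>K j s t\<bar> \<le> L * Q j s t" using K_bound by blast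
  have "Q j s t \<le> exp ((2 * L) * (t - t')) * Q j s t'" if "t' \<le> t" for j s t t'
  proof -
    have "Q j s t * exp (- (2 * L) * t) \<le> Q j s t' * exp (- (2 * L) * t')"
    proof (rule DERIV_nonpos_imp_nonincreasing[OF that])
      fix r
      have "((\<lambda>t. Q j s t * exp (- (2 * L) * t)) has_real_derivative (- 2 * K j s r - 2 * L * Q j s r) * exp (- (2 * L) * r)) (at r)"
        by (auto intro!: derivative_eq_intros Q_derivative simp: algebra_simps)
      moreover have "(- 2 * K j s r - 2 * L * Q j s r) * exp (- (2 * L) * r) \<le> 0"
        using L(2)[of j s r] by (intro mult_nonpos_nonneg) auto
      ultimately show "\<exists>y. ((\<lambda>t. Q j s t * exp (- (2 * L) * t)) has_real_derivative y) (at r) \<and> y \<le> 0" by blast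
    qed
    then have "Q j s t * exp (- (2 * L) * t) * exp ((2 * L) * t) \<le> Q j s t' * exp (- (2 * L) * t') * exp ((2 * L) * t)"
      by (intro mult_right_mono) auto
    then show ?thesis by (simp add: mult.assoc mult_exp_exp algebra_simps)
  qed
  then show ?thesis using L(1) by (intro that[of "2 * L"]) auto
qed

end

section \<open>Virial identity for translation differences\<close>

context cqnls_decay
begin

text \<open>Real part of the gradient-free virial identity, the difference of correlations being
  -\<open>Q\<close>/2.\<close>

lemma Q_virial:
  assumes S: "S \<ge> 0"
  shows "integral (per T) (Q j S) = integral {0..S} (\<lambda>s. integral (per T) (N j s))"
proof -
  let ?A = "\<lambda>t. corr1 j U U 0 S t - corr1 j U U 0 0 t"
  let ?B = "\<lambda>s t. corrh j G U 0 s t - corrh j U G 0 s t"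
  have iA: "?A integrable_on (per T)" and iB: "\<And>s. ?B s integrable_on (per T)"
    by (intro integrable_continuous_real continuous_intros corr_cont edec_UG half_cont)+
  have iBB: "(\<lambda>s. integral (per T) (?B s)) integrable_on {0..S}"
  proof (rule integrable_continuous_real, rule continuous_on_subset[OF _ subset_UNIV], rule continuous_integral_param)
    show "continuous_on UNIV (\<lambda>y. ?B (fst y) (snd y))"
      by (intro continuous_on_diff corr_cont edec_UG half_cont continuous_on_const continuous_on_fst continuous_on_snd continuous_on_id)
  qed
  have Q: "Q j S = (\<lambda>t. - 2 * Re (?A t))" by (simp add: Q_corr fun_eq_iff)
  have "integral (per T) (Q j S) = - 2 * integral (per T) (Re \<circ> ?A)"
    unfolding Q o_def by (rule Henstock_Kurzweil_Integration.integral_mult_right)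
  also have "\<dots> = - Re (2 * integral (per T) ?A)"
    by (subst integral_linear[OF iA bounded_linear_Re]) simp
  also have "\<dots> = Re (integral {0..S} (\<lambda>s. integral (per T) (?B s)))"
    unfolding virial_moll[OF S] by simp
  also have "\<dots> = integral {0..S} (\<lambda>s. Re (integral (per T) (?B s)))"
    by (subst integral_linear[OF iBB bounded_linear_Re, symmetric]) (simp add: o_def)
  also have "\<dots> = integral {0..S} (\<lambda>s. integral (per T) (N j s))"
    by (subst integral_linear[OF iB bounded_linear_Re, symmetric]) (simp add: o_def N_corr[abs_def])
  finally show ?thesis .
qed

definition Htot :: "real \<Rightarrow> real" where
  "Htot t = (LBINT x. Hz (u t x))"

lemma Htot_cont: "continuous_on A Htot"
  unfolding Htot_def by (rule edec_continuous_integral[OF edec_gz(3)[OF edec_u]])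

text \<open>Discrete integration by parts: a translation turns the weight s/2 + x_j into -s/2 + x_j,
  and the two weights differ by s.\<close>

lemma N_main_term:
  "(LBINT x. (s / 2 + x $ j) * (Hz (u t (sh j s x)) - Hz (u t x))) = - s * Htot t"
proof -
  let ?b = "\<lambda>x. u t (sh j s x)"
  have i: "integrable lborel (\<lambda>x. (c + x $ j) * Hz (u t (x + h)))" for c h
    by (rule integrable_edec)
       (intro edec_linear_weight edec_gz edec_ux)
  have iH: "integrable lborel (\<lambda>x. Hz (u t x))"
    by (rule edec_integrable[OF edec_gz(3)[OF edec_u]])
  have sh: "(LBINT x. (s / 2 + x $ j) * Hz (?b x)) = (LBINT x. (- s / 2 + x $ j) * Hz (u t x))"
  proof -
    have "(LBINT x. (- s / 2 + (sh j s x) $ j) * Hz (?b x)) = (LBINT x. (- s / 2 + x $ j) * Hz (u t x))"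
      by (rule integral_translation_lborel[where f = "\<lambda>x. (- s / 2 + x $ j) * Hz (u t x)"])
         (use i[of "- s / 2" 0] in \<open>simp add: borel_measurable_integrable\<close>)
    moreover have "- s / 2 + (sh j s x) $ j = s / 2 + x $ j" for x
      by simp
    ultimately show ?thesis by simp
  qed
  have "(LBINT x. (s / 2 + x $ j) * (Hz (?b x) - Hz (u t x)))
     = (LBINT x. (s / 2 + x $ j) * Hz (?b x)) - (LBINT x. (s / 2 + x $ j) * Hz (u t x))"
    using i[of "s / 2" "s *\<^sub>R axis j 1"] i[of "s / 2" 0] by (simp add: right_diff_distrib)
  also have "\<dots> = (LBINT x. (- s / 2 + x $ j) * Hz (u t x) - (s / 2 + x $ j) * Hz (u t x))"
    unfolding sh using i[of "- s / 2" 0] i[of "s / 2" 0] by (subst Bochner_Integration.integral_diff) auto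
  also have "\<dots> = (LBINT x. - s * Hz (u t x))"
    by (intro Bochner_Integration.integral_cong refl) (simp add: field_simps)
  finally show ?thesis by (simp add: Htot_def)
qed

text \<open>The trapezoid defect is of second order in the difference. The weight is at most 1 +
  norm at either of the two points, so each summand of \<open>cmod a + cmod b\<close> meets the
  weight bound at its own point, where the decay of \<open>u\<close> absorbs it.\<close>

lemma N_bound:
  obtains B where "B > 0" "\<And>j s t. 0 \<le> s \<Longrightarrow> s \<le> 1 \<Longrightarrow> \<bar>N j s t + s * Htot t\<bar> \<le> B * Q j s t"
proof -
  obtain M where M: "M > 0" "\<And>t x. cmod (u t x) \<le> M" using u_bound by blast
  obtain W where W: "W > 0" "\<And>t x. (1 + norm x) * cmod (u t x) \<le> W" using u_weighted_bound by blast
  define c where "c = 8 * \<bar>l2\<bar> * M ^ 3 + (\<bar>l1\<bar> + 2 * \<bar>l2\<bar> * M\<^sup>2) * (2 * M)"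
  have c0: "c \<ge> 0" using M by (simp add: c_def)
  have "\<bar>N j s t + s * Htot t\<bar> \<le> (c * (2 * W)) * Q j s t" if s: "0 \<le> s" "s \<le> 1" for j s t
  proof -
    let ?b = "\<lambda>x. u t (sh j s x)" and ?a = "u t"
    let ?E = "\<lambda>x. (gz (?b x) - gz (?a x)) * Re (?b x * cnj (?a x))"
    let ?H = "\<lambda>x. Hz (?b x) - Hz (?a x)"
    have i1: "integrable lborel (\<lambda>x. (s / 2 + x $ j) * ?E x)"
      by (rule integrable_edec)
         (intro edec_linear_weight edec_mult edec_diff edec_gz edec_bounded_linear[OF bounded_linear_Re] edec_cnj edec_ux)
    have i2: "integrable lborel (\<lambda>x. (s / 2 + x $ j) * ?H x)"
      by (rule integrable_edec)
         (intro edec_linear_weight edec_diff edec_gz edec_ux)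
    have "N j s t + s * Htot t = N j s t - (LBINT x. (s / 2 + x $ j) * ?H x)"
      by (simp add: N_main_term)
    also have "\<dots> = (LBINT x. (s / 2 + x $ j) * (?E x - ?H x))"
      unfolding N_def right_diff_distrib[of _ "?E x" "?H x" for x] by (rule Bochner_Integration.integral_diff[OF i1 i2, symmetric])
    finally have eq: "N j s t + s * Htot t = (LBINT x. (s / 2 + x $ j) * (?E x - ?H x))" .
    have pw: "norm ((s / 2 + x $ j) * (?E x - ?H x)) \<le> (c * (2 * W)) * (cmod (?b x - ?a x))\<^sup>2" for x
    proof -
      have x1: "\<bar>s / 2 + x $ j\<bar> \<le> 1 + norm x" using component_le_norm_cart[of x j] s by linarith
      have x2: "\<bar>s / 2 + x $ j\<bar> \<le> 1 + norm (sh j s x)"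
        using component_le_norm_cart[of "x + s *\<^sub>R axis j 1" j] s by simp
      have "\<bar>s / 2 + x $ j\<bar> * (cmod (?a x) + cmod (?b x)) \<le> (1 + norm x) * cmod (?a x) + (1 + norm (sh j s x)) * cmod (?b x)"
        unfolding distrib_left using x1 x2 by (intro add_mono mult_right_mono) auto
      also have "\<dots> \<le> 2 * W" using W(2)[of x t] W(2)[of "x + s *\<^sub>R axis j 1" t] by simp
      finally have w: "\<bar>s / 2 + x $ j\<bar> * (cmod (?a x) + cmod (?b x)) \<le> 2 * W" .
      have "norm ((s / 2 + x $ j) * (?E x - ?H x)) \<le> \<bar>s / 2 + x $ j\<bar> * (c * ((cmod (?a x) + cmod (?b x)) * (cmod (?b x - ?a x))\<^sup>2))"
        unfolding real_norm_def abs_mult[of "s / 2 + x $ j"] c_def by (intro mult_left_mono gz_Re_bound M) auto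
      also have "\<dots> = c * ((\<bar>s / 2 + x $ j\<bar> * (cmod (?a x) + cmod (?b x))) * (cmod (?b x - ?a x))\<^sup>2)"
        by (simp only: mult_ac)
      also have "\<dots> \<le> c * ((2 * W) * (cmod (?b x - ?a x))\<^sup>2)"
        using w c0 by (intro mult_left_mono mult_right_mono) auto
      finally show ?thesis by (simp only: mult.assoc)
    qed
    have "norm (N j s t + s * Htot t) \<le> (LBINT x. (c * (2 * W)) * (cmod (?b x - ?a x))\<^sup>2)"
      unfolding eq
    proof (rule Bochner_Integration.integral_norm_bound_integral)
      show "integrable lborel (\<lambda>x. (s / 2 + x $ j) * (?E x - ?H x))"
        unfolding right_diff_distrib[of _ "?E x" "?H x" for x] using i1 i2 by (rule Bochner_Integration.integrable_diff)
    qed (use pw in \<open>auto intro!: integrable_mult_right integrable_Q\<close>)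
    then show ?thesis by (simp add: Q_def)
  qed
  moreover have "(c * (2 * W)) * Q j s t \<le> (c * (2 * W) + 1) * Q j s t" for j s t
    using Q_nonneg[of j s t] by (intro mult_right_mono) auto
  ultimately have "\<bar>N j s t + s * Htot t\<bar> \<le> (c * (2 * W) + 1) * Q j s t" if "0 \<le> s" "s \<le> 1" for j s t
    using that order_trans by blast
  then show ?thesis using c0 W(1) by (intro that[of "c * (2 * W) + 1"]) (auto intro: add_nonneg_pos)
qed

section \<open>Small shifts: the quadratic bound and its limit\<close>

definition q :: "'n \<Rightarrow> real \<Rightarrow> real \<Rightarrow> real" where
  "q j T s = integral (per T) (Q j s)"

lemma Q_integrable: "Q j s integrable_on {a..b}"
  using Q_cont[OF continuous_on_const continuous_on_id, of "{a..b}" j s] by (intro integrable_continuous_real) simp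

lemma q_nonneg: "q j T s \<ge> 0"
  unfolding q_def by (intro Henstock_Kurzweil_Integration.integral_nonneg Q_integrable Q_nonneg)

lemma q_cont: "continuous_on A (q j T)"
proof -
  have "continuous_on UNIV (\<lambda>s. integral (per T) (Q j s))"
    by (rule continuous_integral_param) (intro Q_cont continuous_intros)
  then show ?thesis unfolding q_def[abs_def] by (rule continuous_on_subset) simp
qed

text \<open>\<open>N_bound\<close> is integrated over the period and then over the shift; the factor
  \<open>S\<^sup>2 / 2\<close> is the integral of s.\<close>

lemma q_estimate:
  obtains B where "B > 0" "\<And>j T S. 0 \<le> S \<Longrightarrow> S \<le> 1 \<Longrightarrow>
    \<bar>q j T S + S\<^sup>2 / 2 * integral (per T) Htot\<bar> \<le> B * integral {0..S} (q j T)"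
proof -
  obtain B where B: "B > 0" "\<And>j s t. 0 \<le> s \<Longrightarrow> s \<le> 1 \<Longrightarrow> \<bar>N j s t + s * Htot t\<bar> \<le> B * Q j s t"
    using N_bound by blast
  have "\<bar>q j T S + S\<^sup>2 / 2 * integral (per T) Htot\<bar> \<le> B * integral {0..S} (q j T)" if S: "0 \<le> S" "S \<le> 1" for j T S
  proof -
    let ?I = "integral (per T) Htot"
    have iH: "Htot integrable_on (per T)" by (rule integrable_continuous_real[OF Htot_cont])
    have iN: "N j s integrable_on (per T)" for s
      using N_cont[OF continuous_on_const continuous_on_id, of "(per T)" j s] by (intro integrable_continuous_real) simp
    have pw: "\<bar>integral (per T) (N j s) + s * ?I\<bar> \<le> B * q j T s" if "s \<in> {0..S}" for s
    proof -
      have "integral (per T) (N j s) + s * ?I = integral (per T) (\<lambda>t. N j s t + s * Htot t)"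
        using iN iH by (subst Henstock_Kurzweil_Integration.integral_add) (auto intro: integrable_on_mult_right)
      moreover have "norm \<dots> \<le> integral (per T) (\<lambda>t. B * Q j s t)"
        using B(2)[of s] that S
        by (intro Henstock_Kurzweil_Integration.integral_norm_bound_integral integrable_add iN integrable_on_mult_right iH Q_integrable) auto
      ultimately show ?thesis by (simp add: q_def)
    qed
    have "continuous_on UNIV (\<lambda>s. integral (per T) (N j s))"
      by (rule continuous_integral_param) (intro N_cont continuous_intros)
    then have iNN: "(\<lambda>s. integral (per T) (N j s)) integrable_on {0..S}"
      by (rule integrable_continuous_real[OF continuous_on_subset]) simp
    have "((\<lambda>s. s * ?I) has_integral (S\<^sup>2 / 2 * ?I - 0\<^sup>2 / 2 * ?I)) {0..S}"
      by (rule fundamental_theorem_of_calculus[OF S(1)])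
         (auto intro!: derivative_eq_intros simp flip: has_real_derivative_iff_has_vector_derivative)
    then have hs: "((\<lambda>s. s * ?I) has_integral (S\<^sup>2 / 2 * ?I)) {0..S}" by simp
    have "q j T S + S\<^sup>2 / 2 * ?I = integral {0..S} (\<lambda>s. integral (per T) (N j s) + s * ?I)"
      using Henstock_Kurzweil_Integration.integral_add[OF iNN has_integral_integrable[OF hs]]
      unfolding integral_unique[OF hs] q_def Q_virial[OF S(1)] by (simp only:)
    moreover have "norm \<dots> \<le> integral {0..S} (\<lambda>s. B * q j T s)"
      using pw hs by (intro Henstock_Kurzweil_Integration.integral_norm_bound_integral integrable_add iNN integrable_on_mult_right)
        (auto simp: has_integral_integrable intro!: integrable_continuous_real q_cont)
    ultimately show ?thesis by simp
  qed
  then show ?thesis using B(1) by (intro that[of B]) auto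
qed

text \<open>Absorption at the point \<open>r\<close> where \<open>q\<close> is maximal on
  \<open>{0..s}\<close>: there the error is at most \<open>B * r * q j T r\<close>, hence at most
  half of \<open>q j T r\<close>, and moves to the left side. The threshold \<open>s0\<close> serves
  all directions and all windows at once.\<close>

lemma q_quadratic:
  obtains s0 where "0 < s0" "s0 \<le> 1"
    "\<And>j T s. 0 \<le> s \<Longrightarrow> s \<le> s0 \<Longrightarrow> q j T s \<le> \<bar>integral (per T) Htot\<bar> * s\<^sup>2"
proof -
  obtain B where B: "B > 0" "\<And>j T S. 0 \<le> S \<Longrightarrow> S \<le> 1 \<Longrightarrow>
    \<bar>q j T S + S\<^sup>2 / 2 * integral (per T) Htot\<bar> \<le> B * integral {0..S} (q j T)"
    using q_estimate by blast
  \<comment> \<open>The second entry makes the absorbed fraction at most 1/2; the first respects the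
    range of shifts in the estimate with \<open>B\<close>.\<close>
  define s0 where "s0 = min 1 (1 / (2 * B))"
  have s0: "0 < s0" "s0 \<le> 1" "B * s0 \<le> 1 / 2" using B(1) by (auto simp: s0_def min_def field_simps)
  have "q j T s \<le> \<bar>integral (per T) Htot\<bar> * s\<^sup>2" if s: "0 \<le> s" "s \<le> s0" for j T s
  proof -
    let ?I = "\<bar>integral (per T) Htot\<bar>"
    obtain r where r: "r \<in> {0..s}" and max: "\<And>y. y \<in> {0..s} \<Longrightarrow> q j T y \<le> q j T r"
      using continuous_attains_sup[of "{0..s}" "q j T"] s q_cont by auto
    have "integral {0..r} (q j T) \<le> integral {0..r} (\<lambda>_. q j T r)"
      using r max by (intro integral_le integrable_continuous_real q_cont continuous_on_const) auto
    then have "B * integral {0..r} (q j T) \<le> B * (r * q j T r)" using B(1) r by simp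
    also have "\<dots> = (B * r) * q j T r" by simp
    also have "\<dots> \<le> 1 / 2 * q j T r"
    proof (rule mult_right_mono)
      have "B * r \<le> B * s0" using B(1) r s by simp
      then show "B * r \<le> 1 / 2" using s0 by simp
    qed (rule q_nonneg)
    finally have "\<bar>q j T r + r\<^sup>2 / 2 * integral (per T) Htot\<bar> \<le> 1 / 2 * q j T r"
      using B(2)[of r j T] r s s0 by simp
    moreover have "- (r\<^sup>2 / 2 * integral (per T) Htot) \<le> r\<^sup>2 / 2 * ?I"
      using mult_left_mono[of "- integral (per T) Htot" ?I "r\<^sup>2 / 2"] by simp
    ultimately have "q j T r \<le> r\<^sup>2 * ?I" by linarith
    also have "\<dots> \<le> s\<^sup>2 * ?I" using r by (intro mult_right_mono power_mono) auto
    finally show ?thesis using max[of s] s by (simp add: mult.commute)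
  qed
  then show ?thesis using s0 by (intro that[of s0]) auto
qed

text \<open>From the average to every single time: the Gronwall bound runs forward, so
  \<open>t\<close> is compared with all times of the preceding period, at distance at most
  \<open>2 * \<tau>\<close>, and the comparison is averaged.\<close>

lemma Q_quadratic:
  obtains s0 M where "0 < s0" "s0 \<le> 1" "M > 0"
    "\<And>j t s. 0 \<le> s \<Longrightarrow> s \<le> s0 \<Longrightarrow> T \<le> t \<Longrightarrow> t \<le> T + \<tau> \<Longrightarrow> Q j s t \<le> M * s\<^sup>2"
proof -
  obtain s0 where s0: "0 < s0" "s0 \<le> 1"
    "\<And>j T s. 0 \<le> s \<Longrightarrow> s \<le> s0 \<Longrightarrow> q j T s \<le> \<bar>integral (per T) Htot\<bar> * s\<^sup>2" using q_quadratic by blast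
  obtain L where L: "L > 0" "\<And>j s t t'. t' \<le> t \<Longrightarrow> Q j s t \<le> exp (L * (t - t')) * Q j s t'" using Q_gronwall by blast
  let ?I = "\<bar>integral (per (T-\<tau>)) Htot\<bar>"
  \<comment> \<open>The summand 1 keeps \<open>M\<close> positive even if the average of
    \<open>Htot\<close> is zero.\<close>
  define M where "M = exp (L * (2 * \<tau>)) * ?I / \<tau> + 1"
  have "Q j s t \<le> M * s\<^sup>2" if s: "0 \<le> s" "s \<le> s0" "T \<le> t" "t \<le> T + \<tau>" for j t s
  proof -
    have "Q j s t \<le> exp (L * (2 * \<tau>)) * Q j s r" if "r \<in> (per (T-\<tau>))" for r
    proof -
      have "Q j s t \<le> exp (L * (t - r)) * Q j s r" using L(2)[of r t] that s by simp
      also have "\<dots> \<le> exp (L * (2 * \<tau>)) * Q j s r"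
        using that s L(1) by (intro mult_right_mono Q_nonneg) auto
      finally show ?thesis .
    qed
    then have "integral (per (T-\<tau>)) (\<lambda>_. Q j s t) \<le> integral (per (T-\<tau>)) (\<lambda>r. exp (L * (2 * \<tau>)) * Q j s r)"
      by (intro integral_le integrable_on_mult_right Q_integrable) auto
    then have "\<tau> * Q j s t \<le> exp (L * (2 * \<tau>)) * q j (T - \<tau>) s"
      using tau by (simp add: q_def)
    also have "\<dots> \<le> exp (L * (2 * \<tau>)) * (?I * s\<^sup>2)" by (intro mult_left_mono s0(3)[OF s(1,2)]) simp
    finally have "Q j s t \<le> exp (L * (2 * \<tau>)) * ?I / \<tau> * s\<^sup>2" using tau by (simp add: field_simps)
    also have "\<dots> \<le> M * s\<^sup>2" by (intro mult_right_mono) (auto simp: M_def)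
    finally show ?thesis .
  qed
  moreover have "M > 0" using tau by (auto simp: M_def intro!: add_nonneg_pos)
  ultimately show ?thesis using s0 by (intro that[of s0 M]) auto
qed

text \<open>By the quadratic bound the error, an integral of \<open>q\<close> over
  \<open>{0..S}\<close>, is of order S^3, so only the main term survives division by S^2. In the
  limit this is the virial identity for one coordinate direction.\<close>

lemma q_limit:
  assumes sk: "sk \<longlonglongrightarrow> 0" "\<And>k::nat. sk k > 0"
  shows "(\<lambda>k. q j T (sk k) / (sk k)\<^sup>2) \<longlonglongrightarrow> - integral (per T) Htot / 2"
proof -
  obtain B where B: "B > 0" "\<And>j T S. 0 \<le> S \<Longrightarrow> S \<le> 1 \<Longrightarrow>
    \<bar>q j T S + S\<^sup>2 / 2 * integral (per T) Htot\<bar> \<le> B * integral {0..S} (q j T)"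
    using q_estimate by blast
  obtain s0 where s0: "0 < s0" "s0 \<le> 1"
    "\<And>j T s. 0 \<le> s \<Longrightarrow> s \<le> s0 \<Longrightarrow> q j T s \<le> \<bar>integral (per T) Htot\<bar> * s\<^sup>2" using q_quadratic by blast
  let ?I = "integral (per T) Htot"
  have "\<bar>q j T S / S\<^sup>2 - - ?I / 2\<bar> \<le> B * \<bar>?I\<bar> * S" if S: "0 < S" "S \<le> s0" for S
  proof -
    have "integral {0..S} (q j T) \<le> integral {0..S} (\<lambda>s. \<bar>?I\<bar> * S\<^sup>2)"
    proof (rule integral_le)
      fix s assume s: "s \<in> {0..S}"
      have "q j T s \<le> \<bar>?I\<bar> * s\<^sup>2" using s0(3) s S by simp
      also have "\<dots> \<le> \<bar>?I\<bar> * S\<^sup>2" using s by (intro mult_left_mono power_mono) auto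
      finally show "q j T s \<le> \<bar>?I\<bar> * S\<^sup>2" .
    qed (auto intro: integrable_continuous_real q_cont)
    also have "\<dots> = (\<bar>?I\<bar> * S) * S\<^sup>2" using S by simp
    finally have 1: "B * integral {0..S} (q j T) \<le> B * ((\<bar>?I\<bar> * S) * S\<^sup>2)" using B(1) by simp
    have "\<bar>q j T S + S\<^sup>2 / 2 * ?I\<bar> \<le> B * integral {0..S} (q j T)" using B(2)[of S j T] S s0 by simp
    with 1 have "\<bar>q j T S + S\<^sup>2 / 2 * ?I\<bar> \<le> (B * \<bar>?I\<bar> * S) * S\<^sup>2" by simp
    then have 2: "\<bar>q j T S + S\<^sup>2 / 2 * ?I\<bar> / S\<^sup>2 \<le> B * \<bar>?I\<bar> * S" using S by (simp add: pos_divide_le_eq)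
    have "q j T S / S\<^sup>2 - - ?I / 2 = (q j T S + S\<^sup>2 / 2 * ?I) / S\<^sup>2" using S by (simp add: add_divide_distrib)
    then have "\<bar>q j T S / S\<^sup>2 - - ?I / 2\<bar> = \<bar>q j T S + S\<^sup>2 / 2 * ?I\<bar> / S\<^sup>2" by (simp add: abs_divide)
    with 2 show ?thesis by simp
  qed
  note est = this
  have "eventually (\<lambda>k. sk k < s0) sequentially" using order_tendstoD(2)[OF sk(1) s0(1)] .
  then have ev: "eventually (\<lambda>k. norm (q j T (sk k) / (sk k)\<^sup>2 - - ?I / 2) \<le> B * \<bar>?I\<bar> * sk k) sequentially"
    by eventually_elim (use est sk in auto)
  have "(\<lambda>k. B * \<bar>?I\<bar> * sk k) \<longlonglongrightarrow> B * \<bar>?I\<bar> * 0" by (intro tendsto_mult tendsto_const sk)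
  then have "(\<lambda>k. q j T (sk k) / (sk k)\<^sup>2 - - ?I / 2) \<longlonglongrightarrow> 0"
    by (intro Lim_null_comparison[OF ev]) simp
  then show ?thesis by (simp only: LIM_zero_iff)
qed

end

subsection \<open>Difference quotients in mean square\<close>

text \<open>Since \<open>min (h k) H\<close> is dominated by \<open>H\<close>, convergence of the integrals of \<open>h k\<close> upgrades to \<open>h k \<rightarrow> H\<close> in \<open>L\<^sup>1\<close>;
  then \<open>f k\<close> may be truncated to \<open>[- H, H]\<close>.\<close>

lemma integral_pratt:
  fixes f h :: "nat \<Rightarrow> 'a \<Rightarrow> real"
  assumes [measurable]: "\<And>k. f k \<in> borel_measurable M" "F \<in> borel_measurable M"
    and h: "\<And>k. integrable M (h k)" and H: "integrable M H"
    and le: "\<And>k x. \<bar>f k x\<bar> \<le> h k x"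
    and fl: "\<And>x. (\<lambda>k. f k x) \<longlonglongrightarrow> F x" and hl: "\<And>x. (\<lambda>k. h k x) \<longlonglongrightarrow> H x"
    and hi: "(\<lambda>k. \<integral>x. h k x \<partial>M) \<longlonglongrightarrow> (\<integral>x. H x \<partial>M)"
  shows "(\<lambda>k. \<integral>x. f k x \<partial>M) \<longlonglongrightarrow> (\<integral>x. F x \<partial>M)"
proof -
  have [measurable]: "\<And>k. h k \<in> borel_measurable M" "H \<in> borel_measurable M" using h H by auto
  have h0: "h k x \<ge> 0" for k x using le[of k x] by linarith
  have FH: "\<bar>F x\<bar> \<le> H x" for x
    by (rule LIMSEQ_le[OF tendsto_rabs[OF fl] hl]) (use le in auto)
  then have H0: "H x \<ge> 0" for x using order_trans[OF abs_ge_zero] by blast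
  let ?m = "\<lambda>k x. min (h k x) (H x)" and ?g = "\<lambda>k x. max (- H x) (min (H x) (f k x))"
  have m: "(\<lambda>k. \<integral>x. ?m k x \<partial>M) \<longlonglongrightarrow> (\<integral>x. H x \<partial>M)"
  proof (rule integral_dominated_convergence[where w = H])
    show "AE x in M. (\<lambda>k. ?m k x) \<longlonglongrightarrow> H x"
    proof (rule AE_I2)
      fix x show "(\<lambda>k. ?m k x) \<longlonglongrightarrow> H x" using tendsto_min[OF hl[of x] tendsto_const[of "H x"]] by simp
    qed
    show "AE x in M. norm (?m k x) \<le> H x" for k using h0 H0 by (intro AE_I2) (auto simp: min_def)
  qed (use H in auto)
  have im: "integrable M (?m k)" for k using h H by (rule integrable_min)
  have ig: "integrable M (?g k)" for k
    by (rule Bochner_Integration.integrable_bound[OF H]) (use H0 in \<open>auto simp: max_def min_def\<close>)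
  have if': "integrable M (f k)" for k
    by (rule Bochner_Integration.integrable_bound[OF h]) (use le h0 in auto)
  have g: "(\<lambda>k. \<integral>x. ?g k x \<partial>M) \<longlonglongrightarrow> (\<integral>x. F x \<partial>M)"
  proof (rule integral_dominated_convergence[where w = H])
    have "max (- H x) (min (H x) (F x)) = F x" for x using FH[of x] by (auto simp: max_def min_def)
    then show "AE x in M. (\<lambda>k. ?g k x) \<longlonglongrightarrow> F x"
      using tendsto_max[OF tendsto_const tendsto_min[OF tendsto_const fl], of "- H x" "H x" x for x] by (intro AE_I2) simp
    show "AE x in M. norm (?g k x) \<le> H x" for k using H0 by (intro AE_I2) (auto simp: max_def min_def)
  qed (use H in auto)
  have d: "\<bar>(\<integral>x. f k x \<partial>M) - (\<integral>x. ?g k x \<partial>M)\<bar> \<le> (\<integral>x. h k x \<partial>M) - (\<integral>x. ?m k x \<partial>M)" for k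
  proof -
    have "norm (\<integral>x. f k x - ?g k x \<partial>M) \<le> (\<integral>x. h k x - ?m k x \<partial>M)"
    proof (rule order_trans[OF Bochner_Integration.integral_norm_bound integral_mono])
      fix x
      show "norm (f k x - ?g k x) \<le> h k x - ?m k x"
        using le[of k x] H0[of x] by (auto simp: max_def min_def)
    qed (intro integrable_norm Bochner_Integration.integrable_diff if' ig h im)+
    then show ?thesis using if' ig h im by simp
  qed
  have "(\<lambda>k. (\<integral>x. f k x \<partial>M) - (\<integral>x. ?g k x \<partial>M)) \<longlonglongrightarrow> 0"
  proof (rule Lim_null_comparison)
    show "\<forall>\<^sub>F k in sequentially. norm ((\<integral>x. f k x \<partial>M) - (\<integral>x. ?g k x \<partial>M)) \<le> (\<integral>x. h k x \<partial>M) - (\<integral>x. ?m k x \<partial>M)"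
      using d by simp
    show "(\<lambda>k. (\<integral>x. h k x \<partial>M) - (\<integral>x. ?m k x \<partial>M)) \<longlonglongrightarrow> 0" using tendsto_diff[OF hi m] by simp
  qed
  from tendsto_add[OF this g] show ?thesis by simp
qed

text \<open>The variance of \<open>a\<close> over the unit interval is nonnegative.\<close>

lemma power2_integral_le:
  fixes a :: "real \<Rightarrow> real"
  assumes c: "continuous_on {0..1} a"
  shows "(integral {0..1} a)\<^sup>2 \<le> integral {0..1} (\<lambda>\<theta>. (a \<theta>)\<^sup>2)"
proof -
  let ?m = "integral {0..1} a"
  have i: "a integrable_on {0..1}" "(\<lambda>\<theta>. (a \<theta>)\<^sup>2) integrable_on {0..1}"
    using c by (auto intro!: integrable_continuous_real continuous_intros)
  have "0 \<le> integral {0..1} (\<lambda>\<theta>. (a \<theta> - ?m)\<^sup>2)"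
    using c by (intro Henstock_Kurzweil_Integration.integral_nonneg integrable_continuous_real) (auto intro!: continuous_intros)
  also have "(\<lambda>\<theta>. (a \<theta> - ?m)\<^sup>2) = (\<lambda>\<theta>. ((a \<theta>)\<^sup>2 + (- 2 * ?m) * a \<theta>) + ?m\<^sup>2)"
    by (auto simp: power2_eq_square algebra_simps)
  also have "integral {0..1} \<dots> = integral {0..1} (\<lambda>\<theta>. (a \<theta>)\<^sup>2) + (- 2 * ?m) * ?m + ?m\<^sup>2"
  proof -
    have "((\<lambda>\<theta>. ((a \<theta>)\<^sup>2 + (- 2 * ?m) * a \<theta>) + ?m\<^sup>2) has_integral
        integral {0..1} (\<lambda>\<theta>. (a \<theta>)\<^sup>2) + (- 2 * ?m) * ?m + ?m\<^sup>2) {0..1}"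
      using i has_integral_const_real[of "?m\<^sup>2" 0 1]
      by (intro has_integral_add has_integral_mult_right integrable_integral) auto
    then show ?thesis by (rule integral_unique)
  qed
  finally show ?thesis by (simp add: power2_eq_square)
qed

text \<open>Abstracts one time slice, with a quadratic bound along a single sequence of shifts; the
  constant \<open>M\<close> passes on to the squared norm of the derivative.\<close>

locale difference_quotient =
  fixes v v1 :: "'a::euclidean_space \<Rightarrow> complex" and e :: 'a and sk :: "nat \<Rightarrow> real" and M :: real
  assumes v: "continuous_on UNIV v" and v1: "continuous_on UNIV v1"
    and dv: "\<And>x. ((\<lambda>s. v (x + s *\<^sub>R e)) has_vector_derivative v1 x) (at 0)"
    and sk: "sk \<longlonglongrightarrow> 0" and skp: "\<And>k. sk k > 0"
    and int: "\<And>k. integrable lborel (\<lambda>x. (cmod (v (x + sk k *\<^sub>R e) - v x))\<^sup>2)"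
    and bound: "\<And>k. (LBINT x. (cmod (v (x + sk k *\<^sub>R e) - v x))\<^sup>2) \<le> M * (sk k)\<^sup>2"
begin

lemma quotient_limit: "(\<lambda>k. (v (x + sk k *\<^sub>R e) - v x) /\<^sub>R sk k) \<longlonglongrightarrow> v1 x"
proof -
  have "(\<lambda>s. (v (x + s *\<^sub>R e) - v (x + 0 *\<^sub>R e)) /\<^sub>R (s - 0)) \<midarrow>0\<rightarrow> v1 x"
    using dv[of x] unfolding has_vector_derivative_iff_quotient .
  moreover have "\<forall>k. sk k \<in> UNIV - {0}" using skp by (simp add: less_imp_neq[symmetric])
  ultimately have "((\<lambda>s. (v (x + s *\<^sub>R e) - v (x + 0 *\<^sub>R e)) /\<^sub>R (s - 0)) \<circ> sk) \<longlonglongrightarrow> v1 x"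
    using sk unfolding tendsto_at_iff_sequentially by blast
  then show ?thesis by (simp add: o_def)
qed

lemma quotient2_limit: "(\<lambda>k. (cmod (v (x + sk k *\<^sub>R e) - v x))\<^sup>2 / (sk k)\<^sup>2) \<longlonglongrightarrow> (cmod (v1 x))\<^sup>2"
proof -
  have "(\<lambda>k. (cmod ((v (x + sk k *\<^sub>R e) - v x) /\<^sub>R sk k))\<^sup>2) \<longlonglongrightarrow> (cmod (v1 x))\<^sup>2"
    by (intro tendsto_power tendsto_norm quotient_limit)
  moreover have "(cmod ((v (x + sk k *\<^sub>R e) - v x) /\<^sub>R sk k))\<^sup>2 = (cmod (v (x + sk k *\<^sub>R e) - v x))\<^sup>2 / (sk k)\<^sup>2" for k
    using skp[of k] by (simp only: norm_scaleR abs_inverse) (simp add: power_mult_distrib field_simps)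
  ultimately show ?thesis by simp
qed

lemma v1_measurable [measurable]: "v1 \<in> borel_measurable borel" "v \<in> borel_measurable borel"
  using v v1 by (auto intro: borel_measurable_continuous_onI)

text \<open>Fatou's lemma along the squared difference quotients, whose integrals are at most
  \<open>M\<close>.\<close>

lemma v1_square_integrable: "integrable lborel (\<lambda>x. (cmod (v1 x))\<^sup>2)"
proof (rule integrableI_bounded)
  show "(\<lambda>x. (cmod (v1 x))\<^sup>2) \<in> borel_measurable lborel" by simp
  let ?D = "\<lambda>k x. (cmod (v (x + sk k *\<^sub>R e) - v x))\<^sup>2 / (sk k)\<^sup>2"
  have iD: "integrable lborel (?D k)" for k using int by simp
  have [measurable]: "?D k \<in> borel_measurable lborel" for k using borel_measurable_integrable[OF iD] .
  have "(\<integral>\<^sup>+ x. ennreal (norm ((cmod (v1 x))\<^sup>2)) \<partial>lborel) = (\<integral>\<^sup>+ x. liminf (\<lambda>k. ennreal (?D k x)) \<partial>lborel)"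
  proof (rule nn_integral_cong)
    fix x
    have "(\<lambda>k. ennreal (?D k x)) \<longlonglongrightarrow> ennreal ((cmod (v1 x))\<^sup>2)" by (intro tendsto_ennrealI quotient2_limit)
    then show "ennreal (norm ((cmod (v1 x))\<^sup>2)) = liminf (\<lambda>k. ennreal (?D k x))"
      using lim_imp_Liminf[OF sequentially_bot] by fastforce
  qed
  also have "\<dots> \<le> liminf (\<lambda>k. \<integral>\<^sup>+ x. ennreal (?D k x) \<partial>lborel)"
    by (rule nn_integral_liminf) measurable
  also have "\<dots> \<le> liminf (\<lambda>k::nat. ennreal M)"
  proof (rule Liminf_mono, rule always_eventually, rule allI)
    fix k
    have "(\<integral>\<^sup>+ x. ennreal (?D k x) \<partial>lborel) = ennreal (LBINT x. ?D k x)"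
      by (rule nn_integral_eq_integral[OF iD]) simp
    also have "\<dots> \<le> ennreal M"
      using bound[of k] skp[of k] by (intro ennreal_leI) (simp add: field_simps)
    finally show "(\<integral>\<^sup>+ x. ennreal (?D k x) \<partial>lborel) \<le> ennreal M" .
  qed
  also have "\<dots> = ennreal M" by (simp add: Liminf_const)
  finally show "(\<integral>\<^sup>+ x. ennreal (norm ((cmod (v1 x))\<^sup>2)) \<partial>lborel) < \<infinity>"
    using ennreal_less_top order_le_less_trans by (metis infinity_ennreal_def)
qed

text \<open>Average of the squared derivative over the segment from \<open>x\<close> to
  \<open>x + s e\<close>. By Cauchy-Schwarz it dominates the squared quotient, and by translation
  invariance its integral in \<open>x\<close> does not depend on \<open>s\<close>. It is a majorant
  that varies with the shift but has convergent integrals, as \<open>integral_pratt\<close>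
  requires; square integrability of \<open>v1\<close> alone supplies no fixed one.\<close>

definition h :: "real \<Rightarrow> 'a \<Rightarrow> real" where
  "h s x = integral {0..1} (\<lambda>\<theta>. (cmod (v1 (x + (\<theta> * s) *\<^sub>R e)))\<^sup>2)"

lemma v1_line_cont: "continuous_on S (\<lambda>\<theta>. v1 (x + (\<theta> * s) *\<^sub>R e))"
  by (rule continuous_on_compose2[OF v1], intro continuous_intros) simp

lemma h_cont: "continuous_on UNIV (\<lambda>p. h (fst p) (snd p))"
proof -
  have "continuous_on UNIV (\<lambda>y::(real \<times> 'a) \<times> real. (cmod (v1 (snd (fst y) + (snd y * fst (fst y)) *\<^sub>R e)))\<^sup>2)"
    by (intro continuous_on_power continuous_on_norm continuous_on_compose2[OF v1] continuous_intros) auto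
  then show ?thesis unfolding h_def by (rule continuous_integral_param)
qed

lemma h_cont2:
  assumes "continuous_on A a" "continuous_on A b"
  shows "continuous_on A (\<lambda>y. h (a y) (b y))"
  using continuous_on_compose2[OF h_cont continuous_on_Pair[OF assms]] by simp

lemma h_dominates: "(cmod (v (x + s *\<^sub>R e) - v x))\<^sup>2 \<le> s\<^sup>2 * h s x"
proof -
  let ?w = "\<lambda>\<theta>. v1 (x + (\<theta> * s) *\<^sub>R e)"
  have I: "((\<lambda>\<theta>. s *\<^sub>R ?w \<theta>) has_integral (v (x + (1 * s) *\<^sub>R e) - v (x + (0 * s) *\<^sub>R e))) {0..1}"
  proof (rule fundamental_theorem_of_calculus)
    fix \<theta> :: real
    have "((\<lambda>r. v (x + r *\<^sub>R e)) \<circ> (\<lambda>\<theta>. \<theta> * s) has_vector_derivative s *\<^sub>R v1 (x + (\<theta> * s) *\<^sub>R e)) (at \<theta>)"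
      by (rule vector_diff_chain_at[OF _ has_vector_derivative_line[OF dv]])
         (auto intro!: derivative_eq_intros simp flip: has_real_derivative_iff_has_vector_derivative)
    then show "((\<lambda>\<theta>. v (x + (\<theta> * s) *\<^sub>R e)) has_vector_derivative s *\<^sub>R ?w \<theta>) (at \<theta> within {0..1})"
      by (simp add: o_def has_vector_derivative_at_within)
  qed simp
  have eq: "v (x + s *\<^sub>R e) - v x = integral {0..1} (\<lambda>\<theta>. s *\<^sub>R ?w \<theta>)"
    unfolding integral_unique[OF I] by simp
  have "cmod (v (x + s *\<^sub>R e) - v x) \<le> integral {0..1} (\<lambda>\<theta>. \<bar>s\<bar> * cmod (?w \<theta>))"
    unfolding eq by (intro Henstock_Kurzweil_Integration.integral_norm_bound_integral integrable_continuous_real continuous_intros v1_line_cont) simp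
  then have "(cmod (v (x + s *\<^sub>R e) - v x))\<^sup>2 \<le> (\<bar>s\<bar> * integral {0..1} (\<lambda>\<theta>. cmod (?w \<theta>)))\<^sup>2"
    by (intro power_mono) simp_all
  also have "\<dots> \<le> s\<^sup>2 * h s x"
    unfolding power_mult_distrib h_def power2_abs
    by (intro mult_left_mono power2_integral_le continuous_intros v1_line_cont) simp
  finally show ?thesis .
qed

lemma h_nonneg: "h s x \<ge> 0"
  unfolding h_def
  by (intro Henstock_Kurzweil_Integration.integral_nonneg integrable_continuous_real continuous_intros v1_line_cont) simp

lemma h_integral: "integrable lborel (h s)" "(LBINT x. h s x) = (LBINT x. (cmod (v1 x))\<^sup>2)"
proof -
  let ?I = "LBINT x. (cmod (v1 x))\<^sup>2"
  have hm: "h s \<in> borel_measurable borel"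
    using h_cont2[OF continuous_on_const continuous_on_id] by (intro borel_measurable_continuous_onI) simp
  have "(\<integral>\<^sup>+ x. ennreal (h s x) \<partial>lborel)
     = (\<integral>\<^sup>+ x. \<integral>\<^sup>+ \<theta>. ennreal ((cmod (v1 (x + (\<theta> * s) *\<^sub>R e)))\<^sup>2) * indicator {0..1} \<theta> \<partial>lborel \<partial>lborel)"
  proof (rule nn_integral_cong)
    fix x
    have "((\<lambda>\<theta>. (cmod (v1 (x + (\<theta> * s) *\<^sub>R e)))\<^sup>2) has_integral h s x) {0..1}"
      unfolding h_def by (intro integrable_integral integrable_continuous_real continuous_intros v1_line_cont)
    from nn_integral_has_integral_lebesgue'[OF _ this]
    show "ennreal (h s x) = (\<integral>\<^sup>+ \<theta>. ennreal ((cmod (v1 (x + (\<theta> * s) *\<^sub>R e)))\<^sup>2) * indicator {0..1} \<theta> \<partial>lborel)"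
      by simp
  qed
  \<comment> \<open>Tonelli's theorem; afterwards the inner integral is the same for every \<theta>
    by translation invariance.\<close>
  also have "\<dots> = (\<integral>\<^sup>+ \<theta>. \<integral>\<^sup>+ x. ennreal ((cmod (v1 (x + (\<theta> * s) *\<^sub>R e)))\<^sup>2) * indicator {0..1} \<theta> \<partial>lborel \<partial>lborel)"
  proof (rule lborel_pair.Fubini')
    have "(\<lambda>p::real \<times> 'a. v1 (snd p + (fst p * s) *\<^sub>R e)) \<in> borel_measurable borel"
      by (intro borel_measurable_continuous_onI continuous_on_compose2[OF v1] continuous_intros) auto
    then have 1: "(\<lambda>p::real \<times> 'a. v1 (snd p + (fst p * s) *\<^sub>R e)) \<in> borel_measurable (lborel \<Otimes>\<^sub>M lborel)"
      by (simp add: lborel_prod)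
    have 2: "(\<lambda>p::real \<times> 'a. indicator {0..1} (fst p) :: ennreal) \<in> borel_measurable (lborel \<Otimes>\<^sub>M lborel)"
      by (rule measurable_compose[OF measurable_fst]) simp
    show "(\<lambda>(\<theta>, x). ennreal ((cmod (v1 (x + (\<theta> * s) *\<^sub>R e)))\<^sup>2) * indicator {0..1} \<theta>) \<in> borel_measurable (lborel \<Otimes>\<^sub>M lborel)"
      unfolding case_prod_beta' using 1 2
      by (intro borel_measurable_times_ennreal measurable_compose[OF _ measurable_ennreal] borel_measurable_power borel_measurable_norm) auto
  qed
  also have "\<dots> = (\<integral>\<^sup>+ \<theta>. ennreal ?I * indicator {0..1} (\<theta>::real) \<partial>lborel)"
  proof (rule nn_integral_cong)
    fix \<theta> :: real
    have "(\<integral>\<^sup>+ x. ennreal ((cmod (v1 (x + (\<theta> * s) *\<^sub>R e)))\<^sup>2) \<partial>lborel) = (\<integral>\<^sup>+ x. ennreal ((cmod (v1 x))\<^sup>2) \<partial>(distr lborel borel ((+) ((\<theta> * s) *\<^sub>R e))))"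
      by (subst nn_integral_distr) (auto simp: add.commute)
    also have "\<dots> = ennreal ?I"
      unfolding lborel_distr_plus by (rule nn_integral_eq_integral[OF v1_square_integrable]) simp
    finally show "(\<integral>\<^sup>+ x. ennreal ((cmod (v1 (x + (\<theta> * s) *\<^sub>R e)))\<^sup>2) * indicator {0..1} \<theta> \<partial>lborel) = ennreal ?I * indicator {0..1} \<theta>"
      by (cases "\<theta> \<in> {0..1}") auto
  qed
  also have "\<dots> = ennreal ?I" by (simp add: nn_integral_cmult_indicator)
  finally have nn: "(\<integral>\<^sup>+ x. ennreal (h s x) \<partial>lborel) = ennreal ?I" .
  show "integrable lborel (h s)"
    using hm h_nonneg nn by (intro integrableI_nonneg) auto
  show "(LBINT x. h s x) = ?I"
    using hm h_nonneg nn by (intro integral_eq_nn_integral[THEN trans]) auto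
qed

text \<open>Used both for the kinetic term and for the source \<open>K\<close>, whose integrands are
  dominated by multiples of the squared quotient.\<close>

lemma quadratic_limit:
  assumes f: "\<And>k. f k \<in> borel_measurable lborel" and F: "F \<in> borel_measurable lborel" and c: "c \<ge> 0"
    and le: "\<And>k x. \<bar>f k x\<bar> \<le> c * ((cmod (v (x + sk k *\<^sub>R e) - v x))\<^sup>2 / (sk k)\<^sup>2)"
    and lim: "\<And>x. (\<lambda>k. f k x) \<longlonglongrightarrow> F x"
  shows "(\<lambda>k. LBINT x. f k x) \<longlonglongrightarrow> (LBINT x. F x)"
proof (rule integral_pratt[where h = "\<lambda>k x. c * h (sk k) x" and H = "\<lambda>x. c * (cmod (v1 x))\<^sup>2", OF f F])
  show "integrable lborel (\<lambda>x. c * h (sk k) x)" for k by (intro integrable_mult_right h_integral)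
  show "integrable lborel (\<lambda>x. c * (cmod (v1 x))\<^sup>2)" by (intro integrable_mult_right v1_square_integrable)
  show "\<bar>f k x\<bar> \<le> c * h (sk k) x" for k x
  proof -
    have "(cmod (v (x + sk k *\<^sub>R e) - v x))\<^sup>2 / (sk k)\<^sup>2 \<le> h (sk k) x"
      using h_dominates[of x "sk k"] skp[of k] by (simp add: pos_divide_le_eq mult.commute)
    then show ?thesis using le[of k x] c by (meson mult_left_mono order_trans)
  qed
  show "(\<lambda>k. c * h (sk k) x) \<longlonglongrightarrow> c * (cmod (v1 x))\<^sup>2" for x
  proof -
    have "continuous_on UNIV (\<lambda>s. h s x)"
      by (rule h_cont2[OF continuous_on_id continuous_on_const])
    then have "isCont (\<lambda>s. h s x) 0" by (simp add: continuous_on_eq_continuous_at)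
    then have "(\<lambda>k. h (sk k) x) \<longlonglongrightarrow> h 0 x" using sk by (rule isCont_tendsto_compose)
    moreover have "h 0 x = (cmod (v1 x))\<^sup>2" by (simp add: h_def)
    ultimately show ?thesis by (intro tendsto_mult tendsto_const) simp
  qed
  show "(\<lambda>k. LBINT x. c * h (sk k) x) \<longlonglongrightarrow> (LBINT x. c * (cmod (v1 x))\<^sup>2)"
    by (simp add: h_integral)
qed (rule lim)

lemma quotient_norm_limit:
  "(\<lambda>k. (LBINT x. (cmod (v (x + sk k *\<^sub>R e) - v x))\<^sup>2) / (sk k)\<^sup>2) \<longlonglongrightarrow> (LBINT x. (cmod (v1 x))\<^sup>2)"
proof -
  have "(\<lambda>k. LBINT x. (cmod (v (x + sk k *\<^sub>R e) - v x))\<^sup>2 / (sk k)\<^sup>2) \<longlonglongrightarrow> (LBINT x. (cmod (v1 x))\<^sup>2)"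
  proof (rule quadratic_limit[where c = 1])
    show "(\<lambda>x. (cmod (v (x + sk k *\<^sub>R e) - v x))\<^sup>2 / (sk k)\<^sup>2) \<in> borel_measurable lborel" for k
      using int[of k] by (auto dest: borel_measurable_integrable)
  qed (auto intro: quotient2_limit)
  then show ?thesis by simp
qed

lemma v1_norm_bound: "(LBINT x. (cmod (v1 x))\<^sup>2) \<le> M"
proof (rule LIMSEQ_le_const2[OF quotient_norm_limit], intro exI allI impI)
  fix k show "(LBINT x. (cmod (v (x + sk k *\<^sub>R e) - v x))\<^sup>2) / (sk k)\<^sup>2 \<le> M"
    using bound[of k] skp[of k] by (simp add: pos_divide_le_eq)
qed

end

subsection \<open>The localized energy\<close>

lemma cmod2_derivative:
  assumes "(f has_vector_derivative f') (at t)"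
  shows "((\<lambda>t. (cmod (f t))\<^sup>2) has_real_derivative 2 * Re (cnj (f t) * f')) (at t)"
proof -
  have d: "((\<lambda>t. Re (f t)) has_real_derivative Re f') (at t)" "((\<lambda>t. Im (f t)) has_real_derivative Im f') (at t)"
    unfolding has_real_derivative_iff_has_vector_derivative
    using assms by (auto intro: bounded_linear.has_vector_derivative[OF bounded_linear_Re] bounded_linear.has_vector_derivative[OF bounded_linear_Im])
  have "((\<lambda>t. (Re (f t))\<^sup>2 + (Im (f t))\<^sup>2) has_real_derivative 2 * Re (cnj (f t) * f')) (at t)"
    using DERIV_add[OF DERIV_mult[OF d(1) d(1)] DERIV_mult[OF d(2) d(2)]] by (simp add: power2_eq_square algebra_simps)
  then show ?thesis by (simp add: cmod_power2)
qed

context cqnls_decay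
begin

text \<open>Cut-off at radius k + 1, where the successor avoids division by zero. The mass current
  contains a gradient without known pointwise decay, so the potential energy is localized before
  integrating by parts.\<close>

definition phi :: "nat \<Rightarrow> real ^ 'n \<Rightarrow> real" where
  "phi k x = bump ((1 / real (Suc k)) *\<^sub>R x)"

definition phi1 :: "nat \<Rightarrow> 'n \<Rightarrow> real ^ 'n \<Rightarrow> real" where
  "phi1 k j x = (1 / real (Suc k)) * bump1 j ((1 / real (Suc k)) *\<^sub>R x)"

lemma phi_cont: "continuous_on A a \<Longrightarrow> continuous_on A (\<lambda>y. phi k (a y))" "continuous_on A a \<Longrightarrow> continuous_on A (\<lambda>y. phi1 k j (a y))"
  unfolding phi_def phi1_def
  by (intro continuous_intros continuous_on_compose2[OF continuous_bump(1)[of UNIV]] continuous_on_compose2[OF continuous_bump(2)[of UNIV]]; simp)+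

lemma phi_support: "norm x \<ge> real (Suc k) \<Longrightarrow> phi k x = 0" "norm x \<ge> real (Suc k) \<Longrightarrow> phi1 k j x = 0"
proof -
  assume "norm x \<ge> real (Suc k)"
  then have "norm ((1 / real (Suc k)) *\<^sub>R x) \<ge> 1" by (simp add: field_simps)
  then show "phi k x = 0" "phi1 k j x = 0" unfolding phi_def phi1_def by (simp_all only: bump_support mult_zero_right)
qed

lemma phi_derivative: "((\<lambda>s. phi k (sh j s x)) has_vector_derivative phi1 k j x) (at 0)"
proof -
  let ?r = "1 / real (Suc k)"
  have "((\<lambda>r. bump (?r *\<^sub>R x + r *\<^sub>R axis j 1)) \<circ> (\<lambda>s. ?r * s) has_vector_derivative ?r *\<^sub>R bump1 j (?r *\<^sub>R x + (?r * 0) *\<^sub>R axis j 1)) (at 0)"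
    by (rule vector_diff_chain_at[OF _ has_vector_derivative_line[OF bump_derivative(1)]])
       (auto intro!: derivative_eq_intros simp flip: has_real_derivative_iff_has_vector_derivative)
  then show ?thesis by (simp add: phi_def phi1_def o_def scaleR_add_right)
qed

lemma bump_bounds: "0 \<le> bump z" "bump z \<le> 1" "\<bar>bump1 j (z :: real ^ 'n)\<bar> \<le> 6"
proof -
  have m: "0 \<le> max 0 (1 - z \<bullet> z)" "max 0 (1 - z \<bullet> z) \<le> 1" by auto
  show "0 \<le> bump z" "bump z \<le> 1" unfolding bump_def using m by (auto intro: power_le_one)
  show "\<bar>bump1 j z\<bar> \<le> 6"
  proof (cases "norm z \<ge> 1")
    case False
    have "\<bar>z $ j\<bar> \<le> 1" using component_le_norm_cart[of z j] False by simp
    moreover have "max 0 (1 - z \<bullet> z) ^ 2 \<le> 1" using m by (intro power_le_one)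
    ultimately have "\<bar>z $ j\<bar> * max 0 (1 - z \<bullet> z) ^ 2 \<le> 1 * 1" by (intro mult_mono) auto
    then show ?thesis by (simp add: bump1_def abs_mult)
  qed (simp add: bump_support)
qed

lemma phi_bounds: "0 \<le> phi k x" "phi k x \<le> 1" "\<bar>phi1 k j x\<bar> \<le> 6 / real (Suc k)" "\<bar>phi1 k j x\<bar> \<le> 6"
proof -
  show "0 \<le> phi k x" "phi k x \<le> 1" unfolding phi_def by (rule bump_bounds)+
  have "\<bar>phi1 k j x\<bar> = (1 / real (Suc k)) * \<bar>bump1 j ((1 / real (Suc k)) *\<^sub>R x)\<bar>" by (simp add: phi1_def abs_mult)
  also have "\<dots> \<le> (1 / real (Suc k)) * 6" by (intro mult_left_mono bump_bounds) simp
  finally show 1: "\<bar>phi1 k j x\<bar> \<le> 6 / real (Suc k)" by simp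
  have "6 / real (Suc k) \<le> 6" by (simp add: divide_le_eq)
  with 1 show "\<bar>phi1 k j x\<bar> \<le> 6" by linarith
qed

lemma phi_limits: "(\<lambda>k. phi k x) \<longlonglongrightarrow> 1" "(\<lambda>k. phi1 k j x) \<longlonglongrightarrow> 0"
proof -
  have r: "(\<lambda>k. 1 / real (Suc k)) \<longlonglongrightarrow> 0" by (rule LIMSEQ_Suc[OF lim_1_over_n])
  have "isCont (\<lambda>r. bump (r *\<^sub>R x)) 0"
    using continuous_on_compose2[OF continuous_bump(1)[of UNIV], of UNIV "\<lambda>r. r *\<^sub>R x"]
    by (simp add: continuous_on_eq_continuous_at continuous_intros)
  from isCont_tendsto_compose[OF this r] show "(\<lambda>k. phi k x) \<longlonglongrightarrow> 1"
    by (simp add: phi_def bump_def)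
  have "(\<lambda>k. 6 * (1 / real (Suc k))) \<longlonglongrightarrow> 6 * 0" by (intro tendsto_mult tendsto_const r)
  then show "(\<lambda>k. phi1 k j x) \<longlonglongrightarrow> 0"
    by (intro Lim_null_comparison[of "\<lambda>k. phi1 k j x" "\<lambda>k. 6 * (1 / real (Suc k))"]) (use phi_bounds(3) in auto)
qed

text \<open>The \<open>j\<close>-th space derivative of g(u), written out by the chain rule;
  \<open>cur\<close> below is the mass current.\<close>

definition dg :: "'n \<Rightarrow> real \<Rightarrow> real ^ 'n \<Rightarrow> real" where
  "dg j t x = (l1 - 2 * l2 * (cmod (u t x))\<^sup>2) * (2 * Re (cnj (u t x) * du j t x))"

definition cur :: "'n \<Rightarrow> real \<Rightarrow> real ^ 'n \<Rightarrow> real" where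
  "cur j t x = Im (cnj (u t x) * du j t x)"

lemma gz_chain:
  assumes "(f has_vector_derivative f') (at t)"
  shows "((\<lambda>t. gz (f t)) has_real_derivative (l1 - 2 * l2 * (cmod (f t))\<^sup>2) * (2 * Re (cnj (f t) * f'))) (at t)"
    and "((\<lambda>t. Gz (f t)) has_real_derivative gz (f t) * (2 * Re (cnj (f t) * f'))) (at t)"
proof -
  have p: "cmod z ^ 4 = ((cmod z)\<^sup>2) ^ 2" "cmod z ^ 6 = ((cmod z)\<^sup>2) ^ 3" for z by (simp_all flip: power_mult)
  note d = cmod2_derivative[OF assms]
  define R where "R = 2 * Re (cnj (f t) * f')"
  show "((\<lambda>t. gz (f t)) has_real_derivative (l1 - 2 * l2 * (cmod (f t))\<^sup>2) * (2 * Re (cnj (f t) * f'))) (at t)"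
    unfolding gz_def p by (rule derivative_eq_intros d refl)+ (fold R_def, simp add: algebra_simps)
  show "((\<lambda>t. Gz (f t)) has_real_derivative gz (f t) * (2 * Re (cnj (f t) * f'))) (at t)"
    unfolding Gz_def gz_def p by (rule derivative_eq_intros d refl)+ (fold R_def, simp add: field_simps)
qed

lemma u_cont2: "continuous_on A a \<Longrightarrow> continuous_on A b \<Longrightarrow> continuous_on A (\<lambda>y. u (a y) (b y))"
  using continuous_on_compose2[OF u_cont continuous_on_Pair] by fastforce

lemma ut_cont2: "continuous_on A a \<Longrightarrow> continuous_on A b \<Longrightarrow> continuous_on A (\<lambda>y. ut (a y) (b y))"
  using continuous_on_compose2[OF ut_cont continuous_on_Pair] by fastforce

lemma gz_cont: "continuous_on A f \<Longrightarrow> continuous_on A (\<lambda>y. gz (f y))" "continuous_on A f \<Longrightarrow> continuous_on A (\<lambda>y. Gz (f y))"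
  unfolding gz_def Gz_def by (intro continuous_intros; assumption)+

lemma dg_cont: "continuous_on UNIV (dg j t)" "continuous_on UNIV (cur j t)"
  unfolding dg_def cur_def by (intro continuous_intros u_space_cont)+

lemma phi_edec:
  fixes X :: "'p::euclidean_space \<Rightarrow> real ^ 'n \<Rightarrow> real"
  assumes "continuous_on UNIV (\<lambda>y. X (fst y) (snd y))"
  shows "edec (\<lambda>p x. phi k x * X p x)" "edec (\<lambda>p x. phi1 k j x * X p x)"
  by (rule edec_compact_support[where R = "real (Suc k)"];
      simp add: case_prod_beta' phi_support del: of_nat_Suc;
      intro continuous_intros phi_cont assms)+

definition P :: "nat \<Rightarrow> real \<Rightarrow> real" where
  "P k t = (LBINT x. phi k x * Gz (u t x))"

abbreviation Jd :: "nat \<Rightarrow> 'n \<Rightarrow> real \<Rightarrow> real ^ 'n \<Rightarrow> real" where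
  "Jd k j t x \<equiv> phi1 k j x * (gz (u t x) * cur j t x) + phi k x * (dg j t x * cur j t x)"

definition J :: "nat \<Rightarrow> 'n \<Rightarrow> real \<Rightarrow> real" where
  "J k j t = (LBINT x. Jd k j t x)"

text \<open>By the continuity equation, the density |u|^2 changes at the rate of minus twice the
  divergence of the current; integration by parts moves the divergence to the product of the cut-off
  and g(u), whose gradient tested against the current is \<open>J\<close>.\<close>

lemma P_derivative: "(P k has_real_derivative (\<Sum>j\<in>UNIV. 2 * J k j t)) (at t)"
proof -
  \<comment> \<open>The \<open>j\<close>-th term of the divergence of the current: the other part of
    the product rule is real.\<close>
  let ?c = "\<lambda>j x. Im (cnj (u t x) * ddu j t x)"
  have c1: "continuous_on UNIV (?c j)" for j by (intro continuous_intros u_space_cont)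
  have ed: "edec (\<lambda>_::real. \<lambda>x. phi k x * X x)" "edec (\<lambda>_::real. \<lambda>x. phi1 k j x * X x)" if "continuous_on UNIV X" for X j
    using continuous_on_compose2[OF that continuous_on_snd[OF continuous_on_id], of "UNIV :: (real \<times> (real ^ 'n)) set"]
    by (intro phi_edec; simp)+
  have cg: "continuous_on UNIV (\<lambda>x. gz (u t x) * cur j t x)" "continuous_on UNIV (\<lambda>x. dg j t x * cur j t x)"
     "continuous_on UNIV (\<lambda>x. gz (u t x) * ?c j x)" for j
    by (intro continuous_intros gz_cont u_space_cont dg_cont)+
  have parts: "(LBINT x. phi k x * (gz (u t x) * ?c j x)) = - J k j t" for j
  proof -
    have "(LBINT x. Jd k j t x + phi k x * (gz (u t x) * ?c j x)) = 0"
    proof (rule integral_line_derivative_zero[where e = "axis j 1"])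
      show "edec (\<lambda>_::real. \<lambda>x. phi k x * (gz (u t x) * cur j t x))" by (intro ed cg)
      show "edec (\<lambda>_::real. \<lambda>x. Jd k j t x + phi k x * (gz (u t x) * ?c j x))"
        by (intro edec_add ed cg)
      fix x
      let ?x = "\<lambda>s. x + s *\<^sub>R axis j (1::real)"
      have 1: "((\<lambda>s. phi k (?x s)) has_real_derivative phi1 k j x) (at 0)"
        using phi_derivative by (simp add: has_real_derivative_iff_has_vector_derivative)
      have 2: "((\<lambda>s. gz (u t (?x s))) has_real_derivative dg j t x) (at 0)"
        using gz_chain(1)[OF du] by (simp add: dg_def)
      have "((\<lambda>s. cnj (u t (?x s)) * du j t (?x s)) has_vector_derivative cnj (u t (?x 0)) * ddu j t x + cnj (du j t x) * du j t (?x 0)) (at 0)"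
        by (intro has_vector_derivative_mult has_vector_derivative_cnj du ddu)
      then have "((\<lambda>s. cur j t (?x s)) has_vector_derivative Im (cnj (u t (?x 0)) * ddu j t x + cnj (du j t x) * du j t (?x 0))) (at 0)"
        unfolding cur_def by (rule bounded_linear.has_vector_derivative[OF bounded_linear_Im])
      then have 3: "((\<lambda>s. cur j t (?x s)) has_real_derivative ?c j x) (at 0)"
        by (simp add: has_real_derivative_iff_has_vector_derivative mult.commute)
      show "((\<lambda>s. phi k (?x s) * (gz (u t (?x s)) * cur j t (?x s))) has_vector_derivative
         Jd k j t x + phi k x * (gz (u t x) * ?c j x)) (at 0)"
        using DERIV_mult[OF 1 DERIV_mult[OF 2 3]]
        by (simp add: has_real_derivative_iff_has_vector_derivative[symmetric] algebra_simps)
    qed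
    then have "J k j t + (LBINT x. phi k x * (gz (u t x) * ?c j x)) = 0"
      unfolding J_def
      using edec_integrable[OF edec_add[OF ed(2)[OF cg(1)] ed(1)[OF cg(2)]]] edec_integrable[OF ed(1)[OF cg(3)]]
      by simp
    then show ?thesis by simp
  qed
  have "(P k has_vector_derivative (LBINT x. phi k x * (gz (u t x) * (2 * Re (cnj (u t x) * ut t x))))) (at t)"
    unfolding P_def[abs_def]
  proof (rule edec_has_vector_derivative_integral)
    show "edec (\<lambda>t x. phi k x * Gz (u t x))"
      by (intro phi_edec gz_cont u_cont2 continuous_intros)
    show "edec (\<lambda>t x. phi k x * (gz (u t x) * (2 * Re (cnj (u t x) * ut t x))))"
      by (intro phi_edec continuous_intros gz_cont u_cont2 ut_cont2)
    show "((\<lambda>t. phi k x * Gz (u t x)) has_vector_derivative phi k x * (gz (u t x) * (2 * Re (cnj (u t x) * ut t x)))) (at t)" for t x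
      using DERIV_cmult[OF gz_chain(2)[OF ut]] by (simp add: has_real_derivative_iff_has_vector_derivative)
  qed
  moreover have "(LBINT x. phi k x * (gz (u t x) * (2 * Re (cnj (u t x) * ut t x)))) = (\<Sum>j\<in>UNIV. 2 * J k j t)"
  proof -
    \<comment> \<open>The nonlinear term drops out because cnj(u) F is real.\<close>
    have "Re (cnj (u t x) * ut t x) = - (\<Sum>j\<in>UNIV. ?c j x)" for x
    proof -
      have "\<i> * ut t x = F t x - (\<Sum>j\<in>UNIV. ddu j t x)"
        using eqn[of t x] by (simp add: F_def gz_def laplacian_def algebra_simps)
      then have "Im (cnj (u t x) * (\<i> * ut t x)) = Im (cnj (u t x) * F t x) - (\<Sum>j\<in>UNIV. ?c j x)"
        by (simp only: right_diff_distrib sum_distrib_left minus_complex.sel Im_sum)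
      moreover have "Im (cnj (u t x) * F t x) = 0" by (simp add: F_def)
      moreover have "Im (cnj (u t x) * (\<i> * ut t x)) = Re (cnj (u t x) * ut t x)" by simp
      ultimately show ?thesis by simp
    qed
    moreover have "a * (b * (2 * - (\<Sum>j\<in>UNIV. c j))) = (\<Sum>j\<in>UNIV. - 2 * (a * (b * c j)))" for a b :: real and c :: "'n \<Rightarrow> real"
      unfolding sum_negf[symmetric] sum_distrib_left by (intro sum.cong refl) simp
    ultimately have "phi k x * (gz (u t x) * (2 * Re (cnj (u t x) * ut t x))) = (\<Sum>j\<in>UNIV. - 2 * (phi k x * (gz (u t x) * ?c j x)))" for x
      by (simp only:)
    then have "(LBINT x. phi k x * (gz (u t x) * (2 * Re (cnj (u t x) * ut t x)))) = (\<Sum>j\<in>UNIV. - 2 * (LBINT x. phi k x * (gz (u t x) * ?c j x)))"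
      using edec_integrable[OF ed(1)[OF cg(3)]]
      by (simp only:) (subst Bochner_Integration.integral_sum, auto)
    then show ?thesis unfolding parts by simp
  qed
  ultimately show ?thesis by (simp add: has_real_derivative_iff_has_vector_derivative)
qed

end

subsection \<open>Energy and virial identity\<close>

text \<open>A window of one period on which the quadratic bound holds; energies are compared with
  the one at its left end \<open>T\<close>.\<close>

locale cqnls_window = cqnls_decay l1 l2 \<tau> u ut
  for l1 l2 \<tau> :: real and u ut :: "real \<Rightarrow> real ^ 'n::finite \<Rightarrow> complex" +
  fixes T s0 M :: real
  assumes s0: "0 < s0" and Mpos: "M > 0"
    and Q_le: "\<And>j t s. 0 \<le> s \<Longrightarrow> s \<le> s0 \<Longrightarrow> T \<le> t \<Longrightarrow> t \<le> T + \<tau> \<Longrightarrow> Q j s t \<le> M * s\<^sup>2"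
begin

definition sk :: "nat \<Rightarrow> real" where "sk k = s0 / real (Suc k)"

lemma sk: "sk k > 0" "sk k \<le> s0" "sk \<longlonglongrightarrow> 0"
proof -
  show "sk k > 0" "sk k \<le> s0" using s0 by (simp_all add: sk_def divide_le_eq)
  have "(\<lambda>k. s0 * (1 / real (Suc k))) \<longlonglongrightarrow> s0 * 0" by (intro tendsto_mult tendsto_const LIMSEQ_Suc[OF lim_1_over_n])
  then show "sk \<longlonglongrightarrow> 0" by (simp add: sk_def[abs_def])
qed

lemma quotient_le: "t \<in> per T \<Longrightarrow> Q j (sk k) t / (sk k)\<^sup>2 \<le> M"
  using Q_le[where s = "sk k" and t = t and j = j] sk(1,2)[of k] by (simp add: pos_divide_le_eq)

lemma dq:
  assumes "t \<in> per T"
  shows "difference_quotient (u t) (du j t) (axis j 1) sk M"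
proof
  show "(LBINT x. (cmod (u t (sh j (sk k) x) - u t x))\<^sup>2) \<le> M * (sk k)\<^sup>2" for k
    using Q_le[where s = "sk k" and t = t and j = j] sk(1,2)[of k] assms by (simp add: Q_def)
qed (use u_space_cont du sk integrable_Q in auto)

definition Kin :: "'n \<Rightarrow> real \<Rightarrow> real" where
  "Kin j t = (LBINT x. (cmod (du j t x))\<^sup>2)"

definition mass :: "real \<Rightarrow> real" where
  "mass t = (LBINT x. (cmod (u t x))\<^sup>2)"

definition Gtot :: "real \<Rightarrow> real" where
  "Gtot t = (LBINT x. Gz (u t x))"

definition Gabs :: "real \<Rightarrow> real" where
  "Gabs t = (LBINT x. \<bar>Gz (u t x)\<bar>)"

lemma mass_edec: "edec (\<lambda>t x. (cmod (u t x))\<^sup>2)"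
  by (intro edec_power edec_norm edec_u) simp

lemma Gabs_edec: "edec (\<lambda>t x. \<bar>Gz (u t x)\<bar>)"
  using edec_norm[OF edec_gz(2)[OF edec_u]] by simp

lemma tot_cont: "continuous_on A mass" "continuous_on A Gtot" "continuous_on A Gabs"
  unfolding mass_def Gtot_def Gabs_def
  by (intro edec_continuous_integral mass_edec Gabs_edec edec_gz edec_u)+

lemma Q_quotient_limit:
  assumes "t \<in> per T"
  shows "(\<lambda>k. Q j (sk k) t / (sk k)\<^sup>2) \<longlonglongrightarrow> Kin j t"
  unfolding Q_def Kin_def by (rule difference_quotient.quotient_norm_limit[OF dq[OF assms]])

text \<open>Each of the two factors of the integrand is of first order in the shift, and their
  product is dominated by the squared quotient. The limit coincides with that of \<open>J\<close>,
  so that the exchange between kinetic and potential energy cancels.\<close>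

lemma K_quotient_limit:
  assumes t: "t \<in> per T"
  shows "(\<lambda>k. K j (sk k) t / (sk k)\<^sup>2) \<longlonglongrightarrow> (LBINT x. dg j t x * cur j t x)"
proof -
  interpret D: difference_quotient "u t" "du j t" "axis j 1" sk M by (rule dq[OF t])
  obtain M0 where M0: "M0 > 0" "\<And>t x. cmod (u t x) \<le> M0" using u_bound by blast
  let ?b = "\<lambda>k x. u t (sh j (sk k) x)"
  have "(\<lambda>k. LBINT x. ((gz (?b k x) - gz (u t x)) * Im (?b k x * cnj (u t x))) / (sk k)\<^sup>2) \<longlonglongrightarrow> (LBINT x. dg j t x * cur j t x)"
  proof (rule D.quadratic_limit[where c = "(\<bar>l1\<bar> + 2 * \<bar>l2\<bar> * M0\<^sup>2) * (2 * M0\<^sup>2)"])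
    show "(\<lambda>x. ((gz (?b k x) - gz (u t x)) * Im (?b k x * cnj (u t x))) / (sk k)\<^sup>2) \<in> borel_measurable lborel" for k
      using borel_measurable_integrable[OF integrable_K] by (intro borel_measurable_divide) auto
    show "(\<lambda>x. dg j t x * cur j t x) \<in> borel_measurable lborel"
      using continuous_on_mult[OF dg_cont, of j t j t] by (simp add: borel_measurable_continuous_onI)
    show "0 \<le> (\<bar>l1\<bar> + 2 * \<bar>l2\<bar> * M0\<^sup>2) * (2 * M0\<^sup>2)" by simp
    fix k x
    have "\<bar>(gz (?b k x) - gz (u t x)) * Im (?b k x * cnj (u t x)) / (sk k)\<^sup>2\<bar> = \<bar>(gz (?b k x) - gz (u t x)) * Im (?b k x * cnj (u t x))\<bar> / (sk k)\<^sup>2"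
      unfolding abs_divide by simp
    also have "\<dots> \<le> ((\<bar>l1\<bar> + 2 * \<bar>l2\<bar> * M0\<^sup>2) * (2 * M0\<^sup>2)) * (cmod (?b k x - u t x))\<^sup>2 / (sk k)\<^sup>2"
      by (intro divide_right_mono gz_Im_bound M0) simp
    finally show "\<bar>(gz (?b k x) - gz (u t x)) * Im (?b k x * cnj (u t x)) / (sk k)\<^sup>2\<bar>
       \<le> ((\<bar>l1\<bar> + 2 * \<bar>l2\<bar> * M0\<^sup>2) * (2 * M0\<^sup>2)) * ((cmod (?b k x - u t x))\<^sup>2 / (sk k)\<^sup>2)" by simp
  next
    fix x
    have "((\<lambda>s. gz (u t (sh j s x))) has_vector_derivative dg j t x) (at 0)"
      using gz_chain(1)[OF du] by (simp add: dg_def has_real_derivative_iff_has_vector_derivative)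
    then have "(\<lambda>s. (gz (u t (sh j s x)) - gz (u t (x + 0 *\<^sub>R axis j 1))) /\<^sub>R (s - 0)) \<midarrow>0\<rightarrow> dg j t x"
      unfolding has_vector_derivative_iff_quotient .
    moreover have "\<forall>k. sk k \<in> UNIV - {0}" using sk(1) by (simp add: less_imp_neq[symmetric])
    ultimately have "((\<lambda>s. (gz (u t (sh j s x)) - gz (u t (x + 0 *\<^sub>R axis j 1))) /\<^sub>R (s - 0)) \<circ> sk) \<longlonglongrightarrow> dg j t x"
      using sk(3) unfolding tendsto_at_iff_sequentially by blast
    then have 1: "(\<lambda>k. (gz (?b k x) - gz (u t x)) / sk k) \<longlonglongrightarrow> dg j t x"
      by (simp add: o_def divide_inverse_commute)
    have "(\<lambda>k. Im (cnj (u t x) * ((?b k x - u t x) /\<^sub>R sk k))) \<longlonglongrightarrow> cur j t x"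
      unfolding cur_def by (intro tendsto_intros D.quotient_limit)
    moreover have "Im (cnj (u t x) * ((?b k x - u t x) /\<^sub>R sk k)) = Im (?b k x * cnj (u t x)) / sk k" for k
      by (simp add: divide_inverse algebra_simps)
    ultimately have 2: "(\<lambda>k. Im (?b k x * cnj (u t x)) / sk k) \<longlonglongrightarrow> cur j t x" by simp
    show "(\<lambda>k. (gz (?b k x) - gz (u t x)) * Im (?b k x * cnj (u t x)) / (sk k)\<^sup>2) \<longlonglongrightarrow> dg j t x * cur j t x"
      using tendsto_mult[OF 1 2] by (simp add: power2_eq_square del: times_complex.sel)
  qed
  then show ?thesis by (simp add: K_def)
qed

text \<open>The bound is uniform in \<open>k\<close> and depends on time only through the continuous
  function \<open>mass\<close>, as dominated convergence in time requires. In the limit the gradient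
  of the cut-off disappears.\<close>

lemma J_limit_bound:
  obtains c where "c > 0" "\<And>j t k. t \<in> per T \<Longrightarrow> \<bar>J k j t\<bar> \<le> c * (mass t + M)"
    "\<And>j t. t \<in> per T \<Longrightarrow> (\<lambda>k. J k j t) \<longlonglongrightarrow> (LBINT x. dg j t x * cur j t x)"
proof -
  obtain M0 where M0: "M0 > 0" "\<And>t x. cmod (u t x) \<le> M0" using u_bound by blast
  define Cg where "Cg = \<bar>l1\<bar> * M0\<^sup>2 + \<bar>l2\<bar> * M0 ^ 4"
  define Cd where "Cd = 2 * (\<bar>l1\<bar> + 2 * \<bar>l2\<bar> * M0\<^sup>2)"
  \<comment> \<open>6 bounds the derivative of the cut-off, \<open>Cg\<close> bounds g(u), and
    \<open>Cd * M0\<^sup>2\<close> bounds the coefficient of the squared gradient in the product of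
    \<open>dg\<close> and \<open>cur\<close>.\<close>
  define c where "c = 6 * Cg + Cd * M0\<^sup>2"
  have Cg0: "Cg \<ge> 0" and Cd0: "Cd \<ge> 0" by (simp_all add: Cg_def Cd_def)
  have gzb: "\<bar>gz (u t x)\<bar> \<le> Cg" for t x
  proof -
    have "\<bar>gz (u t x)\<bar> \<le> \<bar>l1\<bar> * (cmod (u t x))\<^sup>2 + \<bar>l2\<bar> * cmod (u t x) ^ 4"
      unfolding gz_def using abs_triangle_ineq4[of "l1 * (cmod (u t x))\<^sup>2" "l2 * cmod (u t x) ^ 4"] by (simp add: abs_mult)
    also have "\<dots> \<le> Cg" unfolding Cg_def by (intro add_mono mult_left_mono power_mono M0) auto
    finally show ?thesis .
  qed
  have dgb: "\<bar>dg j t x\<bar> \<le> Cd * (cmod (u t x) * cmod (du j t x))" for j t x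
  proof -
    have "\<bar>l1 - 2 * l2 * (cmod (u t x))\<^sup>2\<bar> \<le> \<bar>l1\<bar> + 2 * \<bar>l2\<bar> * (cmod (u t x))\<^sup>2"
      using abs_triangle_ineq4[of l1 "2 * l2 * (cmod (u t x))\<^sup>2"] by (simp add: abs_mult)
    also have "\<dots> \<le> \<bar>l1\<bar> + 2 * \<bar>l2\<bar> * M0\<^sup>2"
      by (intro add_left_mono mult_left_mono power_mono M0) auto
    finally have "\<bar>l1 - 2 * l2 * (cmod (u t x))\<^sup>2\<bar> \<le> \<bar>l1\<bar> + 2 * \<bar>l2\<bar> * M0\<^sup>2" .
    moreover have "\<bar>2 * Re (cnj (u t x) * du j t x)\<bar> \<le> 2 * (cmod (u t x) * cmod (du j t x))"
      using abs_Re_le_cmod[of "cnj (u t x) * du j t x"] by (simp only: abs_mult norm_mult complex_mod_cnj)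
    ultimately have "\<bar>dg j t x\<bar> \<le> (\<bar>l1\<bar> + 2 * \<bar>l2\<bar> * M0\<^sup>2) * (2 * (cmod (u t x) * cmod (du j t x)))"
      unfolding dg_def abs_mult[of "l1 - _"] by (intro mult_mono) auto
    then show ?thesis by (simp only: Cd_def mult_ac)
  qed
  have curb: "\<bar>cur j t x\<bar> \<le> cmod (u t x) * cmod (du j t x)" for j t x
    unfolding cur_def using abs_Im_le_cmod[of "cnj (u t x) * du j t x"] by (simp only: norm_mult complex_mod_cnj)
  let ?w = "\<lambda>j t x. c * ((cmod (u t x))\<^sup>2 + (cmod (du j t x))\<^sup>2)"
  have pw: "\<bar>Jd k j t x\<bar> \<le> ?w j t x" for k j t x
  proof -
    let ?a = "cmod (u t x)" and ?d = "cmod (du j t x)"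
    have ad: "?a * ?d \<le> ?a\<^sup>2 + ?d\<^sup>2"
    proof -
      have "0 \<le> ?a * ?d" by simp
      moreover have "2 * (?a * ?d) \<le> ?a\<^sup>2 + ?d\<^sup>2" using sum_squares_bound[of ?a ?d] by (simp only: mult.assoc)
      ultimately show ?thesis by linarith
    qed
    have "\<bar>phi1 k j x * (gz (u t x) * cur j t x)\<bar> \<le> 6 * (Cg * (?a * ?d))"
      unfolding abs_mult[of "phi1 k j x"] abs_mult[of "gz (u t x)"]
      by (intro mult_mono phi_bounds gzb curb) (use Cg0 in auto)
    also have "\<dots> \<le> 6 * (Cg * (?a\<^sup>2 + ?d\<^sup>2))" using ad Cg0 by (intro mult_left_mono) auto
    finally have 1: "\<bar>phi1 k j x * (gz (u t x) * cur j t x)\<bar> \<le> 6 * (Cg * (?a\<^sup>2 + ?d\<^sup>2))" .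
    have "\<bar>phi k x * (dg j t x * cur j t x)\<bar> \<le> 1 * ((Cd * (?a * ?d)) * (?a * ?d))"
      unfolding abs_mult[of "phi k x"] abs_mult[of "dg j t x"]
      by (intro mult_mono dgb curb) (use phi_bounds(1,2)[of k x] Cd0 in auto)
    also have "\<dots> = (Cd * ?a\<^sup>2) * ?d\<^sup>2" by (simp add: power2_eq_square)
    also have "\<dots> \<le> (Cd * M0\<^sup>2) * (?a\<^sup>2 + ?d\<^sup>2)"
      by (intro mult_mono mult_left_mono power_mono M0) (use Cd0 in auto)
    finally have 2: "\<bar>phi k x * (dg j t x * cur j t x)\<bar> \<le> (Cd * M0\<^sup>2) * (?a\<^sup>2 + ?d\<^sup>2)" .
    have "?w j t x = 6 * (Cg * (?a\<^sup>2 + ?d\<^sup>2)) + (Cd * M0\<^sup>2) * (?a\<^sup>2 + ?d\<^sup>2)"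
      by (simp only: c_def distrib_right mult.assoc)
    with 1 2 show ?thesis by linarith
  qed
  have iu: "integrable lborel (\<lambda>x. (cmod (u t x))\<^sup>2)" for t by (rule edec_integrable[OF mass_edec])
  have idu: "integrable lborel (\<lambda>x. (cmod (du j t x))\<^sup>2)" "(LBINT x. (cmod (du j t x))\<^sup>2) \<le> M" if "t \<in> per T" for j t
    by (rule difference_quotient.v1_square_integrable[OF dq[OF that]], rule difference_quotient.v1_norm_bound[OF dq[OF that]])
  have iw: "integrable lborel (?w j t)" if "t \<in> per T" for j t
    by (intro integrable_mult_right Bochner_Integration.integrable_add iu idu that)
  have mF: "(Jd k j t) \<in> borel_measurable lborel" for k j t
  proof -
    have "continuous_on UNIV (Jd k j t)"
      by (intro continuous_intros phi_cont gz_cont u_space_cont dg_cont)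
    then show ?thesis by (simp add: borel_measurable_continuous_onI)
  qed
  have mL: "(\<lambda>x. dg j t x * cur j t x) \<in> borel_measurable lborel" for j t
    using continuous_on_mult[OF dg_cont, of j t j t] by (simp add: borel_measurable_continuous_onI)
  show ?thesis
  proof (rule that[of "c + 1"])
    show "c + 1 > 0" using Cg0 Cd0 by (simp add: c_def add_nonneg_pos)
    fix j t assume t: "t \<in> per T"
    have iF: "integrable lborel (Jd k j t)" for k
      by (rule Bochner_Integration.integrable_bound[OF iw[OF t, of j] mF]) (use pw[of k j _ t] in \<open>auto intro!: AE_I2 order_trans[OF _ abs_ge_self]\<close>)
    have m0: "mass t \<ge> 0" unfolding mass_def by (intro Bochner_Integration.integral_nonneg) auto
    show "\<bar>J k j t\<bar> \<le> (c + 1) * (mass t + M)" for k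
    proof -
      have "norm (J k j t) \<le> (LBINT x. ?w j t x)"
        unfolding J_def by (rule Bochner_Integration.integral_norm_bound_integral[OF iF iw[OF t]]) (use pw in simp)
      also have "\<dots> = c * (mass t + Kin j t)"
        using iu[of t] idu(1)[OF t] by (simp add: mass_def Kin_def)
      also have "\<dots> \<le> (c + 1) * (mass t + M)"
        using idu(2)[OF t, of j] m0 Mpos Cg0 Cd0 by (intro mult_mono add_left_mono) (auto simp: Kin_def c_def)
      finally show ?thesis by simp
    qed
    show "(\<lambda>k. J k j t) \<longlonglongrightarrow> (LBINT x. dg j t x * cur j t x)"
      unfolding J_def
    proof (rule integral_dominated_convergence[where w = "?w j t", OF mL mF iw[OF t]])
      show "AE x in lborel. (\<lambda>k. Jd k j t x) \<longlonglongrightarrow> dg j t x * cur j t x"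
      proof (rule AE_I2)
        fix x
        have "(\<lambda>k. Jd k j t x) \<longlonglongrightarrow> 0 * (gz (u t x) * cur j t x) + 1 * (dg j t x * cur j t x)"
          by (intro tendsto_intros phi_limits)
        then show "(\<lambda>k. Jd k j t x) \<longlonglongrightarrow> dg j t x * cur j t x" by simp
      qed
    qed (use pw in auto)
  qed
qed

text \<open>Regularized energy: difference quotients for the kinetic part, a cut-off for the
  potential part. Both are known to be differentiable in time, which is not clear for the gradient
  norm.\<close>

definition W :: "nat \<Rightarrow> real \<Rightarrow> real" where
  "W k t = (\<Sum>j\<in>UNIV. Q j (sk k) t / (sk k)\<^sup>2) + P k t"

lemma W_derivative:
  "(W k has_real_derivative (\<Sum>j\<in>UNIV. - 2 * (K j (sk k) t / (sk k)\<^sup>2) + 2 * J k j t)) (at t)"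
proof -
  have "((\<lambda>t. Q j (sk k) t / (sk k)\<^sup>2) has_real_derivative - 2 * (K j (sk k) t / (sk k)\<^sup>2)) (at t)" for j
    using DERIV_cdivide[OF Q_derivative[of j "sk k" t], where c = "(sk k)\<^sup>2"] by simp
  then show ?thesis unfolding W_def[abs_def] sum.distrib
    by (intro DERIV_add DERIV_sum P_derivative)
qed

lemma P_le: "\<bar>P k t\<bar> \<le> Gabs t"
proof -
  have "norm (P k t) \<le> (LBINT x. \<bar>Gz (u t x)\<bar>)"
    unfolding P_def
  proof (rule Bochner_Integration.integral_norm_bound_integral)
    show "integrable lborel (\<lambda>x. phi k x * Gz (u t x))"
      by (rule edec_integrable[where f = "\<lambda>t x. phi k x * Gz (u t x)"]) (intro phi_edec gz_cont u_cont2 continuous_intros)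
    show "integrable lborel (\<lambda>x. \<bar>Gz (u t x)\<bar>)" by (rule edec_integrable[OF Gabs_edec])
    show "norm (phi k x * Gz (u t x)) \<le> \<bar>Gz (u t x)\<bar>" for x
      using phi_bounds(1,2)[of k x] by (simp add: abs_mult mult_left_le_one_le)
  qed
  then show ?thesis by (simp add: Gabs_def)
qed

lemma P_limit: "(\<lambda>k. P k t) \<longlonglongrightarrow> Gtot t"
  unfolding P_def Gtot_def
proof (rule integral_dominated_convergence[where w = "\<lambda>x. \<bar>Gz (u t x)\<bar>"])
  show "(\<lambda>x. Gz (u t x)) \<in> borel_measurable lborel"
    by (rule edec_measurable[OF edec_gz(2)[OF edec_u]])
  show "(\<lambda>x. phi k x * Gz (u t x)) \<in> borel_measurable lborel" for k
    by (rule edec_measurable[where f = "\<lambda>t x. phi k x * Gz (u t x)"]) (intro phi_edec gz_cont u_cont2 continuous_intros)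
  show "integrable lborel (\<lambda>x. \<bar>Gz (u t x)\<bar>)" by (rule edec_integrable[OF Gabs_edec])
  show "AE x in lborel. (\<lambda>k. phi k x * Gz (u t x)) \<longlonglongrightarrow> Gz (u t x)"
    using tendsto_mult[OF phi_limits(1) tendsto_const] by (intro AE_I2) fastforce
  show "AE x in lborel. norm (phi k x * Gz (u t x)) \<le> \<bar>Gz (u t x)\<bar>" for k
    using phi_bounds(1,2)[of k] by (intro AE_I2) (simp add: abs_mult mult_left_le_one_le)
qed

lemma energy_eq: "energy l1 l2 (u T) = (\<Sum>j\<in>UNIV. Kin j T) + Gtot T"
proof -
  have T: "T \<in> per T" using tau by simp
  have "norm (grad (u T) x) ^ 2 + l1 / 2 * cmod (u T x) ^ 4 - l2 / 3 * cmod (u T x) ^ 6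
     = (\<Sum>j\<in>UNIV. (cmod (du j T x))\<^sup>2) + Gz (u T x)" for x
    by (simp add: grad_def Gz_def norm_vec_def L2_set_def sum_nonneg)
  then show ?thesis
    unfolding energy_def Kin_def Gtot_def
    using difference_quotient.v1_square_integrable[OF dq[OF T]] edec_integrable[OF edec_gz(2)[OF edec_u]]
    by simp
qed

text \<open>Conservation of energy on the window: the derivative of \<open>W k\<close> tends to zero
  at each time because its two parts have opposite limits, and the uniform bounds allow integration
  from \<open>T\<close> to \<open>t\<close>.\<close>

lemma W_limit:
  assumes t: "t \<in> per T"
  shows "(\<lambda>k. W k t) \<longlonglongrightarrow> energy l1 l2 (u T)"
proof -
  have T: "T \<in> per T" using tau by simp
  obtain c where c: "c > 0" "\<And>j t k. t \<in> per T \<Longrightarrow> \<bar>J k j t\<bar> \<le> c * (mass t + M)"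
    "\<And>j t. t \<in> per T \<Longrightarrow> (\<lambda>k. J k j t) \<longlonglongrightarrow> (LBINT x. dg j t x * cur j t x)"
    using J_limit_bound by blast
  obtain L where L: "L > 0" "\<And>j s t. \<bar>K j s t\<bar> \<le> L * Q j s t" using K_bound by blast
  let ?D = "\<lambda>k t. \<Sum>j\<in>UNIV. - 2 * (K j (sk k) t / (sk k)\<^sup>2) + 2 * J k j t"
  have I: "(?D k has_integral W k t - W k T) {T..t}" for k
    using t W_derivative
    by (intro fundamental_theorem_of_calculus) (auto simp: has_real_derivative_iff_has_vector_derivative intro: has_vector_derivative_at_within)
  have "(\<lambda>k. integral {T..t} (?D k)) \<longlonglongrightarrow> integral {T..t} (\<lambda>_. 0)"
  proof (rule dominated_convergence(2)[where h = "\<lambda>t. \<Sum>j\<in>(UNIV::'n set). 2 * (L * M) + 2 * (c * (mass t + M))"])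
    show "?D k integrable_on {T..t}" for k using I by (rule has_integral_integrable)
    show "(\<lambda>t. \<Sum>j\<in>(UNIV::'n set). 2 * (L * M) + 2 * (c * (mass t + M))) integrable_on {T..t}"
      by (intro integrable_continuous_real continuous_intros tot_cont)
    fix r assume "r \<in> {T..t}"
    then have r: "r \<in> per T" using t by auto
    show "norm (?D k r) \<le> (\<Sum>j\<in>(UNIV::'n set). 2 * (L * M) + 2 * (c * (mass r + M)))" for k
    proof (rule sum_norm_le)
      fix j :: 'n
      have "\<bar>K j (sk k) r / (sk k)\<^sup>2\<bar> \<le> L * (Q j (sk k) r / (sk k)\<^sup>2)"
        unfolding abs_divide using L(2)[of j "sk k" r] by (simp add: divide_right_mono)
      also have "\<dots> \<le> L * M" using quotient_le[OF r] L(1) by (intro mult_left_mono) auto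
      finally show "norm (- 2 * (K j (sk k) r / (sk k)\<^sup>2) + 2 * J k j r) \<le> 2 * (L * M) + 2 * (c * (mass r + M))"
        using c(2)[OF r, of k j] unfolding real_norm_def by linarith
    qed
    have "(\<lambda>k. ?D k r) \<longlonglongrightarrow> (\<Sum>j\<in>UNIV. - 2 * (LBINT x. dg j r x * cur j r x) + 2 * (LBINT x. dg j r x * cur j r x))"
      by (intro tendsto_sum tendsto_add tendsto_mult tendsto_const K_quotient_limit[OF r] c(3)[OF r])
    then show "(\<lambda>k. ?D k r) \<longlonglongrightarrow> 0" by simp
  qed
  then have 1: "(\<lambda>k. W k t - W k T) \<longlonglongrightarrow> 0" using integral_unique[OF I] by simp
  have "(\<lambda>k. W k T) \<longlonglongrightarrow> (\<Sum>j\<in>UNIV. Kin j T) + Gtot T"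
    unfolding W_def by (intro tendsto_add tendsto_sum Q_quotient_limit[OF T] P_limit)
  from tendsto_add[OF 1 this] show ?thesis unfolding energy_eq by simp
qed

text \<open>The period integral of \<open>W k\<close> is evaluated in two ways. By conservation it
  tends to \<tau> times the energy; by \<open>q_limit\<close> each of the n directions contributes
  minus half the integral of \<open>Htot\<close>, and the potential part contributes the integral of
  \<open>Gtot\<close>.\<close>

lemma energy_virial:
  "\<tau> * energy l1 l2 (u T) = integral (per T) Gtot - real CARD('n) / 2 * integral (per T) Htot"
proof -
  have Pc: "continuous_on A (P k)" for A k
    by (rule DERIV_continuous_on) (rule DERIV_subset[OF P_derivative subset_UNIV])
  have iP: "P k integrable_on (per T)" for k by (rule integrable_continuous_real[OF Pc])
  have iQ: "(\<lambda>t. Q j (sk k) t / (sk k)\<^sup>2) integrable_on (per T)" for j k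
    unfolding divide_inverse by (rule integrable_on_mult_left[OF Q_integrable])
  have W_int: "W k integrable_on (per T)" for k
    unfolding W_def[abs_def] by (intro integrable_add integrable_sum iQ iP) auto
  have "(\<lambda>k. integral (per T) (W k)) \<longlonglongrightarrow> integral (per T) (\<lambda>_. energy l1 l2 (u T))"
  proof (rule dominated_convergence(2)[where h = "\<lambda>t. real CARD('n) * M + Gabs t"])
    show "(\<lambda>t. real CARD('n) * M + Gabs t) integrable_on (per T)"
      by (intro integrable_continuous_real continuous_intros tot_cont)
    fix t assume t: "t \<in> per T"
    show "(\<lambda>k. W k t) \<longlonglongrightarrow> energy l1 l2 (u T)" by (rule W_limit[OF t])
    show "norm (W k t) \<le> real CARD('n) * M + Gabs t" for k
    proof -
      have "(\<Sum>j\<in>(UNIV::'n set). Q j (sk k) t / (sk k)\<^sup>2) \<le> (\<Sum>j\<in>(UNIV::'n set). M)"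
        by (intro sum_mono quotient_le t)
      moreover have "(\<Sum>j\<in>(UNIV::'n set). Q j (sk k) t / (sk k)\<^sup>2) \<ge> 0"
        by (intro sum_nonneg divide_nonneg_nonneg Q_nonneg) auto
      ultimately show ?thesis using P_le[of k t] by (simp add: W_def)
    qed
  qed (rule W_int)
  then have 1: "(\<lambda>k. integral (per T) (W k)) \<longlonglongrightarrow> \<tau> * energy l1 l2 (u T)" using tau by simp
  have "integral (per T) (W k) = (\<Sum>j\<in>UNIV. q j T (sk k) / (sk k)\<^sup>2) + integral (per T) (P k)" for k
  proof -
    have "integral (per T) (\<lambda>t. Q j (sk k) t / (sk k)\<^sup>2) = q j T (sk k) / (sk k)\<^sup>2" for j
      by (simp add: q_def)
    moreover have "integral (per T) (W k) = (\<Sum>j\<in>UNIV. integral (per T) (\<lambda>t. Q j (sk k) t / (sk k)\<^sup>2)) + integral (per T) (P k)"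
      unfolding W_def[abs_def]
      by (subst Henstock_Kurzweil_Integration.integral_add[OF integrable_sum iP])
         (auto intro: iQ simp: Henstock_Kurzweil_Integration.integral_sum iQ)
    ultimately show ?thesis by (simp only:)
  qed
  moreover have "(\<lambda>k. (\<Sum>j\<in>UNIV. q j T (sk k) / (sk k)\<^sup>2) + integral (per T) (P k)) \<longlonglongrightarrow>
      (\<Sum>j\<in>(UNIV::'n set). - integral (per T) Htot / 2) + integral (per T) Gtot"
  proof (intro tendsto_add tendsto_sum q_limit sk)
    show "(\<lambda>k. integral (per T) (P k)) \<longlonglongrightarrow> integral (per T) Gtot"
      by (rule dominated_convergence(2)[where h = Gabs])
         (auto intro: iP P_limit P_le integrable_continuous_real tot_cont)
  qed
  ultimately have "(\<lambda>k. integral (per T) (W k)) \<longlonglongrightarrow>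
      (\<Sum>j\<in>(UNIV::'n set). - integral (per T) Htot / 2) + integral (per T) Gtot" by simp
  from LIMSEQ_unique[OF 1 this] show ?thesis by simp
qed

end

section \<open>Positivity of the moments and sign of the energy\<close>

context cqnls_decay
begin

lemma periodic_multiple: "u (t + of_int k * \<tau>) x = u t x"
proof -
  have n: "u (t + of_nat n * \<tau>) x = u t x" for n t
  proof (induction n)
    case (Suc n)
    have "u (t + of_nat (Suc n) * \<tau>) x = u ((t + of_nat n * \<tau>) + \<tau>) x" by (simp add: algebra_simps)
    then show ?case using Suc by (simp add: periodic)
  qed simp
  show ?thesis
  proof (cases "k \<ge> 0")
    case True
    then show ?thesis using n[of t "nat k"] by simp
  next
    case False
    then show ?thesis using n[of "t + of_int k * \<tau>" "nat (- k)"] by simp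
  qed
qed

definition mom :: "nat \<Rightarrow> real \<Rightarrow> real" where
  "mom p t = (LBINT x. cmod (u t x) ^ p)"

lemma mom_edec: "p > 0 \<Longrightarrow> edec (\<lambda>t x. cmod (u t x) ^ p)"
  by (intro edec_power edec_norm edec_u)

lemma mom_cont: "p > 0 \<Longrightarrow> continuous_on A (mom p)"
  unfolding mom_def by (intro edec_continuous_integral mom_edec)

lemma mom_pos:
  assumes nz: "u t x \<noteq> 0" and p: "p > 0"
  shows "integral (per T) (mom p) > 0"
proof -
  have nn: "mom p t \<ge> 0" for t unfolding mom_def by (intro Bochner_Integration.integral_nonneg) auto
  \<comment> \<open>Translate of \<open>t\<close> by whole periods into the window, the only times
    that the integral sees.\<close>
  define t1 where "t1 = t + of_int (- \<lfloor>(t - T) / \<tau>\<rfloor>) * \<tau>"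
  have "of_int \<lfloor>(t - T) / \<tau>\<rfloor> * \<tau> \<le> t - T" "t - T < (of_int \<lfloor>(t - T) / \<tau>\<rfloor> + 1) * \<tau>"
    by (subst pos_le_divide_eq[OF tau, symmetric], rule of_int_floor_le)
       (subst pos_divide_less_eq[OF tau, symmetric], linarith)
  then have t1: "t1 \<in> per T" by (simp add: t1_def algebra_simps)
  have "u t1 x \<noteq> 0" using nz unfolding t1_def periodic_multiple .
  then have "mom p t1 > 0" unfolding mom_def
    by (intro integral_continuous_pos[where ?x0.0 = x] edec_integrable[OF mom_edec[OF p]] continuous_intros u_space_cont) auto
  then have "integral (per T) (mom p) \<noteq> 0"
    using integral_eq_0_iff[OF mom_cont[OF p], of T "T + \<tau>"] nn t1 tau by force
  moreover have "integral (per T) (mom p) \<ge> 0"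
    by (intro Henstock_Kurzweil_Integration.integral_nonneg integrable_continuous_real mom_cont p nn)
  ultimately show ?thesis by simp
qed

text \<open>In G - (n/2) H the sextic parts cancel for n = 1, leaving l1/4 times the quartic moment,
  and the quartic parts cancel for n = 2, leaving l2/3 times the sextic moment. Multiplication by
  the same parameter makes the coefficient a positive square.\<close>

lemma energy_sign:
  assumes l: "l1 \<noteq> 0" "l2 \<noteq> 0" and nz: "u t x \<noteq> 0"
  shows "CARD('n) = 1 \<Longrightarrow> l1 * energy l1 l2 (u T) > 0" "CARD('n) = 2 \<Longrightarrow> l2 * energy l1 l2 (u T) > 0"
proof -
  obtain s0 M where s0: "0 < s0" "s0 \<le> 1" "M > 0"
    "\<And>j t s. 0 \<le> s \<Longrightarrow> s \<le> s0 \<Longrightarrow> T \<le> t \<Longrightarrow> t \<le> T + \<tau> \<Longrightarrow> Q j s t \<le> M * s\<^sup>2"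
    using Q_quadratic[of T] by metis
  interpret cqnls_window l1 l2 \<tau> u ut T s0 M by unfold_locales (use s0 in auto)
  let ?A = "integral (per T) (mom 4)" and ?B = "integral (per T) (mom 6)"
  have i: "mom 4 integrable_on (per T)" "mom 6 integrable_on (per T)"
    by (intro integrable_continuous_real mom_cont; simp)+
  have m: "integrable lborel (\<lambda>x. cmod (u t x) ^ 4)" "integrable lborel (\<lambda>x. cmod (u t x) ^ 6)" for t
    by (rule edec_integrable[OF mom_edec]; simp)+
  have lin: "integral (per T) (\<lambda>t. a * mom 4 t - b * mom 6 t) = a * ?A - b * ?B" for a b
    using i by (subst Henstock_Kurzweil_Integration.integral_diff) (auto intro: integrable_on_mult_right)
  have "Gtot = (\<lambda>t. l1 / 2 * mom 4 t - l2 / 3 * mom 6 t)"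
    unfolding Gtot_def Gz_def mom_def using m by simp
  then have G: "integral (per T) Gtot = l1 / 2 * ?A - l2 / 3 * ?B" using lin[of "l1 / 2" "l2 / 3"] by (simp only:)
  have "Htot = (\<lambda>t. l1 / 2 * mom 4 t - 2 * l2 / 3 * mom 6 t)"
    unfolding Htot_def Hz_def mom_def using m by simp
  then have H: "integral (per T) Htot = l1 / 2 * ?A - 2 * l2 / 3 * ?B" using lin[of "l1 / 2" "2 * l2 / 3"] by (simp only:)
  have A: "?A > 0" and B: "?B > 0" by (rule mom_pos[OF nz]; simp)+
  note E = energy_virial[unfolded G H]
  show "l1 * energy l1 l2 (u T) > 0" if "CARD('n) = 1"
  proof -
    have "\<tau> * energy l1 l2 (u T) = l1 / 4 * ?A" using E that by (simp add: field_simps)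
    then have "\<tau> * (l1 * energy l1 l2 (u T)) = (l1 * l1) / 4 * ?A" by (simp add: mult.left_commute)
    moreover have "\<dots> > 0" by (rule mult_pos_pos[OF divide_pos_pos[OF _ zero_less_numeral] A]) (use l not_real_square_gt_zero in blast)
    ultimately have "0 < \<tau> * (l1 * energy l1 l2 (u T))" by (simp only:)
    then show ?thesis by (rule zero_less_mult_pos[OF _ tau])
  qed
  show "l2 * energy l1 l2 (u T) > 0" if "CARD('n) = 2"
  proof -
    have "\<tau> * energy l1 l2 (u T) = l2 / 3 * ?B" using E that by (simp add: field_simps)
    then have "\<tau> * (l2 * energy l1 l2 (u T)) = (l2 * l2) / 3 * ?B" by (simp add: mult.left_commute)
    moreover have "\<dots> > 0" by (rule mult_pos_pos[OF divide_pos_pos[OF _ zero_less_numeral] B]) (use l not_real_square_gt_zero in blast)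
    ultimately have "0 < \<tau> * (l2 * energy l1 l2 (u T))" by (simp only:)
    then show ?thesis by (rule zero_less_mult_pos[OF _ tau])
  qed
qed

end

theorem theorem4p2:
  fixes l1 l2 t0 :: real and u :: "real \<Rightarrow> real ^ 'n::finite \<Rightarrow> complex"
  assumes "l1 * l2 > 0"
    and "cqnls_solution l1 l2 u"
    and "momentum (u t0) = 0"
    and "(CARD('n) = 1 \<and> l1 * energy l1 l2 (u t0) \<le> 0) \<or>
         (CARD('n) = 2 \<and> l2 * energy l1 l2 (u t0) \<le> 0)"
  shows "\<not> breather l1 l2 u"
proof
  assume br: "breather l1 l2 u"
  obtain t x where nz: "u t x \<noteq> 0" using br by (auto simp: breather_def)
  obtain \<tau> C \<gamma> m where tau: "\<tau> > 0" and C: "C > 0" "\<gamma> > 0"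
    and per: "\<And>t x. u (t + \<tau>) x = u t x"
    and dec: "\<And>\<alpha> x t. length \<alpha> \<le> m \<Longrightarrow> cmod (deriv_along \<alpha> (u t) x) \<le> C * exp (- \<gamma> * norm x)"
    using br unfolding breather_def by metis
  obtain ut where C2: "\<And>t. Ck 2 (u t)"
    and ut: "\<And>t x. ((\<lambda>s. u s x) has_vector_derivative ut t x) (at t)" "continuous_on UNIV (\<lambda>(t, x). ut t x)"
    and eq: "\<And>t x. \<i> * ut t x + laplacian (u t) x =
             of_real (l1 * cmod (u t x) ^ 2) * u t x - of_real (l2 * cmod (u t x) ^ 4) * u t x"
    using assms(2) unfolding cqnls_solution_def by blast
  \<comment> \<open>The empty multi-index is admissible for every \<open>m\<close> and gives the
    decay of \<open>u\<close> itself.\<close>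
  have "\<And>t x. cmod (u t x) \<le> C * exp (- \<gamma> * norm x)"
    using dec[of "[]"] by (simp add: deriv_along_def)
  then interpret cqnls_decay l1 l2 \<tau> u ut
    by unfold_locales (use tau per C2 ut eq C in \<open>auto intro: exI[of _ C] exI[of _ \<gamma>]\<close>)
  have "l1 \<noteq> 0" "l2 \<noteq> 0" using assms(1) by auto
  \<comment> \<open>The window is chosen to start at \<open>t0\<close>, so that the sign concerns
    exactly the energy in the hypothesis.\<close>
  then show False using energy_sign[OF _ _ nz, of t0] assms(4) by auto
qed

end
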